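(* Let $j,k,r,n$ be positive integers with $j,k\ge2$. Let $\mathcal{G}_{j,k,r}$ be the multigraph whose vertices are the $r\times(k-1)$ integer matrices $A=(A_{i\ell})$ with $j>A_{i,1}\ge A_{i,2}\ge\dots\ge A_{i,k-1}\ge0$ for each $i\in[r]$, and in which the number $e(A,A')$ of undirected edges between $A$ and $A'$ is: $1$ if $A-A'=\pm E_{i\ell}$ or $A-A'=E_{i\ell}-E_{i'\ell'}$ for some $(i,\ell)\ne(i',\ell')$, where $E_{i\ell}$ is the matrix with $1$ in position $(i,\ell)$ and $0$ elsewhere; $1+d_1+\dots+d_r$ loops if $A=A'$, where $d_i$ is the number of distinct entries in row $i$ of $A$ that are less than $j-1$; and $0$ otherwise. Then the number $\mathrm{NCN}_{j,k}(n,r)$ of $r$-colored partitions $\Lambda$ of $[n]$ with $\mathrm{cr}(\Lambda)<j$ and $\mathrm{ne}(\Lambda)<k$ equals the number of $(n-1)$-step walks in $\mathcal{G}_{j,k,r}$ beginning and ending at the zero matrix (walks being sequences of edges, with parallel edges and loops counted as distinct).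
   Context: For a partition $P$ of $[n]=\{1,\dots,n\}$, $\mathrm{Arc}(P)$ is the set of pairs $(i,j)$ with $i,j$ in the same block and $j$ the least element of that block greater than $i$. A $k$-crossing is a sequence of arcs with $i_1<\dots<i_k<j_1<\dots<j_k$, a $k$-nesting one with $i_1<\dots<i_k<j_k<\dots<j_1$. An $r$-colored partition is $\Lambda=(P,\varphi)$ with $\varphi:\mathrm{Arc}(P)\to[r]$; $\mathrm{cr}(\Lambda)$ ($\mathrm{ne}(\Lambda)$) is the largest $k$ such that $P$ has a $k$-crossing ($k$-nesting) whose arcs all have the same color. *)

theory Defs
  imports
    "HOL-Library.Disjoint_Sets"
    "HOL-Library.FuncSet"
    "Jordan_Normal_Form.Matrix"
begin

definition arcs :: "nat set set \<Rightarrow> (nat \<times> nat) set" where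
  "arcs P = {(a, b). \<exists>B\<in>P. a \<in> B \<and> b \<in> B \<and> a < b \<and> (\<forall>m\<in>B. a < m \<longrightarrow> b \<le> m)}"

text \<open>A sequence of arcs (i1,j1), ..., (im,jm) is a crossing iff the list
  i1, ..., im, j1, ..., jm is strictly increasing, and a nesting iff
  i1, ..., im, jm, ..., j1 is.\<close>

definition is_crossing :: "nat set set \<Rightarrow> (nat \<times> nat) list \<Rightarrow> bool" where
  "is_crossing P as \<longleftrightarrow> set as \<subseteq> arcs P \<and> sorted_wrt (<) (map fst as @ map snd as)"

definition is_nesting :: "nat set set \<Rightarrow> (nat \<times> nat) list \<Rightarrow> bool" where
  "is_nesting P as \<longleftrightarrow> set as \<subseteq> arcs P \<and> sorted_wrt (<) (map fst as @ rev (map snd as))"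

type_synonym coloring = "nat \<times> nat \<Rightarrow> nat"

definition colored_partitions :: "nat \<Rightarrow> nat \<Rightarrow> (nat set set \<times> coloring) set" where
  "colored_partitions n r = (SIGMA P:{P. partition_on {1..n} P}. arcs P \<rightarrow>\<^sub>E {1..r})"

definition monochromatic :: "coloring \<Rightarrow> (nat \<times> nat) list \<Rightarrow> bool" where
  "monochromatic \<phi> as \<longleftrightarrow> (\<exists>c. \<forall>a\<in>set as. \<phi> a = c)"

text \<open>The empty sequence is a 0-crossing and a 0-nesting, so both maxima range over
  nonempty sets; they are 0 exactly when the partition has no arcs.\<close>

definition cr :: "nat set set \<times> coloring \<Rightarrow> nat" where
  "cr \<Lambda> = Max {length as | as. is_crossing (fst \<Lambda>) as \<and> monochromatic (snd \<Lambda>) as}"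

definition ne :: "nat set set \<times> coloring \<Rightarrow> nat" where
  "ne \<Lambda> = Max {length as | as. is_nesting (fst \<Lambda>) as \<and> monochromatic (snd \<Lambda>) as}"

definition NCN :: "nat \<Rightarrow> nat \<Rightarrow> nat \<Rightarrow> nat \<Rightarrow> nat" where
  "NCN j k n r = card {\<Lambda> \<in> colored_partitions n r. cr \<Lambda> < j \<and> ne \<Lambda> < k}"

text \<open>Undirected multigraphs: an edge with endpoints u and v has the endpoint set {u, v},
  which is a singleton for a loop.\<close>

record ('v, 'e) multigraph =
  verts :: "'v set"
  edges :: "'e set"
  ends :: "'e \<Rightarrow> 'v set"

fun walk :: "('v, 'e) multigraph \<Rightarrow> 'v \<Rightarrow> 'e list \<Rightarrow> 'v \<Rightarrow> bool" where
  "walk G u [] v \<longleftrightarrow> u \<in> verts G \<and> u = v"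
| "walk G u (e # es) v \<longleftrightarrow>
     u \<in> verts G \<and> e \<in> edges G \<and> (\<exists>w. ends G e = {u, w} \<and> walk G w es v)"

definition elem_mat :: "nat \<Rightarrow> nat \<Rightarrow> nat \<Rightarrow> nat \<Rightarrow> int mat" where
  "elem_mat nr nc i l = mat nr nc (\<lambda>p. if p = (i, l) then 1 else 0)"

text \<open>Rows and columns are numbered from 0, so the columns are 0, ..., k - 2;
  everything below is meant for k at least 2.\<close>

definition G_verts :: "nat \<Rightarrow> nat \<Rightarrow> nat \<Rightarrow> int mat set" where
  "G_verts j k r = {A \<in> carrier_mat r (k - 1). \<forall>i<r.
     int j > A $$ (i, 0) \<and> (\<forall>l. l + 1 < k - 1 \<longrightarrow> A $$ (i, l) \<ge> A $$ (i, l + 1)) \<and>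
     A $$ (i, k - 2) \<ge> 0}"

definition G_adj :: "nat \<Rightarrow> nat \<Rightarrow> int mat \<Rightarrow> int mat \<Rightarrow> bool" where
  "G_adj k r A A' \<longleftrightarrow>
     (\<exists>i<r. \<exists>l<k - 1. A - A' = elem_mat r (k - 1) i l \<or> A - A' = - elem_mat r (k - 1) i l) \<or>
     (\<exists>i<r. \<exists>l<k - 1. \<exists>i'<r. \<exists>l'<k - 1. (i, l) \<noteq> (i', l') \<and>
        A - A' = elem_mat r (k - 1) i l - elem_mat r (k - 1) i' l')"

definition G_mult :: "nat \<Rightarrow> nat \<Rightarrow> nat \<Rightarrow> int mat \<Rightarrow> int mat \<Rightarrow> nat" where
  "G_mult j k r A A' =
     (if A = A' then 1 + (\<Sum>i<r. card {A $$ (i, l) | l. l < k - 1 \<and> A $$ (i, l) < int j - 1})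
      else if G_adj k r A A' then 1 else 0)"

lemma G_adj_sym:
  assumes "A \<in> carrier_mat r (k - 1)" "A' \<in> carrier_mat r (k - 1)" "G_adj k r A A'"
  shows "G_adj k r A' A"
proof -
  have eq: "A' - A = - (A - A')"
    using assms(1,2) by (intro eq_matI) auto
  have neg: "- (elem_mat r (k - 1) i l - elem_mat r (k - 1) i' l')
      = elem_mat r (k - 1) i' l' - elem_mat r (k - 1) i l" for i l i' l'
    by (intro eq_matI) (auto simp: elem_mat_def)
  show ?thesis
    using assms(3) unfolding G_adj_def eq by (metis neg uminus_uminus_mat)
qed

lemma G_mult_sym:
  assumes "A \<in> G_verts j k r" "A' \<in> G_verts j k r"
  shows "G_mult j k r A A' = G_mult j k r A' A"
  using assms G_adj_sym[of A r k A'] G_adj_sym[of A' r k A]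
  by (auto simp: G_mult_def G_verts_def)

text \<open>The edges between A and A' are the pairs ({A, A'}, t) with t below their number;
  this is well defined because the number of edges is symmetric in A and A'.\<close>

definition G_graph :: "nat \<Rightarrow> nat \<Rightarrow> nat \<Rightarrow> (int mat, int mat set \<times> nat) multigraph" where
  "G_graph j k r =
     \<lparr> verts = G_verts j k r,
       edges = {({A, A'}, t) | A A' t. A \<in> G_verts j k r \<and> A' \<in> G_verts j k r \<and>
                  t < G_mult j k r A A'},
       ends = fst \<rparr>"

end

theory Submission
  imports Defs "HOL-Library.Sublist"
begin

text \<open>At each time t list, for every colour, the openers at most t of the arcs with closer greater
  than t, in decreasing order of the closers. Going from t to t - 1 deletes the greatest possible
  entry t, if present, and then possibly appends the opener of the arc closing at t. Under row
  insertion the first operation removes a corner and the second adds a box, and both can be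
  reversed once the shapes are known, so arc diagrams correspond to sequences of families of Young
  diagrams in which one box may be removed and then one box may be added at each time. By
  Schensted's theorem the bounds on crossings and nestings say that all these shapes fit into a
  rectangle with j - 1 rows and k - 1 columns. Regrouping the steps (n times: remove, then add;
  the first and the last half step are forced) gives n - 1 steps of the form: add at most one
  box, then remove at most one box. The number of intermediate shapes of such a step is the
  edge multiplicity in the graph.\<close>

section \<open>Row insertion\<close>

definition bump :: "'a::linorder set \<Rightarrow> 'a \<Rightarrow> 'a option" where
  "bump R x = (if \<exists>y\<in>R. x < y then Some (Min {y \<in> R. x < y}) else None)"

definition row_insert :: "'a::linorder set \<Rightarrow> 'a \<Rightarrow> 'a set" where
  "row_insert R x = insert x (R - set_option (bump R x))"

text \<open>The entries of two adjacent rows increase downwards in every column, expressed without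
  sorting the rows.\<close>

definition columns_increase :: "'a::linorder set \<Rightarrow> 'a set \<Rightarrow> bool" where
  "columns_increase R S \<longleftrightarrow> (\<forall>v. card (S \<inter> {..v}) \<le> card (R \<inter> {..v}))"

lemma bump_None_iff: "bump R x = None \<longleftrightarrow> (\<forall>y\<in>R. y \<le> x)"
  unfolding bump_def by (auto simp: not_le)

lemma bump_Some_iff:
  assumes "finite R"
  shows "bump R x = Some y \<longleftrightarrow> y \<in> R \<and> x < y \<and> (\<forall>z\<in>R. x < z \<longrightarrow> y \<le> z)"
proof -
  have "Min {z \<in> R. x < z} = y \<longleftrightarrow> y \<in> R \<and> x < y \<and> (\<forall>z\<in>R. x < z \<longrightarrow> y \<le> z)"
    if "\<exists>z\<in>R. x < z"
    using that assms by (subst Min_eq_iff) auto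
  then show ?thesis by (auto simp: bump_def)
qed

lemma row_insert_None: "bump R x = None \<Longrightarrow> row_insert R x = insert x R"
  by (simp add: row_insert_def)

lemma row_insert_Some: "bump R x = Some y \<Longrightarrow> row_insert R x = insert x (R - {y})"
  by (simp add: row_insert_def)

lemma finite_row_insert [simp]: "finite (row_insert R x) \<longleftrightarrow> finite R"
  by (cases "bump R x") (auto simp: row_insert_def)

lemma card_row_insert_atMost:
  assumes "finite R" "x \<notin> R"
  shows "card (row_insert R x \<inter> {..v}) =
    card (R \<inter> {..v}) + of_bool (x \<le> v \<and> (\<forall>y. bump R x = Some y \<longrightarrow> v < y))"
proof (cases "bump R x")
  case None
  then show ?thesis using assms by (auto simp: row_insert_None)
next
  case (Some y)
  have bumped: "y \<in> R" "x < y" using Some bump_Some_iff[OF assms(1)] by auto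
  consider (before) "v < x" | (between) "x \<le> v" "v < y" | (after) "y \<le> v" "x \<le> v"
    using bumped(2) by force
  then show ?thesis
  proof cases
    case before
    then have "row_insert R x \<inter> {..v} = R \<inter> {..v}"
      using bumped by (auto simp: row_insert_Some[OF Some])
    then show ?thesis using before by auto
  next
    case between
    then have "row_insert R x \<inter> {..v} = insert x (R \<inter> {..v})"
      by (auto simp: row_insert_Some[OF Some])
    then show ?thesis using between Some assms by simp
  next
    case after
    then have inserted: "row_insert R x \<inter> {..v} = insert x (R \<inter> {..v} - {y})"
      by (auto simp: row_insert_Some[OF Some])
    have "card (insert x (R \<inter> {..v} - {y})) = Suc (card (R \<inter> {..v} - {y}))"
      using assms by simp
    also have "\<dots> = card (R \<inter> {..v})" using after bumped assms by (intro card_Suc_Diff1) auto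
    finally show ?thesis using inserted after Some by (simp add: leD)
  qed
qed

lemma card_row_insert:
  assumes "finite R" "x \<notin> R"
  shows "card (row_insert R x) = card R + of_bool (bump R x = None)"
proof (cases "bump R x")
  case None
  then show ?thesis using assms by (simp add: row_insert_None)
next
  case (Some y)
  then show ?thesis using assms bump_Some_iff[OF assms(1), of x y] card_Suc_Diff1[of R y]
    by (simp add: row_insert_Some)
qed

lemma row_insert_inj:
  assumes "finite R" "finite S" "x \<notin> R" "y \<notin> S" "bump R x = bump S y"
    and "row_insert R x = row_insert S y"
  shows "R = S \<and> x = y"
proof -
  have inserted_le: "x \<le> y"
    if "finite R" "finite S" "bump R x = bump S y" "x \<in> row_insert S y" for R S :: "'a set" and x y
  proof (cases "bump S y")
    case None
    then show ?thesis using that(4) by (auto simp: row_insert_None bump_None_iff)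
  next
    case (Some p)
    then have "x < p" "x = y \<or> x \<in> S" "\<And>z. z \<in> S \<Longrightarrow> y < z \<Longrightarrow> p \<le> z"
      using that bump_Some_iff[OF that(1), of x p] bump_Some_iff[OF that(2), of y p]
      by (auto simp: row_insert_Some)
    then show ?thesis by (metis leD not_le_imp_less order_refl)
  qed
  have "x \<in> row_insert S y" "y \<in> row_insert R x" using assms(6) by (auto simp: row_insert_def)
  then have "x = y" using inserted_le[of R S x y] inserted_le[of S R y x] assms(1,2,5) by simp
  then have "R - set_option (bump R x) = S - set_option (bump R x)"
    using assms(3-6) by (simp add: row_insert_def insert_ident)
  moreover have "set_option (bump R x) \<subseteq> R" "set_option (bump R x) \<subseteq> S"
    using assms(1,2,5) by (auto simp: bump_Some_iff)
  ultimately show ?thesis using \<open>x = y\<close> by blast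
qed

lemma columns_increase_lessThan:
  assumes "columns_increase R S" "finite R" "finite S"
  shows "card (S \<inter> {..<v}) \<le> card (R \<inter> {..<v})"
proof (cases "S \<inter> {..<v} = {}")
  case False
  define m where "m = Max (S \<inter> {..<v})"
  have "m < v" using Max_in[of "S \<inter> {..<v}"] False assms(3) by (simp add: m_def)
  then have "S \<inter> {..<v} = S \<inter> {..m}" using assms(3) by (auto simp: m_def)
  also have "card \<dots> \<le> card (R \<inter> {..m})" using assms(1) by (simp add: columns_increase_def)
  also have "\<dots> \<le> card (R \<inter> {..<v})" using assms(2) \<open>m < v\<close> by (intro card_mono) auto
  finally show ?thesis .
qed simp

lemma columns_increase_card:
  assumes "columns_increase R S" "finite R" "finite S"
  shows "card S \<le> card R"
proof (cases "S = {}")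
  case False
  have "S = S \<inter> {..Max S}" using assms(3) by auto
  then have "card S \<le> card (R \<inter> {..Max S})" using assms(1) unfolding columns_increase_def by metis
  also have "\<dots> \<le> card R" using assms(2) by (intro card_mono) auto
  finally show ?thesis .
qed simp

text \<open>A bumped entry y was counted in the upper row from the threshold y on, so there the lower
  row had at least one entry less and can take y.\<close>

lemma columns_increase_row_insert:
  assumes "finite R" "finite S" "x \<notin> R" "y \<notin> S" "bump R x = Some y" "columns_increase R S"
  shows "columns_increase (row_insert R x) (row_insert S y)"
  unfolding columns_increase_def
proof
  fix v
  have bumped: "y \<in> R" using assms(5) by (simp add: bump_Some_iff[OF assms(1)])
  have columns: "card (S \<inter> {..v}) \<le> card (R \<inter> {..v})"
    using assms(6) by (simp add: columns_increase_def)
  show "card (row_insert S y \<inter> {..v}) \<le> card (row_insert R x \<inter> {..v})"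
  proof (cases "y \<le> v \<and> (\<forall>z. bump S y = Some z \<longrightarrow> v < z)")
    case True
    have le_bumped: "z \<le> y" if "z \<in> S" "z \<le> v" for z
    proof (cases "bump S y")
      case None
      then show ?thesis using that by (simp add: bump_None_iff)
    next
      case (Some u)
      then have "v < u" using True by blast
      then show ?thesis using Some that bump_Some_iff[OF assms(2), of y u] by fastforce
    qed
    have "S \<inter> {..v} = S \<inter> {..<y}"
      using True assms(4) by (auto simp: order.strict_iff_order intro: le_bumped)
    also have "card \<dots> \<le> card (R \<inter> {..<y})" using assms by (intro columns_increase_lessThan)
    also have "\<dots> < card (R \<inter> {..v})" using bumped True assms(1) by (intro psubset_card_mono) force+
    finally show ?thesis
      using True card_row_insert_atMost[OF assms(1,3), of v]
        card_row_insert_atMost[OF assms(2,4), of v]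
      by simp
  next
    case False
    then show ?thesis
      using columns card_row_insert_atMost[OF assms(1,3), of v]
        card_row_insert_atMost[OF assms(2,4), of v]
      by (auto simp: of_bool_def)
  qed
qed

lemma columns_increase_row_insertD:
  assumes "finite R" "finite S" "x \<notin> R" "y \<notin> S" "bump R x = Some y"
    and "columns_increase (row_insert R x) (row_insert S y)"
  shows "columns_increase R S"
  unfolding columns_increase_def
proof
  fix v
  let ?R' = "row_insert R x" and ?S' = "row_insert S y"
  note card_upper = card_row_insert_atMost[OF assms(1,3)]
  have bumped: "y \<in> R" "x < y" "\<And>z. z \<in> R \<Longrightarrow> x < z \<Longrightarrow> y \<le> z"
    using assms(5) by (auto simp: bump_Some_iff[OF assms(1)])
  have columns: "card (?S' \<inter> {..w}) \<le> card (?R' \<inter> {..w})" for w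
    using assms(6) by (simp add: columns_increase_def)
  have "card (S \<inter> {..v}) \<le> card (?S' \<inter> {..v})"
    using card_row_insert_atMost[OF assms(2,4), of v] by simp
  moreover have "card (?S' \<inter> {..v}) < card (?R' \<inter> {..v})" if in_gap: "x \<le> v" "v < y"
  proof -
    have "y \<in> ?S' \<inter> {..y} - {..v}" using in_gap(2) by (simp add: row_insert_def)
    then have "?S' \<inter> {..v} \<subset> ?S' \<inter> {..y}" using in_gap(2) by auto
    then have "card (?S' \<inter> {..v}) < card (?S' \<inter> {..y})"
      using assms(2) by (intro psubset_card_mono) auto
    also have "\<dots> \<le> card (?R' \<inter> {..y})" by (rule columns)
    also have "?R' \<inter> {..y} = ?R' \<inter> {..v}"
      using in_gap bumped by (force simp: row_insert_Some[OF assms(5)])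
    finally show ?thesis .
  qed
  ultimately show "card (S \<inter> {..v}) \<le> card (R \<inter> {..v})"
    using columns[of v] card_upper[of v] assms(5) by (cases "x \<le> v \<and> v < y") auto
qed

lemma row_insert_reverse:
  assumes "finite R'" "columns_increase R' S" "finite S" "y \<in> S" "y \<notin> R'"
  obtains x R where "x \<in> R'" "R = insert y (R' - {x})" "x \<notin> R" "bump R x = Some y"
    "row_insert R x = R'"
proof -
  define X where "X = R' \<inter> {..<y}"
  have "0 < card (S \<inter> {..y})" using assms(3,4) by (auto simp: card_gt_0_iff)
  also have "\<dots> \<le> card (R' \<inter> {..y})" using assms(2) by (simp add: columns_increase_def)
  also have "R' \<inter> {..y} = X" using assms(5) by (auto simp: X_def order.strict_iff_order)
  finally have below: "finite X" "X \<noteq> {}" by (simp_all add: card_gt_0_iff)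
  define x where "x = Max X"
  have greatest_below: "x \<in> R'" "x < y" "\<And>z. z \<in> R' \<Longrightarrow> z < y \<Longrightarrow> z \<le> x"
    using Max_in[OF below] below(1) by (auto simp: x_def X_def)
  define R where "R = insert y (R' - {x})"
  have bumped: "bump R x = Some y"
    using greatest_below assms(1) by (subst bump_Some_iff) (force simp: R_def not_less[symmetric])+
  then have "row_insert R x = R'"
    using greatest_below(1) assms(5) by (auto simp: row_insert_Some R_def)
  with bumped greatest_below show thesis using that[of x R] by (simp add: R_def)
qed

lemma bump_delete_greatest:
  assumes "finite R" "\<And>y. y \<in> R \<Longrightarrow> y \<le> m"
  shows "bump (R - {m}) x = (if bump R x = Some m then None else bump R x)"
proof (cases "bump R x")
  case None
  then have "bump (R - {m}) x = None" by (simp add: bump_None_iff)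
  then show ?thesis using None by simp
next
  case (Some y)
  then have bumped: "y \<in> R" "x < y" "\<And>z. z \<in> R \<Longrightarrow> x < z \<Longrightarrow> y \<le> z"
    using bump_Some_iff[OF assms(1)] by auto
  show ?thesis
  proof (cases "y = m")
    case True
    have "bump (R - {m}) x = None" unfolding bump_None_iff using bumped(3) assms(2) True by force
    then show ?thesis using Some True by simp
  next
    case False
    then have "bump (R - {m}) x = Some y" using bumped assms(1) by (subst bump_Some_iff) auto
    then show ?thesis using Some False by simp
  qed
qed

lemma row_insert_delete_greatest:
  assumes "finite R" "\<And>y. y \<in> R \<Longrightarrow> y \<le> m" "x \<noteq> m"
  shows "row_insert (R - {m}) x = row_insert R x - {m}"
  using assms(3) bump_delete_greatest[OF assms(1,2)] by (auto simp: row_insert_def)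

section \<open>Tableaux\<close>

abbreviation (input) lower_rows :: "(nat \<Rightarrow> 'a) \<Rightarrow> nat \<Rightarrow> 'a" where
  "lower_rows T \<equiv> \<lambda>a. T (Suc a)"

abbreviation entries :: "(nat \<Rightarrow> 'a set) \<Rightarrow> 'a set" where
  "entries T \<equiv> \<Union>(range T)"

primrec tab_insert :: "(nat \<Rightarrow> 'a::linorder set) \<Rightarrow> 'a \<Rightarrow> nat \<Rightarrow> 'a set" where
  "tab_insert T x 0 = row_insert (T 0) x"
| "tab_insert T x (Suc a) =
     (case bump (T 0) x of None \<Rightarrow> T (Suc a) | Some y \<Rightarrow> tab_insert (lower_rows T) y a)"

definition tableau :: "(nat \<Rightarrow> 'a::linorder set) \<Rightarrow> bool" where
  "tableau T \<longleftrightarrow> finite (entries T) \<and> disjoint_family T \<and>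
     (\<forall>a. columns_increase (T a) (T (Suc a)))"

lemma tableau_finite: "tableau T \<Longrightarrow> finite (T a)"
  unfolding tableau_def by (meson UNIV_I UN_upper finite_subset)

lemma entries_lower_rows: "entries T = T 0 \<union> entries (lower_rows T)"
proof -
  have "T a \<subseteq> T 0 \<union> entries (lower_rows T)" for a by (cases a) auto
  then show ?thesis by blast
qed

lemma tableau_lower_rows_iff:
  "tableau T \<longleftrightarrow> finite (T 0) \<and> T 0 \<inter> entries (lower_rows T) = {} \<and>
    columns_increase (T 0) (T 1) \<and> tableau (lower_rows T)"
proof
  assume tableau_T: "tableau T"
  then have "T 0 \<inter> T (Suc a) = {}" for a
    unfolding tableau_def disjoint_family_on_def by blast
  then show "finite (T 0) \<and> T 0 \<inter> entries (lower_rows T) = {} \<and>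
      columns_increase (T 0) (T 1) \<and> tableau (lower_rows T)"
    using tableau_T entries_lower_rows[of T] by (auto simp: tableau_def disjoint_family_on_def)
next
  assume parts: "finite (T 0) \<and> T 0 \<inter> entries (lower_rows T) = {} \<and>
      columns_increase (T 0) (T 1) \<and> tableau (lower_rows T)"
  have "T a \<inter> T b = {}" if "a \<noteq> b" for a b
    using parts that unfolding tableau_def disjoint_family_on_def by (cases a; cases b) auto
  moreover have "columns_increase (T a) (T (Suc a))" for a
    using parts by (cases a) (auto simp: tableau_def)
  ultimately show "tableau T"
    using parts entries_lower_rows[of T] by (auto simp: tableau_def disjoint_family_on_def)
qed

lemma tableau_lower_rows: "tableau T \<Longrightarrow> tableau (lower_rows T)"
  using tableau_lower_rows_iff by blast

lemma tableau_empty: "tableau (\<lambda>_. {})"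
  by (simp add: tableau_def disjoint_family_on_def columns_increase_def)

lemma tableau_eventually_empty:
  assumes "tableau T"
  obtains N where "\<And>a. a \<ge> N \<Longrightarrow> T a = {}"
proof -
  let ?A = "{a. T a \<noteq> {}}"
  have "inj_on T ?A"
    using assms unfolding tableau_def inj_on_def disjoint_family_on_def by blast
  moreover have "finite (T ` ?A)"
    by (rule finite_subset[of _ "Pow (entries T)"]) (use assms in \<open>auto simp: tableau_def\<close>)
  ultimately have "finite ?A" using finite_imageD by blast
  then obtain N where "\<forall>a\<in>?A. a < N" using finite_nat_set_iff_bounded by blast
  then show ?thesis using that[of N] by (metis (mono_tags, lifting) leD mem_Collect_eq)
qed

lemma tableau_induct [consumes 1, case_names empty rows]:
  assumes "tableau T" and "P (\<lambda>_. {})"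
    and rows: "\<And>T. tableau T \<Longrightarrow> P (lower_rows T) \<Longrightarrow> P T"
  shows "P T"
proof -
  have "P T" if "tableau T" "\<And>a. a \<ge> N \<Longrightarrow> T a = {}" for N T
    using that
  proof (induction N arbitrary: T)
    case 0
    then have "T = (\<lambda>_. {})" by auto
    then show ?case using assms(2) by simp
  next
    case (Suc N)
    then have "P (lower_rows T)" using tableau_lower_rows[of T] by simp
    then show ?case by (rule rows[OF Suc.prems(1)])
  qed
  then show ?thesis using assms(1) tableau_eventually_empty[OF assms(1)] by blast
qed

lemma tableau_card_antimono:
  assumes "tableau T" "a \<le> b"
  shows "card (T b) \<le> card (T a)"
  using assms(2)
proof (induction rule: dec_induct)
  case (step b)
  have "card (T (Suc b)) \<le> card (T b)"
    using assms(1) tableau_finite[OF assms(1)]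
    by (intro columns_increase_card) (simp_all add: tableau_def)
  then show ?case using step.IH by simp
qed simp

lemma tableau_nonempty_antimono: "tableau T \<Longrightarrow> a \<le> b \<Longrightarrow> T b \<noteq> {} \<Longrightarrow> T a \<noteq> {}"
  using tableau_card_antimono[of T a b] tableau_finite[of T b] by (auto simp: card_gt_0_iff)

lemma tab_insert_None: "bump (T 0) x = None \<Longrightarrow> tab_insert T x = T(0 := insert x (T 0))"
proof
  show "tab_insert T x a = (T(0 := insert x (T 0))) a" if "bump (T 0) x = None" for a
    using that by (cases a) (auto simp: row_insert_None)
qed

lemma lower_rows_tab_insert_Some:
  "bump (T 0) x = Some y \<Longrightarrow> lower_rows (tab_insert T x) = tab_insert (lower_rows T) y"
  by (simp add: fun_eq_iff)

lemma bumped_notin_lower_rows: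
  assumes "tableau T" "bump (T 0) x = Some y"
  shows "y \<notin> entries (lower_rows T)"
proof -
  have "y \<in> T 0" using assms(2) by (simp add: bump_Some_iff[OF tableau_finite[OF assms(1)]])
  then show ?thesis using assms(1) unfolding tableau_lower_rows_iff[of T] by blast
qed

lemma tableau_tab_insert_None:
  assumes "tableau T" "x \<notin> entries T" "bump (T 0) x = None"
  shows "tableau (tab_insert T x) \<and> entries (tab_insert T x) = insert x (entries T)"
proof
  have parts: "finite (T 0)" "T 0 \<inter> entries (lower_rows T) = {}" "columns_increase (T 0) (T 1)"
      "tableau (lower_rows T)"
    using assms(1) unfolding tableau_lower_rows_iff[of T] by auto
  have fresh: "x \<notin> T 0" "x \<notin> entries (lower_rows T)" using assms(2) by auto
  have "columns_increase (row_insert (T 0) x) (T 1)"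
    using parts(3) card_row_insert_atMost[OF parts(1) fresh(1)] unfolding columns_increase_def
    by (metis le_add1 le_trans)
  then show "tableau (tab_insert T x)"
    unfolding tab_insert_None[of T x, OF assms(3)]
      tableau_lower_rows_iff[of "T(0 := insert x (T 0))"]
    using parts fresh assms(3) by (simp add: row_insert_None)
  show "entries (tab_insert T x) = insert x (entries T)"
    unfolding tab_insert_None[of T x, OF assms(3)]
      entries_lower_rows[of "T(0 := insert x (T 0))"] entries_lower_rows[of T]
    by simp
qed

lemma tableau_tab_insert:
  assumes "tableau T" "x \<notin> entries T"
  shows "tableau (tab_insert T x) \<and> entries (tab_insert T x) = insert x (entries T)"
  using assms
proof (induction arbitrary: x rule: tableau_induct)
  case empty
  then show ?case by (intro tableau_tab_insert_None) (simp_all add: tableau_empty bump_None_iff)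
next
  case (rows T)
  let ?T' = "tab_insert T x"
  have parts: "finite (T 0)" "T 0 \<inter> entries (lower_rows T) = {}" "columns_increase (T 0) (T 1)"
      "tableau (lower_rows T)"
    using rows.hyps unfolding tableau_lower_rows_iff[of T] by auto
  have fresh: "x \<notin> T 0" "x \<notin> entries (lower_rows T)" using rows.prems by auto
  show ?case
  proof (cases "bump (T 0) x")
    case None
    then show ?thesis by (rule tableau_tab_insert_None[OF rows.hyps rows.prems])
  next
    case (Some y)
    have bumped: "y \<in> T 0" "y \<notin> entries (lower_rows T)"
      using Some bumped_notin_lower_rows[OF rows.hyps Some]
      by (auto simp: bump_Some_iff[OF parts(1)])
    have IH: "tableau (tab_insert (lower_rows T) y)"
        "entries (tab_insert (lower_rows T) y) = insert y (entries (lower_rows T))"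
      using rows.IH[OF bumped(2)] by auto
    have "columns_increase (row_insert (T 0) x) (row_insert (T 1) y)"
      using parts fresh(1) bumped(2) Some tableau_finite[OF parts(4)]
      by (intro columns_increase_row_insert) auto
    moreover have "row_insert (T 0) x \<inter> insert y (entries (lower_rows T)) = {}"
      using parts(2) fresh bumped by (auto simp: row_insert_Some[OF Some])
    ultimately have "tableau ?T'"
      unfolding tableau_lower_rows_iff[of ?T'] lower_rows_tab_insert_Some[of T x, OF Some]
      using parts IH Some by simp
    moreover have "entries ?T' = insert x (entries T)"
      unfolding entries_lower_rows[of ?T'] lower_rows_tab_insert_Some[of T x, OF Some] IH(2)
        entries_lower_rows[of T]
      using bumped by (auto simp: row_insert_Some[OF Some])
    ultimately show ?thesis by blast
  qed
qed

lemma card_tab_insert: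
  assumes "tableau T" "x \<notin> entries T"
  shows "\<exists>a. \<forall>b. card (tab_insert T x b) = card (T b) + of_bool (b = a)"
  using assms
proof (induction arbitrary: x rule: tableau_induct)
  case (empty x)
  have "tab_insert (\<lambda>_. {}) x = (\<lambda>_. {})(0 := {x})"
    using tab_insert_None[of "\<lambda>_. {}" x] by (simp add: bump_None_iff)
  then show ?case by (intro exI[of _ 0]) simp
next
  case (rows T)
  have finite_row: "finite (T 0)" and fresh: "x \<notin> T 0" using rows tableau_finite by auto
  show ?case
  proof (cases "bump (T 0) x")
    case None
    then have "card (tab_insert T x b) = card (T b) + of_bool (b = 0)" for b
      using finite_row fresh tab_insert_None[of T x] by simp
    then show ?thesis by blast
  next
    case (Some y)
    from rows.IH[OF bumped_notin_lower_rows[OF rows.hyps Some]] obtain a where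
      grown: "\<And>b. card (tab_insert (lower_rows T) y b) = card (T (Suc b)) + of_bool (b = a)"
        by blast
    have "card (tab_insert T x b) = card (T b) + of_bool (b = Suc a)" for b
      using grown Some card_row_insert[OF finite_row fresh] by (cases b) auto
    then show ?thesis by blast
  qed
qed

lemma bump_None_iff_if_row_insert_eq:
  assumes "finite R" "finite S" "x \<notin> R" "y \<notin> S" "row_insert R x = row_insert S y" "card R = card S"
  shows "bump R x = None \<longleftrightarrow> bump S y = None"
  using card_row_insert[OF assms(1,3)] card_row_insert[OF assms(2,4)] assms(5,6)
  by (auto simp: of_bool_def split: if_splits)

lemma tab_insert_inj:
  assumes "tableau T" "tableau U" "x \<notin> entries T" "y \<notin> entries U"
    and "tab_insert T x = tab_insert U y" "\<And>a. card (T a) = card (U a)"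
  shows "T = U \<and> x = y"
  using assms
proof (induction arbitrary: U x y rule: tableau_induct)
  case (empty U x y)
  have "U a = {}" for a using empty(5)[of a] tableau_finite[OF empty(1), of a] by simp
  then have U_empty: "U = (\<lambda>_. {})" by auto
  have "tab_insert (\<lambda>_. {}) x 0 = tab_insert U y 0" by (simp only: empty(4))
  then show ?case by (simp add: U_empty row_insert_def bump_def)
next
  case (rows T U x y)
  have finite_rows: "finite (T 0)" "finite (U 0)" using rows tableau_finite by auto
  have fresh: "x \<notin> T 0" "y \<notin> U 0" using rows.prems by auto
  have top_rows_eq: "row_insert (T 0) x = row_insert (U 0) y"
    using fun_cong[OF rows.prems(4), of 0] by simp
  have None_iff: "bump (T 0) x = None \<longleftrightarrow> bump (U 0) y = None"
    by (rule bump_None_iff_if_row_insert_eq[OF finite_rows fresh top_rows_eq rows.prems(5)])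
  have "lower_rows T = lower_rows U \<and> bump (T 0) x = bump (U 0) y"
  proof (cases "bump (T 0) x")
    case None
    have "T (Suc a) = U (Suc a)" for a
      using fun_cong[OF rows.prems(4), of "Suc a"] None None_iff by simp
    then show ?thesis using None None_iff by simp
  next
    case (Some p)
    then obtain q where bump_U: "bump (U 0) y = Some q" using None_iff by auto
    have "lower_rows T = lower_rows U \<and> p = q"
    proof (rule rows.IH)
      show "tableau (lower_rows U)" using rows.prems(1) by (rule tableau_lower_rows)
      show "p \<notin> entries (lower_rows T)" "q \<notin> entries (lower_rows U)"
        using bumped_notin_lower_rows rows.hyps rows.prems(1) Some bump_U by blast+
      show "tab_insert (lower_rows T) p = tab_insert (lower_rows U) q"
        using lower_rows_tab_insert_Some[of T x, OF Some]
          lower_rows_tab_insert_Some[of U y, OF bump_U] rows.prems(4) by simp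
      show "card (T (Suc a)) = card (U (Suc a))" for a using rows.prems(5) .
    qed
    then show ?thesis using Some bump_U by simp
  qed
  moreover from this have "T 0 = U 0 \<and> x = y"
    using row_insert_inj[OF finite_rows fresh] top_rows_eq by blast
  ultimately show ?case by (metis ext not0_implies_Suc)
qed

lemma tab_insert_reverse_top_row:
  assumes "tableau T'" "card (T' 1) < card (T' 0)"
  obtains T x where "tableau T" "x \<notin> entries T" "tab_insert T x = T'"
    "\<And>b. card (T' b) = card (T b) + of_bool (b = 0)"
proof -
  have parts: "finite (T' 0)" "T' 0 \<inter> entries (lower_rows T') = {}" "columns_increase (T' 0) (T' 1)"
      "tableau (lower_rows T')"
    using assms(1) unfolding tableau_lower_rows_iff[of T'] by auto
  define x where "x = Max (T' 0)"
  have "T' 0 \<noteq> {}" using assms(2) by auto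
  then have greatest: "x \<in> T' 0" "\<And>y. y \<in> T' 0 \<Longrightarrow> y \<le> x" using parts(1) by (auto simp: x_def)
  define T where "T = T'(0 := T' 0 - {x})"
  have lower_rows_eq: "lower_rows T = lower_rows T'" by (simp add: T_def)
  have "columns_increase (T' 0 - {x}) (T' 1)"
    unfolding columns_increase_def
  proof
    fix v
    show "card (T' 1 \<inter> {..v}) \<le> card ((T' 0 - {x}) \<inter> {..v})"
    proof (cases "x \<le> v")
      case True
      then have "(T' 0 - {x}) \<inter> {..v} = T' 0 - {x}" using greatest(2) by force
      moreover have "card (T' 1 \<inter> {..v}) \<le> card (T' 1)"
        using tableau_finite[OF assms(1)] by (intro card_mono) auto
      ultimately show ?thesis using assms(2) greatest(1) parts(1) by simp
    next
      case False
      then have "(T' 0 - {x}) \<inter> {..v} = T' 0 \<inter> {..v}" by auto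
      then show ?thesis using parts(3) by (simp add: columns_increase_def)
    qed
  qed
  then have "tableau T" using parts by (subst tableau_lower_rows_iff) (auto simp: T_def)
  moreover have "x \<notin> entries T"
    using parts(2) greatest(1)
    unfolding entries_lower_rows[of T] lower_rows_eq by (auto simp: T_def)
  moreover have "tab_insert T x = T'"
    using greatest by (subst tab_insert_None) (auto simp: bump_None_iff T_def insert_absorb)
  moreover have "card (T' b) = card (T b) + of_bool (b = 0)" for b
    using greatest(1) parts(1) card_Suc_Diff1[of "T' 0" x] by (auto simp: T_def)
  ultimately show thesis by (rule that)
qed

lemma tab_insert_reverse_lower_rows:
  assumes "tableau T'" "tableau U" "y \<notin> entries U" "tab_insert U y = lower_rows T'"
  shows "\<exists>T x. tableau T \<and> x \<notin> entries T \<and> tab_insert T x = T' \<and>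
    lower_rows T = U \<and> card (T' 0) = card (T 0)"
proof -
  have parts: "finite (T' 0)" "T' 0 \<inter> entries (lower_rows T') = {}" "columns_increase (T' 0) (T' 1)"
      "tableau (lower_rows T')" "finite (T' 1)"
    using assms(1) tableau_finite unfolding tableau_lower_rows_iff[of T'] by auto
  have second_row: "T' 1 = row_insert (U 0) y" using fun_cong[OF assms(4), of 0] by simp
  have entries_lower: "entries (lower_rows T') = insert y (entries U)"
    using tableau_tab_insert[OF assms(2,3)] assms(4) by simp
  then have reinserted: "y \<in> T' 1" "y \<notin> T' 0"
    unfolding second_row row_insert_def using parts(2) by blast+
  obtain x R where unbumped: "x \<in> T' 0" "R = insert y (T' 0 - {x})" "x \<notin> R" "bump R x = Some y"
      "row_insert R x = T' 0"
    using row_insert_reverse[OF parts(1,3,5) reinserted] by blast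
  define T where "T = case_nat R U"
  have T_rows: "T 0 = R" "lower_rows T = U" by (simp_all add: T_def)
  have "columns_increase R (U 0)"
  proof (rule columns_increase_row_insertD)
    show "columns_increase (row_insert R x) (row_insert (U 0) y)"
      using parts(3) unbumped(5) second_row by simp
  qed (use parts(1) assms(2,3) unbumped(2-4) tableau_finite in auto)
  then have "tableau T"
    unfolding tableau_lower_rows_iff[of T] T_rows
    using parts(1,2) assms(2,3) unbumped(2) entries_lower by (auto simp: T_def)
  moreover have "x \<notin> entries T"
    using unbumped(1,3) parts(2) entries_lower unfolding entries_lower_rows[of T] T_rows by auto
  moreover have "tab_insert T x = T'"
  proof
    fix b show "tab_insert T x b = T' b"
      using unbumped(4,5) fun_cong[OF assms(4)] T_rows by (cases b) auto
  qed
  moreover have "card (T' 0) = card (T 0)"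
    using unbumped(1,2) reinserted(2) parts(1) card_Suc_Diff1[of "T' 0" x] T_rows(1) by simp
  ultimately show ?thesis using T_rows(2) by blast
qed

lemma tab_insert_reverse:
  assumes "tableau T'" "card (T' (Suc a)) < card (T' a)"
  shows "\<exists>T x. tableau T \<and> x \<notin> entries T \<and> tab_insert T x = T' \<and>
    (\<forall>b. card (T' b) = card (T b) + of_bool (b = a))"
  using assms
proof (induction a arbitrary: T')
  case 0
  then have "card (T' 1) < card (T' 0)" by simp
  from tab_insert_reverse_top_row[OF 0(1) this] show ?case by metis
next
  case (Suc a)
  obtain U y where U_insert: "tableau U" "y \<notin> entries U" "tab_insert U y = lower_rows T'"
      "\<And>b. card (T' (Suc b)) = card (U b) + of_bool (b = a)"
    using Suc.IH[OF tableau_lower_rows[OF Suc.prems(1)] Suc.prems(2)] by blast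
  obtain T x where T_insert: "tableau T" "x \<notin> entries T" "tab_insert T x = T'"
      "lower_rows T = U" "card (T' 0) = card (T 0)"
    using tab_insert_reverse_lower_rows[OF Suc.prems(1) U_insert(1-3)] by blast
  have "card (T' b) = card (T b) + of_bool (b = Suc a)" for b
    using U_insert(4) T_insert(5) fun_cong[OF T_insert(4)] by (cases b) simp_all
  then show ?case using T_insert(1-3) by blast
qed

lemma tab_insert_delete_greatest:
  assumes "\<And>a. finite (T a)" "\<And>a y. y \<in> T a \<Longrightarrow> y \<le> m" "x < m"
  shows "tab_insert (\<lambda>a. T a - {m}) x a = tab_insert T x a - {m}"
  using assms
proof (induction a arbitrary: T x)
  case 0
  then show ?case by (simp add: row_insert_delete_greatest)
next
  case (Suc a)
  note bump_deleted = bump_delete_greatest[OF Suc.prems(1,2), of 0]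
  show ?case
  proof (cases "bump (T 0) x")
    case None
    then show ?thesis by (simp add: bump_deleted)
  next
    case (Some y)
    show ?thesis
    proof (cases "y = m")
      case True
      have "tab_insert (lower_rows T) m a - {m} = T (Suc a) - {m}"
        using tab_insert_None[of "lower_rows T" m] Suc.prems(2)[of _ 1] by (simp add: bump_None_iff)
      then show ?thesis using Some True by (simp add: bump_deleted)
    next
      case False
      have "y \<in> T 0" using Some Suc.prems(1) by (simp add: bump_Some_iff)
      then have "y < m" using False Suc.prems(2) by (simp add: order.strict_iff_order)
      then show ?thesis
        using Some False Suc.IH[of "lower_rows T" y] Suc.prems by (simp add: bump_deleted)
    qed
  qed
qed

lemma tableau_delete_greatest:
  assumes "tableau T" "\<And>a x. x \<in> T a \<Longrightarrow> x \<le> m"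
  shows "tableau (\<lambda>a. T a - {m})"
proof -
  have "columns_increase (T a - {m}) (T (Suc a) - {m})" for a
    unfolding columns_increase_def
  proof
    fix v
    have columns: "columns_increase (T a) (T (Suc a))" using assms(1) by (simp add: tableau_def)
    show "card ((T (Suc a) - {m}) \<inter> {..v}) \<le> card ((T a - {m}) \<inter> {..v})"
    proof (cases "v < m")
      case True
      then have "(T b - {m}) \<inter> {..v} = T b \<inter> {..v}" for b by auto
      then show ?thesis using columns by (simp add: columns_increase_def)
    next
      case False
      have "(T b - {m}) \<inter> {..v} = T b \<inter> {..<m}" for b
        using False assms(2)[of _ b] by force
      then show ?thesis
        using columns_increase_lessThan[OF columns] tableau_finite[OF assms(1)] by simp
    qed
  qed
  moreover have "finite (\<Union>a. T a - {m})"
    by (rule finite_subset[of _ "entries T"]) (use assms in \<open>auto simp: tableau_def\<close>)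
  ultimately show ?thesis using assms(1) unfolding tableau_def disjoint_family_on_def by blast
qed

lemma tableau_add_greatest:
  assumes "tableau T" "\<And>b x. x \<in> T b \<Longrightarrow> x < m" "a = 0 \<or> card (T a) < card (T (a - 1))"
  shows "tableau (T(a := insert m (T a)))"
proof -
  let ?T = "T(a := insert m (T a))"
  have finite_rows: "finite (T b)" for b using assms(1) tableau_finite by blast
  have fresh: "m \<notin> T b" for b using assms(2)[of m b] by blast
  have card_rows: "card (?T b) = card (T b) + of_bool (b = a)" for b using finite_rows fresh by simp
  have "columns_increase (?T b) (?T (Suc b))" for b
    unfolding columns_increase_def
  proof
    fix v
    show "card (?T (Suc b) \<inter> {..v}) \<le> card (?T b \<inter> {..v})"
    proof (cases "v < m")
      case True
      then have "?T c \<inter> {..v} = T c \<inter> {..v}" for c by auto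
      then show ?thesis using assms(1) by (simp add: tableau_def columns_increase_def)
    next
      case False
      then have "?T c \<inter> {..v} = ?T c" for c using assms(2) by force
      then show ?thesis
        using assms(3) card_rows tableau_card_antimono[OF assms(1), of b "Suc b"] by auto
    qed
  qed
  moreover have "finite (entries ?T)"
    by (rule finite_subset[of _ "insert m (entries T)"])
      (use assms(1) in \<open>auto simp: tableau_def split: if_splits\<close>)
  moreover have "disjoint_family ?T"
    using assms(1) fresh unfolding tableau_def disjoint_family_on_def by auto
  ultimately show ?thesis by (simp add: tableau_def)
qed

section \<open>Knuth equivalence\<close>

definition has_chain :: "('a \<Rightarrow> 'a \<Rightarrow> bool) \<Rightarrow> nat \<Rightarrow> 'a list \<Rightarrow> bool" where
  "has_chain R m w \<longleftrightarrow> (\<exists>s. subseq s w \<and> sorted_wrt R s \<and> length s = m)"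

definition increasing_chains_replaceable :: "'a::linorder list \<Rightarrow> 'a list \<Rightarrow> bool" where
  "increasing_chains_replaceable p q \<longleftrightarrow> (\<exists>f. \<forall>s. subseq s p \<and> sorted_wrt (<) s \<longrightarrow>
     subseq (f s) q \<and> sorted_wrt (<) (f s) \<and> length (f s) = length s \<and>
     (\<forall>x\<in>set (f s). \<exists>a\<in>set s. \<exists>b\<in>set s. a \<le> x \<and> x \<le> b))"

inductive knuth :: "'a::linorder list \<Rightarrow> 'a list \<Rightarrow> bool" where
  knuth_refl: "knuth w w"
| knuth_sym: "knuth v w \<Longrightarrow> knuth w v"
| knuth_trans: "knuth u v \<Longrightarrow> knuth v w \<Longrightarrow> knuth u w"
| knuth_yxz: "x < y \<Longrightarrow> y < z \<Longrightarrow> knuth (u @ [y, x, z] @ v) (u @ [y, z, x] @ v)"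
| knuth_xzy: "x < y \<Longrightarrow> y < z \<Longrightarrow> knuth (u @ [x, z, y] @ v) (u @ [z, x, y] @ v)"

lemma set_subseq: "subseq xs ys \<Longrightarrow> set xs \<subseteq> set ys"
  by (auto elim: list_emb_set)

lemma sorted_wrt_subseq: "subseq xs ys \<Longrightarrow> sorted_wrt R ys \<Longrightarrow> sorted_wrt R xs"
proof (induction rule: list_emb.induct)
  case (list_emb_Cons2 x y xs ys)
  then show ?case using set_subseq[of xs ys] by auto
qed auto

lemma subseq_rev_iff: "subseq (rev xs) (rev ys) \<longleftrightarrow> subseq xs ys"
proof -
  have "subseq (rev xs) (rev ys)" if "subseq xs ys" for xs ys :: "'a list"
    using that by (induction rule: list_emb.induct) (auto intro: subseq_rev_drop_many)
  from this[of xs ys] this[of "rev xs" "rev ys"] show ?thesis by auto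
qed

lemma has_chain_rev: "has_chain R m (rev w) \<longleftrightarrow> has_chain (\<lambda>x y. R y x) m w"
proof -
  have "has_chain R m (rev w) \<longleftrightarrow>
      (\<exists>s. subseq (rev s) (rev w) \<and> sorted_wrt R (rev s) \<and> length (rev s) = m)"
    unfolding has_chain_def by (metis rev_rev_ident)
  then show ?thesis by (simp add: has_chain_def subseq_rev_iff sorted_wrt_rev)
qed

lemma has_chain_antimono:
  assumes "has_chain R m w" "l \<le> m"
  shows "has_chain R l w"
proof -
  obtain s where chain: "subseq s w" "sorted_wrt R s" "length s = m"
    using assms(1) by (auto simp: has_chain_def)
  have "subseq (take l s) w"
    using chain(1) subseq_order.trans[OF prefix_imp_subseq[OF take_is_prefix]] by blast
  then show ?thesis
    unfolding has_chain_def using chain assms(2)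
    by (intro exI[of _ "take l s"]) (auto intro: sorted_wrt_take)
qed

lemma has_increasing_chain_replace:
  assumes "increasing_chains_replaceable p q" "has_chain (<) m (u @ p @ v)"
  shows "has_chain (<) m (u @ q @ v)"
proof -
  obtain s where chain: "subseq s (u @ p @ v)" "sorted_wrt (<) s" "length s = m"
    using assms(2) by (auto simp: has_chain_def)
  obtain s1 s2 s3 where chain_parts: "s = s1 @ s2 @ s3" "subseq s1 u" "subseq s2 p" "subseq s3 v"
    using chain(1) by (auto elim!: subseq_appendE)
  have sorted_parts: "sorted_wrt (<) s1" "sorted_wrt (<) s2" "sorted_wrt (<) s3"
    "\<forall>e\<in>set s1. \<forall>x\<in>set s2. e < x" "\<forall>x\<in>set s2. \<forall>e\<in>set s3. x < e"
    "\<forall>e\<in>set s1. \<forall>x\<in>set s3. e < x"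
    using chain(2) by (auto simp: chain_parts(1) sorted_wrt_append)
  obtain t where replacement: "subseq t q" "sorted_wrt (<) t" "length t = length s2"
    and between: "\<forall>x\<in>set t. \<exists>a\<in>set s2. \<exists>b\<in>set s2. a \<le> x \<and> x \<le> b"
    using assms(1) chain_parts(3) sorted_parts(2)
    unfolding increasing_chains_replaceable_def by meson
  have "\<forall>e\<in>set s1. \<forall>x\<in>set t. e < x" "\<forall>x\<in>set t. \<forall>e\<in>set s3. x < e"
    using between sorted_parts(4,5) by (meson le_less_trans less_le_trans)+
  then have "sorted_wrt (<) (s1 @ t @ s3)"
    using sorted_parts(1,3,6) replacement(2) by (simp add: sorted_wrt_append ball_Un)
  moreover have "subseq (s1 @ t @ s3) (u @ q @ v)"
    using chain_parts(2,4) replacement(1) by (intro list_emb_append_mono)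
  moreover have "length (s1 @ t @ s3) = m" using chain(3) chain_parts(1) replacement(3) by simp
  ultimately show ?thesis unfolding has_chain_def by blast
qed

lemma subseq3_cases:
  assumes "subseq s [a, b, c]"
  shows "s \<in> {[], [a], [b], [c], [a, b], [a, c], [b, c], [a, b, c]}"
proof -
  have "s \<in> set (subseqs [a, b, c])" using assms by (simp only: in_set_subseqs)
  then show ?thesis by (auto simp: Let_def simp del: in_set_subseqs)
qed

text \<open>Only increasing chains through both of the exchanged letters x and z are affected; in them y
  can take the place of one of these letters.\<close>

lemma increasing_chains_replaceable_yxz:
  fixes x y z :: "'a::linorder"
  assumes "x < y" "y < z"
  shows "increasing_chains_replaceable [y, x, z] [y, z, x]"
    "increasing_chains_replaceable [y, z, x] [y, x, z]"
proof -
  let ?t = "\<lambda>s. if s = [x, z] then [y, z] else s"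
  show "increasing_chains_replaceable [y, x, z] [y, z, x]"
    "increasing_chains_replaceable [y, z, x] [y, x, z]"
    unfolding increasing_chains_replaceable_def
    by (intro exI[of _ ?t]; use assms in \<open>auto dest!: subseq3_cases\<close>)+
qed

lemma increasing_chains_replaceable_xzy:
  fixes x y z :: "'a::linorder"
  assumes "x < y" "y < z"
  shows "increasing_chains_replaceable [x, z, y] [z, x, y]"
    "increasing_chains_replaceable [z, x, y] [x, z, y]"
proof -
  let ?t = "\<lambda>s. if s = [x, z] then [x, y] else s"
  show "increasing_chains_replaceable [x, z, y] [z, x, y]"
    "increasing_chains_replaceable [z, x, y] [x, z, y]"
    unfolding increasing_chains_replaceable_def
    by (intro exI[of _ ?t]; use assms in \<open>auto dest!: subseq3_cases\<close>)+
qed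

lemma has_increasing_chain_knuth:
  "knuth v w \<Longrightarrow> has_chain (<) m v \<longleftrightarrow> has_chain (<) m w"
proof (induction rule: knuth.induct)
  case (knuth_yxz x y z u v)
  then show ?case
    using has_increasing_chain_replace[OF increasing_chains_replaceable_yxz(1)]
      has_increasing_chain_replace[OF increasing_chains_replaceable_yxz(2)] by metis
next
  case (knuth_xzy x y z u v)
  then show ?case
    using has_increasing_chain_replace[OF increasing_chains_replaceable_xzy(1)]
      has_increasing_chain_replace[OF increasing_chains_replaceable_xzy(2)] by metis
qed auto

lemma knuth_rev: "knuth v w \<Longrightarrow> knuth (rev v) (rev w)"
proof (induction rule: knuth.induct)
  case (knuth_yxz x y z u v)
  then show ?case using knuth.knuth_xzy[of x y z "rev v" "rev u"] knuth.knuth_sym by auto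
next
  case (knuth_xzy x y z u v)
  then show ?case using knuth.knuth_yxz[of x y z "rev v" "rev u"] knuth.knuth_sym by auto
next
  case (knuth_trans u v w)
  then show ?case using knuth.knuth_trans by blast
qed (simp_all add: knuth.knuth_refl knuth.knuth_sym)

lemma has_decreasing_chain_knuth:
  "knuth v w \<Longrightarrow> has_chain (>) m v \<longleftrightarrow> has_chain (>) m w"
  using has_increasing_chain_knuth[OF knuth_rev, of v w] by (simp add: has_chain_rev)

lemma knuth_append: "knuth v w \<Longrightarrow> knuth (p @ v @ q) (p @ w @ q)"
proof (induction rule: knuth.induct)
  case (knuth_yxz x y z u v)
  then show ?case using knuth.knuth_yxz[of x y z "p @ u" "v @ q"] by simp
next
  case (knuth_xzy x y z u v)
  then show ?case using knuth.knuth_xzy[of x y z "p @ u" "v @ q"] by simp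
next
  case (knuth_trans u v w)
  then show ?case using knuth.knuth_trans by blast
qed (simp_all add: knuth.knuth_refl knuth.knuth_sym)

lemma knuth_slide_left:
  assumes "\<forall>b\<in>set v. z < b" "sorted_wrt (<) v" "x < z"
  shows "knuth (z # v @ [x]) (z # x # v)"
  using assms
proof (induction v rule: rev_induct)
  case (snoc b v)
  define p where "p = last (z # v)"
  have last_letter: "z # v = butlast (z # v) @ [p]" by (simp add: p_def)
  have "p \<in> set (z # v)" unfolding p_def by (intro last_in_set) simp
  then have "x < p" "p < b" using snoc.prems by (auto simp: sorted_wrt_append)
  then have "knuth (butlast (z # v) @ [p, b, x] @ []) (butlast (z # v) @ [p, x, b] @ [])"
    by (intro knuth_sym[OF knuth_yxz])
  then have "knuth (z # (v @ [b]) @ [x]) ((z # v) @ [x, b])"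
    using last_letter by (metis append.assoc append_Cons append_Nil append_Nil2)
  moreover have "knuth (z # v @ [x]) (z # x # v)" using snoc by (auto simp: sorted_wrt_append)
  from knuth_append[OF this, of "[]" "[b]"]
  have "knuth ((z # v) @ [x, b]) (z # x # v @ [b])" by simp
  ultimately show ?case by (rule knuth_trans)
qed (auto intro: knuth_refl)

lemma knuth_slide_front:
  assumes "\<forall>a\<in>set u. a < x" "sorted_wrt (<) u" "x < z"
  shows "knuth (u @ z # x # v) (z # u @ x # v)"
  using assms
proof (induction u arbitrary: x v rule: rev_induct)
  case (snoc q u)
  have "knuth (u @ [q, z, x] @ v) (u @ [z, q, x] @ v)"
    using snoc.prems by (intro knuth_xzy) auto
  moreover have "knuth (u @ z # q # x # v) (z # u @ q # x # v)"
    using snoc.prems by (intro snoc.IH) (auto simp: sorted_wrt_append)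
  ultimately have "knuth (u @ [q, z, x] @ v) (z # u @ q # x # v)"
    using knuth_trans by simp
  then show ?case by simp
qed (auto intro: knuth_refl)

lemma sorted_list_of_set_eqI:
  "sorted_wrt (<) xs \<Longrightarrow> set xs = A \<Longrightarrow> sorted_list_of_set A = xs"
  using strict_sorted_equal[of xs "sorted_list_of_set A"] by auto

lemma knuth_row_insert:
  assumes "finite R" "x \<notin> R" "bump R x = Some y"
  shows "knuth (sorted_list_of_set R @ [x]) (y # sorted_list_of_set (row_insert R x))"
proof -
  have bumped: "y \<in> R" "x < y" "\<And>z. z \<in> R \<Longrightarrow> x < z \<Longrightarrow> y \<le> z"
    using assms(1,3) by (auto simp: bump_Some_iff)
  have gap: "z = y \<or> z < x \<or> y < z" if "z \<in> R" for z
    using bumped(3)[OF that] that assms(2) by (cases z x rule: linorder_cases) (auto simp: le_less)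
  define u where "u = sorted_list_of_set (R \<inter> {..<x})"
  define v where "v = sorted_list_of_set (R \<inter> {y<..})"
  have left_part: "set u = R \<inter> {..<x}" "sorted_wrt (<) u"
    and right_part: "set v = R \<inter> {y<..}" "sorted_wrt (<) v"
    using assms(1) by (auto simp: u_def v_def)
  have word_R: "sorted_list_of_set R = u @ y # v"
    by (rule sorted_list_of_set_eqI)
      (use left_part right_part bumped(1,2) gap in \<open>auto simp: sorted_wrt_append\<close>)
  have word_inserted: "sorted_list_of_set (row_insert R x) = u @ x # v"
    by (rule sorted_list_of_set_eqI)
      (use left_part right_part bumped(1,2) gap in
        \<open>auto simp: sorted_wrt_append row_insert_Some[OF assms(3)]\<close>)
  have "knuth (y # v @ [x]) (y # x # v)" using right_part bumped(2) by (intro knuth_slide_left) auto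
  from knuth_append[OF this, of u "[]"]
  have "knuth (u @ y # v @ [x]) (u @ y # x # v)" by simp
  moreover have "knuth (u @ y # x # v) (y # u @ x # v)"
    using left_part bumped(2) by (intro knuth_slide_front) auto
  ultimately have "knuth (u @ y # v @ [x]) (y # u @ x # v)" by (rule knuth_trans)
  then show ?thesis using word_R word_inserted by simp
qed

section \<open>Schensted's theorem\<close>

definition reading_word :: "(nat \<Rightarrow> 'a::linorder set) \<Rightarrow> 'a list" where
  "reading_word T =
     concat (map (\<lambda>a. sorted_list_of_set (T a)) (rev [0..<LEAST N. \<forall>a\<ge>N. T a = {}]))"

definition insertion_tableau :: "'a::linorder list \<Rightarrow> nat \<Rightarrow> 'a set" where
  "insertion_tableau w = foldl tab_insert (\<lambda>_. {}) w"

lemma reading_word_eq: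
  assumes "\<forall>a\<ge>N. T a = {}"
  shows "reading_word T = concat (map (\<lambda>a. sorted_list_of_set (T a)) (rev [0..<N]))"
proof -
  define L where "L = (LEAST N. \<forall>a\<ge>N. T a = {})"
  have "\<forall>a\<ge>L. T a = {}" unfolding L_def using assms by (rule LeastI)
  have "L \<le> N" unfolding L_def using assms by (rule Least_le)
  then have "reading_word T = concat (map (\<lambda>a. sorted_list_of_set (T a)) (rev [0..<N]))"
  proof (induction rule: dec_induct)
    case base
    then show ?case by (simp add: reading_word_def L_def)
  next
    case (step n)
    then show ?case using \<open>\<forall>a\<ge>L. T a = {}\<close> by simp
  qed
  then show ?thesis .
qed

lemma reading_word_empty: "reading_word (\<lambda>_. {}) = []"
  using reading_word_eq[of 0 "\<lambda>_. {}"] by simp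

lemma reading_word_lower_rows:
  assumes "tableau T"
  shows "reading_word T = reading_word (lower_rows T) @ sorted_list_of_set (T 0)"
proof -
  obtain N where empty_from: "\<And>a. a \<ge> N \<Longrightarrow> T a = {}"
    using tableau_eventually_empty[OF assms] by blast
  have "[0..<Suc N] = 0 # map Suc [0..<N]" by (simp only: map_Suc_upt upt_conv_Cons zero_less_Suc)
  then show ?thesis
    using reading_word_eq[of "Suc N" T] reading_word_eq[of N "lower_rows T"] empty_from
    by (simp del: upt_Suc add: rev_map comp_def)
qed

lemma reading_word_tab_insert_None:
  assumes "tableau T" "x \<notin> entries T" "bump (T 0) x = None"
  shows "reading_word (tab_insert T x) = reading_word T @ [x]"
proof -
  have finite_row: "finite (T 0)" using assms(1) by (rule tableau_finite)
  have "y < x" if "y \<in> T 0" for y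
    using assms(2,3) that by (force simp: bump_None_iff order.strict_iff_order)
  then have "sorted_list_of_set (insert x (T 0)) = sorted_list_of_set (T 0) @ [x]"
    using finite_row by (intro sorted_list_of_set_eqI) (auto simp: sorted_wrt_append)
  moreover have "tableau (tab_insert T x)" using tableau_tab_insert[OF assms(1,2)] by blast
  ultimately show ?thesis
    using reading_word_lower_rows[of "tab_insert T x"] reading_word_lower_rows[OF assms(1)]
      tab_insert_None[of T x, OF assms(3)]
    by simp
qed

lemma knuth_tab_insert:
  assumes "tableau T" "x \<notin> entries T"
  shows "knuth (reading_word T @ [x]) (reading_word (tab_insert T x))"
  using assms
proof (induction arbitrary: x rule: tableau_induct)
  case empty
  have "reading_word (tab_insert (\<lambda>_. {}) x) = reading_word (\<lambda>_. {}) @ [x]"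
    by (rule reading_word_tab_insert_None) (simp_all add: tableau_empty bump_None_iff)
  then show ?case by (simp add: knuth_refl)
next
  case (rows T)
  show ?case
  proof (cases "bump (T 0) x")
    case None
    then show ?thesis
      using reading_word_tab_insert_None[OF rows.hyps rows.prems] by (simp add: knuth_refl)
  next
    case (Some y)
    let ?row = "sorted_list_of_set (row_insert (T 0) x)"
    have fresh: "x \<notin> T 0" using rows.prems by blast
    have "knuth (reading_word T @ [x]) (reading_word (lower_rows T) @ y # ?row)"
      using knuth_append[OF knuth_row_insert[OF tableau_finite[OF rows.hyps] fresh Some],
          of "reading_word (lower_rows T)" "[]"] reading_word_lower_rows[OF rows.hyps]
      by simp
    moreover have "tableau (tab_insert T x)"
      using tableau_tab_insert[OF rows.hyps rows.prems] by blast
    then have "reading_word (tab_insert T x) = reading_word (tab_insert (lower_rows T) y) @ ?row"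
      using reading_word_lower_rows[of "tab_insert T x"] lower_rows_tab_insert_Some[of T x, OF Some]
      by simp
    moreover have "knuth (reading_word (lower_rows T) @ [y])
        (reading_word (tab_insert (lower_rows T) y))"
      by (rule rows.IH) (rule bumped_notin_lower_rows[OF rows.hyps Some])
    from knuth_append[OF this, of "[]" ?row]
    have "knuth (reading_word (lower_rows T) @ y # ?row)
        (reading_word (tab_insert (lower_rows T) y) @ ?row)"
      by simp
    ultimately show ?thesis using knuth_trans by simp
  qed
qed

lemma reading_word_increasing_bound:
  assumes "tableau T" "subseq s (reading_word T)" "sorted_wrt (<) s" "\<forall>x\<in>set s. x \<le> v"
  shows "length s \<le> card (T 0 \<inter> {..v})"
  using assms
proof (induction arbitrary: s v rule: tableau_induct)
  case (rows T)
  have finite_row: "finite (T 0)" using rows.hyps by (rule tableau_finite)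
  obtain s1 s0 where chain_parts: "s = s1 @ s0" "subseq s1 (reading_word (lower_rows T))"
    "subseq s0 (sorted_list_of_set (T 0))"
    using rows.prems(1)
    unfolding reading_word_lower_rows[OF rows.hyps] by (auto elim: subseq_appendE)
  have s0_in_row: "set s0 \<subseteq> T 0" using set_subseq[OF chain_parts(3)] finite_row by simp
  have sorted_parts: "sorted_wrt (<) s1" "sorted_wrt (<) s0" "\<forall>x\<in>set s1. \<forall>y\<in>set s0. x < y"
    using rows.prems(2) chain_parts(1) by (auto simp: sorted_wrt_append)
  have length_s0: "length s0 = card (set s0)"
    using sorted_parts(2) strict_sorted_iff distinct_card by metis
  show ?case
  proof (cases s1 rule: rev_cases)
    case Nil
    have "card (set s0) \<le> card (T 0 \<inter> {..v})"
      using s0_in_row rows.prems(3) chain_parts(1) finite_row by (intro card_mono) auto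
    then show ?thesis using Nil chain_parts(1) length_s0 by simp
  next
    case (snoc s1' u)
    then have greatest_in_s1: "u \<in> set s1" "\<forall>x\<in>set s1. x \<le> u"
      using sorted_parts(1) by (auto simp: sorted_wrt_append)
    then have "length s1 \<le> card (T 1 \<inter> {..u})"
      using rows.IH[OF chain_parts(2) sorted_parts(1), of u] by simp
    also have "\<dots> \<le> card (T 0 \<inter> {..u})"
      using rows.hyps unfolding tableau_lower_rows_iff[of T] columns_increase_def by blast
    finally have "length s \<le> card (T 0 \<inter> {..u}) + card (set s0)"
      using chain_parts(1) length_s0 by simp
    also have "\<dots> = card (T 0 \<inter> {..u} \<union> set s0)"
      using sorted_parts(3) greatest_in_s1(1) finite_row
      by (intro card_Un_disjoint[symmetric]) force+
    also have "\<dots> \<le> card (T 0 \<inter> {..v})"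
    proof (rule card_mono)
      have "u \<le> v" "\<forall>x\<in>set s0. x \<le> v" using rows.prems(3) chain_parts(1) greatest_in_s1 by auto
      then show "T 0 \<inter> {..u} \<union> set s0 \<subseteq> T 0 \<inter> {..v}" using s0_in_row by auto
    qed (use finite_row in simp)
    finally show ?thesis .
  qed
qed (simp add: reading_word_empty)

lemma reading_word_decreasing_bound:
  assumes "tableau T" "subseq s (reading_word T)" "sorted_wrt (>) s" "length s = Suc m"
  shows "T m \<noteq> {}"
  using assms
proof (induction arbitrary: s m rule: tableau_induct)
  case (rows T)
  have finite_row: "finite (T 0)" using rows.hyps by (rule tableau_finite)
  obtain s1 s0 where chain_parts: "s = s1 @ s0" "subseq s1 (reading_word (lower_rows T))"
    "subseq s0 (sorted_list_of_set (T 0))"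
    using rows.prems(1)
    unfolding reading_word_lower_rows[OF rows.hyps] by (auto elim: subseq_appendE)
  have sorted_parts: "sorted_wrt (>) s1" "sorted_wrt (>) s0"
    using rows.prems(2) chain_parts(1) by (auto simp: sorted_wrt_append)
  have "sorted_wrt (<) s0" using sorted_wrt_subseq[OF chain_parts(3)] by simp
  then have length_s0: "length s0 \<le> 1"
    using sorted_parts(2) by (cases s0; cases "tl s0") auto
  show ?case
  proof (cases "length s1")
    case 0
    then obtain x where "x \<in> set s0" "m = 0"
      using chain_parts(1) rows.prems(3) length_s0 by (cases s0) auto
    then show ?thesis using set_subseq[OF chain_parts(3)] finite_row by auto
  next
    case (Suc l)
    then have "T (Suc l) \<noteq> {}" by (rule rows.IH[OF chain_parts(2) sorted_parts(1)])
    moreover have "m \<le> Suc l" using Suc chain_parts(1) rows.prems(3) length_s0 by simp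
    ultimately show ?thesis using tableau_nonempty_antimono[OF rows.hyps] by blast
  qed
qed (simp add: reading_word_empty)

lemma tableau_Min_less:
  assumes "tableau T" "T 1 \<noteq> {}"
  shows "Min (T 0) < Min (T 1)"
proof -
  have finite_rows: "finite (T 0)" "finite (T 1)" using assms(1) by (rule tableau_finite)+
  have Min_in_row: "Min (T 1) \<in> T 1" using finite_rows(2) assms(2) by simp
  then have "0 < card (T 1 \<inter> {..Min (T 1)})" using finite_rows(2) by (auto simp: card_gt_0_iff)
  also have "\<dots> \<le> card (T 0 \<inter> {..Min (T 1)})"
    using assms(1) unfolding tableau_lower_rows_iff[of T] columns_increase_def by blast
  finally obtain z where smaller: "z \<in> T 0" "z \<le> Min (T 1)" by (auto simp: card_gt_0_iff)
  have "T 0 \<inter> T 1 = {}" using assms(1) unfolding tableau_def disjoint_family_on_def by force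
  then have "z < Min (T 1)" using smaller Min_in_row by (metis disjoint_iff order.strict_iff_order)
  then show ?thesis using smaller(1) finite_rows(1) by (meson Min_le le_less_trans)
qed

lemma reading_word_decreasing_ex:
  assumes "tableau T" "T m \<noteq> {}"
  shows "\<exists>s. subseq s (reading_word T) \<and> sorted_wrt (>) s \<and> length s = Suc m \<and>
    (\<forall>x\<in>set s. Min (T 0) \<le> x)"
  using assms
proof (induction m arbitrary: T)
  case 0
  then have "Min (T 0) \<in> set (sorted_list_of_set (T 0))" using tableau_finite[OF 0(1)] by simp
  then have "subseq [Min (T 0)] (reading_word T)"
    unfolding reading_word_lower_rows[OF 0(1)] by (simp add: subseq_singleton_left)
  then show ?case by (intro exI[of _ "[Min (T 0)]"]) simp
next
  case (Suc m)
  have finite_row: "finite (T 0)" using Suc.prems(1) by (rule tableau_finite)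
  have nonempty: "T 0 \<noteq> {}" "T 1 \<noteq> {}"
    using tableau_nonempty_antimono[OF Suc.prems(1), of _ "Suc m"] Suc.prems(2) by auto
  have Min_less: "Min (T 0) < Min (T 1)" using tableau_Min_less[OF Suc.prems(1) nonempty(2)] .
  obtain s where chain: "subseq s (reading_word (lower_rows T))" "sorted_wrt (>) s"
    "length s = Suc m" "\<forall>x\<in>set s. Min (T 1) \<le> x"
    using Suc.IH[OF tableau_lower_rows[OF Suc.prems(1)]] Suc.prems(2) by auto
  have "subseq (s @ [Min (T 0)]) (reading_word T)"
    unfolding reading_word_lower_rows[OF Suc.prems(1)] using chain(1) finite_row nonempty
    by (intro list_emb_append_mono) (auto simp: subseq_singleton_left)
  moreover have "sorted_wrt (>) (s @ [Min (T 0)])"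
    using chain(2,4) Min_less by (auto simp: sorted_wrt_append)
  moreover have "length (s @ [Min (T 0)]) = Suc (Suc m)" using chain(3) by simp
  moreover have "\<forall>x\<in>set (s @ [Min (T 0)]). Min (T 0) \<le> x" using chain(4) Min_less by force
  ultimately show ?case by blast
qed

lemma has_increasing_chain_reading_word:
  assumes "tableau T"
  shows "has_chain (<) m (reading_word T) \<longleftrightarrow> m \<le> card (T 0)"
proof
  assume "has_chain (<) m (reading_word T)"
  then obtain s where chain: "subseq s (reading_word T)" "sorted_wrt (<) s" "length s = m"
    by (auto simp: has_chain_def)
  show "m \<le> card (T 0)"
  proof (cases "s = []")
    case False
    have "length s \<le> card (T 0 \<inter> {..Max (set s)})"
      by (rule reading_word_increasing_bound[OF assms chain(1,2)]) simp
    also have "\<dots> \<le> card (T 0)" using tableau_finite[OF assms] by (intro card_mono) auto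
    finally show ?thesis using chain(3) by simp
  qed (use chain(3) in simp)
next
  assume "m \<le> card (T 0)"
  moreover have "has_chain (<) (card (T 0)) (reading_word T)"
    unfolding has_chain_def reading_word_lower_rows[OF assms] using tableau_finite[OF assms]
    by (intro exI[of _ "sorted_list_of_set (T 0)"]) auto
  ultimately show "has_chain (<) m (reading_word T)" using has_chain_antimono by blast
qed

lemma has_decreasing_chain_reading_word:
  assumes "tableau T"
  shows "has_chain (>) (Suc m) (reading_word T) \<longleftrightarrow> T m \<noteq> {}"
  using reading_word_decreasing_bound[OF assms] reading_word_decreasing_ex[OF assms]
  unfolding has_chain_def by meson

lemma insertion_tableau_Nil: "insertion_tableau [] = (\<lambda>_. {})"
  by (simp add: insertion_tableau_def)

lemma insertion_tableau_snoc:
  "insertion_tableau (w @ [x]) = tab_insert (insertion_tableau w) x"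
  by (simp add: insertion_tableau_def)

lemma tableau_insertion_tableau:
  assumes "distinct w"
  shows "tableau (insertion_tableau w) \<and> entries (insertion_tableau w) = set w"
  using assms
proof (induction w rule: rev_induct)
  case Nil
  then show ?case by (simp add: insertion_tableau_Nil tableau_empty)
next
  case (snoc x w)
  then show ?case
    using tableau_tab_insert[of "insertion_tableau w" x] by (simp add: insertion_tableau_snoc)
qed

lemma knuth_insertion_tableau:
  assumes "distinct w"
  shows "knuth w (reading_word (insertion_tableau w))"
  using assms
proof (induction w rule: rev_induct)
  case Nil
  then show ?case by (simp add: insertion_tableau_Nil reading_word_empty knuth_refl)
next
  case (snoc x w)
  have "knuth (w @ [x]) (reading_word (insertion_tableau w) @ [x])"
    using knuth_append[of w _ "[]" "[x]"] snoc by simp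
  moreover have "knuth (reading_word (insertion_tableau w) @ [x])
      (reading_word (insertion_tableau (w @ [x])))"
    unfolding insertion_tableau_snoc using tableau_insertion_tableau[of w] snoc.prems
    by (intro knuth_tab_insert) auto
  ultimately show ?case by (rule knuth_trans)
qed

theorem schensted_increasing:
  assumes "distinct w"
  shows "has_chain (<) m w \<longleftrightarrow> m \<le> card (insertion_tableau w 0)"
  using has_increasing_chain_knuth[OF knuth_insertion_tableau[OF assms]]
    has_increasing_chain_reading_word tableau_insertion_tableau[OF assms] by blast

theorem schensted_decreasing:
  assumes "distinct w"
  shows "has_chain (>) (Suc m) w \<longleftrightarrow> insertion_tableau w m \<noteq> {}"
  using has_decreasing_chain_knuth[OF knuth_insertion_tableau[OF assms]]
    has_decreasing_chain_reading_word tableau_insertion_tableau[OF assms] by blast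

lemma insertion_tableau_delete_greatest:
  assumes "distinct w" "\<forall>x\<in>set w. x \<le> m"
  shows "insertion_tableau (filter (\<lambda>x. x \<noteq> m) w) a = insertion_tableau w a - {m}"
  using assms
proof (induction w arbitrary: a rule: rev_induct)
  case Nil
  then show ?case by (simp add: insertion_tableau_Nil)
next
  case (snoc x w)
  let ?T = "insertion_tableau w"
  have tableau_T: "tableau ?T" "entries ?T = set w"
    using snoc.prems tableau_insertion_tableau by auto
  have entries_le: "y \<le> m" if "y \<in> ?T b" for y b using that tableau_T(2) snoc.prems(2) by auto
  show ?case
  proof (cases "x = m")
    case True
    then have "m \<notin> set w" using snoc.prems by simp
    then have "filter (\<lambda>x. x \<noteq> m) w = w" "\<And>a. m \<notin> ?T a"
      using tableau_T(2) by (auto intro: filter_True)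
    moreover have "tab_insert ?T m = ?T(0 := insert m (?T 0))"
      using entries_le by (intro tab_insert_None) (simp add: bump_None_iff)
    ultimately show ?thesis using True by (simp add: insertion_tableau_snoc)
  next
    case False
    then have "x < m" using snoc.prems(2) by (simp add: order.strict_iff_order)
    moreover have "insertion_tableau (filter (\<lambda>x. x \<noteq> m) w) = (\<lambda>a. ?T a - {m})"
      using snoc by auto
    ultimately show ?thesis
      using tab_insert_delete_greatest[OF tableau_finite[OF tableau_T(1)] entries_le] False
      by (simp add: insertion_tableau_snoc)
  qed
qed

section \<open>Families of Young diagrams\<close>

text \<open>A family of Young diagrams indexed by colours is a set of boxes (colour, row, column).\<close>

definition boxes :: "nat \<Rightarrow> nat \<Rightarrow> nat \<Rightarrow> (nat \<times> nat \<times> nat) set" where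
  "boxes r p q = {..<r} \<times> {..<p} \<times> {..<q}"

definition young :: "nat \<Rightarrow> nat \<Rightarrow> nat \<Rightarrow> (nat \<times> nat \<times> nat) set set" where
  "young r p q = {S. S \<subseteq> boxes r p q \<and>
     (\<forall>c a b a' b'. (c, a, b) \<in> S \<longrightarrow> a' \<le> a \<longrightarrow> b' \<le> b \<longrightarrow> (c, a', b') \<in> S)}"

definition adds_at_most_one :: "'a set \<Rightarrow> 'a set \<Rightarrow> bool" where
  "adds_at_most_one S S' \<longleftrightarrow> S' = S \<or> (\<exists>x. x \<notin> S \<and> S' = insert x S)"

definition down_steps ::
    "nat \<Rightarrow> nat \<Rightarrow> nat \<Rightarrow> (nat \<times> nat \<times> nat) set \<Rightarrow> (nat \<times> nat \<times> nat) set set" where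
  "down_steps r p q S = {S' \<in> young r p q. adds_at_most_one S' S}"

definition up_steps ::
    "nat \<Rightarrow> nat \<Rightarrow> nat \<Rightarrow> (nat \<times> nat \<times> nat) set \<Rightarrow> (nat \<times> nat \<times> nat) set set" where
  "up_steps r p q S = {S' \<in> young r p q. adds_at_most_one S S'}"

primrec vacillation_count ::
    "nat \<Rightarrow> nat \<Rightarrow> nat \<Rightarrow> nat \<Rightarrow> (nat \<times> nat \<times> nat) set \<Rightarrow> nat" where
  "vacillation_count r p q 0 S = of_bool (S = {})"
| "vacillation_count r p q (Suc m) S =
     (\<Sum>S1\<in>down_steps r p q S. \<Sum>S2\<in>up_steps r p q S1. vacillation_count r p q m S2)"

lemma finite_young: "finite (young r p q)"
  by (rule finite_subset[of _ "Pow (boxes r p q)"]) (auto simp: young_def boxes_def)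

lemma finite_down_steps: "finite (down_steps r p q S)"
  using finite_young by (simp add: down_steps_def)

lemma finite_up_steps: "finite (up_steps r p q S)"
  using finite_young by (simp add: up_steps_def)

lemma young_subset: "S \<in> young r p q \<Longrightarrow> S \<subseteq> boxes r p q"
  by (simp add: young_def)

lemma young_downward_closed:
  "S \<in> young r p q \<Longrightarrow> (c, a, b) \<in> S \<Longrightarrow> a' \<le> a \<Longrightarrow> b' \<le> b \<Longrightarrow> (c, a', b') \<in> S"
  unfolding young_def by blast

lemma empty_in_young: "{} \<in> young r p q"
  by (simp add: young_def)

lemma down_steps_empty: "down_steps r p q {} = {{}}"
  using empty_in_young by (auto simp: down_steps_def adds_at_most_one_def)

lemma young_Un:
  assumes "X \<in> young r p q" "Z \<in> young r p q"
  shows "X \<union> Z \<in> young r p q"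
  unfolding young_def
proof (intro CollectI conjI allI impI)
  show "X \<union> Z \<subseteq> boxes r p q" using assms young_subset by blast
  show "(c, a', b') \<in> X \<union> Z" if "(c, a, b) \<in> X \<union> Z" "a' \<le> a" "b' \<le> b" for c a b a' b'
    using that(1) young_downward_closed[OF assms(1) _ that(2,3)]
      young_downward_closed[OF assms(2) _ that(2,3)] by blast
qed

lemma adds_at_most_one_common:
  assumes "adds_at_most_one X S" "adds_at_most_one Z S" "X \<noteq> Z"
  shows "S = X \<union> Z"
proof -
  have "X \<subseteq> S" "Z \<subseteq> S" using assms by (auto simp: adds_at_most_one_def)
  moreover have "x \<in> X \<union> Z" if "x \<in> S" for x
  proof (rule ccontr)
    assume "x \<notin> X \<union> Z"
    moreover have "S = insert x W" if "adds_at_most_one W S" "x \<notin> W" for W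
      using that \<open>x \<in> S\<close> unfolding adds_at_most_one_def by blast
    ultimately have "insert x X = insert x Z" "x \<notin> X" "x \<notin> Z" using assms(1,2) by auto
    then show False using assms(3) by (metis insert_ident)
  qed
  ultimately show ?thesis by blast
qed

definition addable_boxes ::
    "nat \<Rightarrow> nat \<Rightarrow> nat \<Rightarrow> (nat \<times> nat \<times> nat) set \<Rightarrow> (nat \<times> nat \<times> nat) set" where
  "addable_boxes r p q S = {x. x \<notin> S \<and> insert x S \<in> young r p q}"

lemma card_up_steps:
  assumes "S \<in> young r p q"
  shows "card (up_steps r p q S) = Suc (card (addable_boxes r p q S))"
proof -
  have "up_steps r p q S = insert S ((\<lambda>x. insert x S) ` addable_boxes r p q S)"
    using assms by (auto simp: up_steps_def adds_at_most_one_def addable_boxes_def)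
  moreover have "S \<notin> (\<lambda>x. insert x S) ` addable_boxes r p q S" by (auto simp: addable_boxes_def)
  moreover have "inj_on (\<lambda>x. insert x S) (addable_boxes r p q S)"
    by (rule inj_onI) (metis (mono_tags, lifting) addable_boxes_def insertE insertI1 mem_Collect_eq)
  moreover have "addable_boxes r p q S \<subseteq> boxes r p q"
    using young_subset by (fastforce simp: addable_boxes_def)
  then have "finite (addable_boxes r p q S)" by (rule finite_subset) (simp add: boxes_def)
  ultimately show ?thesis by (simp add: card_image)
qed

section \<open>Families of tableaux\<close>

definition shape :: "('c \<Rightarrow> nat \<Rightarrow> 'a set) \<Rightarrow> ('c \<times> nat \<times> nat) set" where
  "shape Q = {(c, a, b). b < card (Q c a)}"

definition tableau_family ::
    "nat \<Rightarrow> nat \<Rightarrow> nat \<Rightarrow> nat \<Rightarrow> (nat \<Rightarrow> nat \<Rightarrow> nat set) \<Rightarrow> bool" where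
  "tableau_family r p q t Q \<longleftrightarrow> (\<forall>c. tableau (Q c)) \<and> disjoint_family (\<lambda>c. entries (Q c)) \<and>
     (\<forall>c. entries (Q c) \<subseteq> {1..t}) \<and> shape Q \<subseteq> boxes r p q"

definition delete_entry :: "'a \<Rightarrow> ('c \<Rightarrow> nat \<Rightarrow> 'a set) \<Rightarrow> 'c \<Rightarrow> nat \<Rightarrow> 'a set" where
  "delete_entry m Q = (\<lambda>c a. Q c a - {m})"

definition insert_entry ::
    "('c \<times> 'a) option \<Rightarrow> ('c \<Rightarrow> nat \<Rightarrow> 'a::linorder set) \<Rightarrow> 'c \<Rightarrow> nat \<Rightarrow> 'a set" where
  "insert_entry d Q = (case d of None \<Rightarrow> Q | Some (c, i) \<Rightarrow> Q(c := tab_insert (Q c) i))"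

definition insertable ::
    "nat \<Rightarrow> nat \<Rightarrow> (nat \<times> nat) option \<Rightarrow> (nat \<Rightarrow> nat \<Rightarrow> nat set) \<Rightarrow> bool" where
  "insertable r t d Q \<longleftrightarrow>
     (\<forall>c i. d = Some (c, i) \<longrightarrow> c < r \<and> i \<in> {1..t} \<and> (\<forall>c. i \<notin> entries (Q c)))"

lemma insert_entry_None [simp]: "insert_entry None Q = Q"
  by (simp add: insert_entry_def)

lemma insert_entry_Some: "insert_entry (Some (c, i)) Q = Q(c := tab_insert (Q c) i)"
  by (simp add: insert_entry_def)

lemma insertable_None [simp]: "insertable r t None Q"
  by (simp add: insertable_def)

lemma insertable_Some:
  "insertable r t (Some (c, i)) Q \<longleftrightarrow> c < r \<and> i \<in> {1..t} \<and> (\<forall>c. i \<notin> entries (Q c))"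
  by (simp add: insertable_def)

lemma entries_delete_entry: "entries (delete_entry m Q c) = entries (Q c) - {m}"
  by (auto simp: delete_entry_def)

lemma tableau_familyD:
  assumes "tableau_family r p q t Q"
  shows "tableau (Q c)" "finite (Q c a)" "disjoint_family (\<lambda>c. entries (Q c))"
    "entries (Q c) \<subseteq> {1..t}" "shape Q \<subseteq> boxes r p q" "x \<in> Q c a \<Longrightarrow> x \<in> {1..t}"
proof -
  show "tableau (Q c)" "disjoint_family (\<lambda>c. entries (Q c))" "shape Q \<subseteq> boxes r p q"
    and entries_subset: "entries (Q c) \<subseteq> {1..t}"
    using assms unfolding tableau_family_def by blast+
  then show "finite (Q c a)" by (intro tableau_finite)
  show "x \<in> {1..t}" if "x \<in> Q c a" using entries_subset that by blast
qed

lemma tableau_family_subset: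
  assumes "tableau_family r p q t Q" "\<And>c. tableau (U c)" "\<And>c. entries (U c) \<subseteq> entries (Q c)"
    and "\<And>c. entries (U c) \<subseteq> {1..t'}" "shape U \<subseteq> boxes r p q"
  shows "tableau_family r p q t' U"
proof -
  have "disjoint_family (\<lambda>c. entries (U c))"
    using tableau_familyD(3)[OF assms(1)] assms(3) by (rule disjoint_family_subset)
  then show ?thesis using assms(2,4,5) by (simp add: tableau_family_def)
qed

lemma shape_empty [simp]: "shape (\<lambda>_ _. {}) = {}"
  by (simp add: shape_def)

lemma tableau_family_empty: "tableau_family r p q t (\<lambda>_ _. {})"
  by (simp add: tableau_family_def tableau_empty disjoint_family_on_def)

lemma shape_eq_iff: "shape Q = shape Q' \<longleftrightarrow> (\<forall>c a. card (Q c a) = card (Q' c a))"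
proof
  assume shapes_eq: "shape Q = shape Q'"
  have "{..<card (Q c a)} = {..<card (Q' c a)}" for c a
    using shapes_eq by (auto simp: shape_def set_eq_iff)
  then show "\<forall>c a. card (Q c a) = card (Q' c a)" by simp
qed (simp add: shape_def)

lemma shape_eq_empty_iff:
  assumes "tableau_family r p q t Q"
  shows "shape Q = {} \<longleftrightarrow> Q = (\<lambda>_ _. {})"
proof
  assume "shape Q = {}"
  then have "card (Q c a) = 0" for c a by (force simp: shape_def)
  then show "Q = (\<lambda>_ _. {})" using tableau_familyD(2)[OF assms] by (simp add: fun_eq_iff)
qed simp

lemma shape_add_box:
  assumes "\<And>c' b. card (Q c' b) = card (U c' b) + of_bool (c' = c \<and> b = a)"
  shows "shape Q = insert (c, a, card (U c a)) (shape U)" "(c, a, card (U c a)) \<notin> shape U"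
  using assms by (auto simp: shape_def less_Suc_eq of_bool_def split: if_splits)

lemma shape_in_young:
  assumes "tableau_family r p q t Q"
  shows "shape Q \<in> young r p q"
proof -
  have "(c, a', b') \<in> shape Q" if "(c, a, b) \<in> shape Q" "a' \<le> a" "b' \<le> b" for c a b a' b'
    using that tableau_card_antimono[OF tableau_familyD(1)[OF assms], of a' a c]
    by (auto simp: shape_def)
  then show ?thesis using tableau_familyD(5)[OF assms] unfolding young_def by blast
qed

lemma tableau_family_delete_entry:
  assumes "tableau_family r p q (Suc t) Q"
  shows "tableau_family r p q t (delete_entry (Suc t) Q)"
proof (rule tableau_family_subset[OF assms])
  note family = tableau_familyD[OF assms]
  have "x \<le> Suc t" if "x \<in> Q c a" for x c a using family(6)[OF that] by simp
  then show "tableau (delete_entry (Suc t) Q c)" for c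
    unfolding delete_entry_def by (intro tableau_delete_greatest family(1))
  show "entries (delete_entry (Suc t) Q c) \<subseteq> entries (Q c)" for c
    by (auto simp: entries_delete_entry)
  have "{1..Suc t} - {Suc t} = {1..t}" by auto
  then show "entries (delete_entry (Suc t) Q c) \<subseteq> {1..t}" for c
    using family(4)[of c] unfolding entries_delete_entry by blast
  have "shape (delete_entry (Suc t) Q) \<subseteq> shape Q"
    using family(2)
    by (auto simp: shape_def delete_entry_def intro: order.strict_trans2 card_Diff1_le)
  then show "shape (delete_entry (Suc t) Q) \<subseteq> boxes r p q" using family(5) by blast
qed

lemma tableau_family_insert_entry:
  assumes "tableau_family r p q t U" "insertable r t d U" "shape (insert_entry d U) \<subseteq> boxes r p q"
  shows "tableau_family r p q t (insert_entry d U)"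
proof (cases d)
  case None
  then show ?thesis using assms(1) by simp
next
  case (Some ci)
  then obtain c i where d_eq: "d = Some (c, i)" by (cases ci) auto
  note family = tableau_familyD[OF assms(1)]
  have fresh: "i \<in> {1..t}" "\<And>c. i \<notin> entries (U c)"
    using assms(2) by (auto simp: d_eq insertable_Some)
  have inserted_tableau: "tableau (tab_insert (U c) i)"
    "entries (tab_insert (U c) i) = insert i (entries (U c))"
    using tableau_tab_insert[OF family(1) fresh(2)] by auto
  have entries_eq: "entries (insert_entry d U c') =
      (if c' = c then insert i (entries (U c)) else entries (U c'))" for c'
    using inserted_tableau(2) by (simp add: d_eq insert_entry_Some)
  have "disjoint_family (\<lambda>c. entries (insert_entry d U c))"
    using family(3) fresh(2) unfolding entries_eq disjoint_family_on_def by auto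
  moreover have "tableau (insert_entry d U c')" for c'
    using inserted_tableau(1) family(1) by (simp add: d_eq insert_entry_Some)
  moreover have "entries (insert_entry d U c') \<subseteq> {1..t}" for c'
    using family(4) fresh(1) unfolding entries_eq by simp
  ultimately show ?thesis using assms(3) by (simp add: tableau_family_def)
qed

section \<open>Reversing insertions and deletions\<close>

definition insertion_preimages :: "nat \<Rightarrow> nat \<Rightarrow> nat \<Rightarrow> nat \<Rightarrow> (nat \<Rightarrow> nat \<Rightarrow> nat set) \<Rightarrow>
    ((nat \<times> nat) option \<times> (nat \<Rightarrow> nat \<Rightarrow> nat set)) set" where
  "insertion_preimages r p q t Q =
     {(d, U). tableau_family r p q t U \<and> insertable r t d U \<and> insert_entry d U = Q}"

definition deletion_preimages ::
    "nat \<Rightarrow> nat \<Rightarrow> nat \<Rightarrow> nat \<Rightarrow> (nat \<Rightarrow> nat \<Rightarrow> nat set) \<Rightarrow> (nat \<Rightarrow> nat \<Rightarrow> nat set) set" where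
  "deletion_preimages r p q t U =
     {Q. tableau_family r p q (Suc t) Q \<and> delete_entry (Suc t) Q = U}"

lemma shape_insert_entry_Some:
  assumes "tableau_family r p q t U" "insertable r t (Some (c, i)) U"
  shows "\<exists>a b. (c, a, b) \<notin> shape U \<and>
    shape (insert_entry (Some (c, i)) U) = insert (c, a, b) (shape U)"
proof -
  have "tableau (U c)" "i \<notin> entries (U c)"
    using tableau_familyD(1)[OF assms(1)] assms(2) by (auto simp: insertable_Some)
  then obtain a where "\<And>b. card (tab_insert (U c) i b) = card (U c b) + of_bool (b = a)"
    using card_tab_insert[of "U c" i] by blast
  then have "card (insert_entry (Some (c, i)) U c' b) = card (U c' b) + of_bool (c' = c \<and> b = a)"
    for c' b by (simp add: insert_entry_Some)
  from shape_add_box[OF this] show ?thesis by blast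
qed

lemma insertion_preimages_None_iff:
  assumes "(d, U) \<in> insertion_preimages r p q t Q"
  shows "d = None \<longleftrightarrow> shape U = shape Q"
proof (cases d)
  case None
  then show ?thesis using assms by (simp add: insertion_preimages_def)
next
  case (Some ci)
  moreover obtain c i where "ci = (c, i)" by (cases ci)
  ultimately show ?thesis
    using assms shape_insert_entry_Some[of r p q t U c i] unfolding insertion_preimages_def by blast
qed

lemma inj_on_shape_insertion_preimages:
  "inj_on (\<lambda>(d, U). shape U) (insertion_preimages r p q t Q)"
proof (rule inj_onI, clarify)
  fix d U d' U'
  assume preimages: "(d, U) \<in> insertion_preimages r p q t Q"
    "(d', U') \<in> insertion_preimages r p q t Q"
    and shapes_eq: "shape U = shape U'"
  have None_iff: "d = None \<longleftrightarrow> d' = None"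
    using insertion_preimages_None_iff[OF preimages(1)]
      insertion_preimages_None_iff[OF preimages(2)] shapes_eq by simp
  show "d = d' \<and> U = U'"
  proof (cases d)
    case None
    then show ?thesis using None_iff preimages by (simp add: insertion_preimages_def)
  next
    case (Some ci)
    then obtain c i c' i' where d_eq: "d = Some (c, i)" "d' = Some (c', i')"
      using None_iff by (cases ci; cases d') auto
    have U_insert: "tableau_family r p q t U" "insertable r t (Some (c, i)) U"
        "Q = insert_entry (Some (c, i)) U"
      and U'_insert: "tableau_family r p q t U'" "insertable r t (Some (c', i')) U'"
        "Q = insert_entry (Some (c', i')) U'"
      using preimages by (auto simp: insertion_preimages_def d_eq)
    have "c = c'"
      using shape_insert_entry_Some[OF U_insert(1,2)] shape_insert_entry_Some[OF U'_insert(1,2)]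
      unfolding U_insert(3)[symmetric] U'_insert(3)[symmetric] shapes_eq by blast
    have "tab_insert (U c) i = tab_insert (U' c) i'"
      using U_insert(3) U'_insert(3) \<open>c = c'\<close> by (metis fun_upd_same insert_entry_Some)
    then have "U c = U' c \<and> i = i'"
      using U_insert(2) U'_insert(2) shapes_eq tableau_familyD(1)[OF U_insert(1)]
        tableau_familyD(1)[OF U'_insert(1)]
      by (intro tab_insert_inj) (auto simp: insertable_Some shape_eq_iff)
    moreover have "U x = U' x" if "x \<noteq> c" for x
      using U_insert(3) U'_insert(3) \<open>c = c'\<close> that by (metis fun_upd_other insert_entry_Some)
    ultimately show ?thesis using d_eq \<open>c = c'\<close> by (metis ext)
  qed
qed

lemma removable_box_row_lengths:
  assumes "S \<in> young r p q" "(c, a, b) \<notin> S" "shape Q = insert (c, a, b) S"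
  shows "card (Q c a) = Suc b" "card (Q c (Suc a)) < card (Q c a)"
proof -
  have "(c, a, b) \<in> shape Q" "(c, a, Suc b) \<notin> shape Q" "(c, Suc a, b) \<notin> shape Q"
    using assms(2,3) young_downward_closed[OF assms(1), of c a "Suc b" a b]
      young_downward_closed[OF assms(1), of c "Suc a" b a b] by auto
  then show "card (Q c a) = Suc b" "card (Q c (Suc a)) < card (Q c a)" by (auto simp: shape_def)
qed

lemma removed_entry_notin_entries:
  assumes "tableau_family r p q t Q" "entries (Q c) = insert i (entries T)" "i \<notin> entries T"
  shows "i \<notin> entries ((Q(c := T)) c')"
proof (cases "c' = c")
  case False
  then have "entries (Q c') \<inter> entries (Q c) = {}"
    using tableau_familyD(3)[OF assms(1)] unfolding disjoint_family_on_def by blast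
  then show ?thesis using assms(2) False by auto
qed (use assms(3) in simp)

lemma insertion_preimage_of_removable_box:
  assumes family: "tableau_family r p q t Q"
    and removable: "S \<in> young r p q" "(c, a, b) \<notin> S" "shape Q = insert (c, a, b) S"
  obtains i U where "(Some (c, i), U) \<in> insertion_preimages r p q t Q" "shape U = S"
proof -
  note row_lengths = removable_box_row_lengths[OF removable]
  obtain T i where T_insert: "tableau T" "i \<notin> entries T" "tab_insert T i = Q c"
      "\<And>b. card (Q c b) = card (T b) + of_bool (b = a)"
    using tab_insert_reverse[OF tableau_familyD(1)[OF family] row_lengths(2)] by blast
  have entries_Qc: "entries (Q c) = insert i (entries T)"
    using tableau_tab_insert[OF T_insert(1,2)] T_insert(3) by simp
  define U where "U = Q(c := T)"
  have "card (Q c' b) = card (U c' b) + of_bool (c' = c \<and> b = a)" for c' b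
    using T_insert(4) by (simp add: U_def)
  note shape_add_box[OF this]
  moreover have "card (U c a) = b" using T_insert(4)[of a] row_lengths(1) by (simp add: U_def)
  ultimately have shape_U: "shape U = S" using removable(2,3) by (metis Diff_insert_absorb)
  have entries_subset: "entries (U c') \<subseteq> entries (Q c')" for c'
    using entries_Qc by (auto simp: U_def)
  have "tableau_family r p q t U"
  proof (rule tableau_family_subset[OF family _ entries_subset])
    show "tableau (U c')" for c'
      using T_insert(1) tableau_familyD(1)[OF family] by (simp add: U_def)
    show "entries (U c') \<subseteq> {1..t}" for c'
      using entries_subset tableau_familyD(4)[OF family] by blast
    show "shape U \<subseteq> boxes r p q" unfolding shape_U using removable(1) by (rule young_subset)
  qed
  moreover have "insertable r t (Some (c, i)) U"
  proof -
    have "i \<notin> entries (U c')" for c'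
      unfolding U_def by (rule removed_entry_notin_entries[OF family entries_Qc T_insert(2)])
    moreover have "i \<in> {1..t}" using entries_Qc tableau_familyD(4)[OF family] by blast
    moreover have "c < r" using tableau_familyD(5)[OF family] removable(3) by (auto simp: boxes_def)
    ultimately show ?thesis by (simp add: insertable_Some)
  qed
  moreover have "insert_entry (Some (c, i)) U = Q"
    using T_insert(3) by (simp add: insert_entry_Some U_def)
  ultimately show thesis using that shape_U by (simp add: insertion_preimages_def)
qed

lemma shape_insertion_preimage:
  assumes "(d, U) \<in> insertion_preimages r p q t Q"
  shows "shape U \<in> down_steps r p q (shape Q)"
proof -
  have "adds_at_most_one (shape U) (shape Q)"
  proof (cases d)
    case None
    then show ?thesis
      using insertion_preimages_None_iff[OF assms] by (simp add: adds_at_most_one_def)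
  next
    case (Some ci)
    moreover obtain c i where "ci = (c, i)" by (cases ci)
    ultimately show ?thesis
      using assms shape_insert_entry_Some[of r p q t U c i]
      unfolding insertion_preimages_def adds_at_most_one_def by blast
  qed
  then show ?thesis
    using assms shape_in_young by (auto simp: down_steps_def insertion_preimages_def)
qed

lemma bij_betw_shape_insertion_preimages:
  assumes family: "tableau_family r p q t Q"
  shows "bij_betw (\<lambda>(d, U). shape U) (insertion_preimages r p q t Q) (down_steps r p q (shape Q))"
proof (rule bij_betw_imageI[OF inj_on_shape_insertion_preimages])
  have "S \<in> (\<lambda>(d, U). shape U) ` insertion_preimages r p q t Q"
    if "S \<in> down_steps r p q (shape Q)" for S
  proof -
    have S_below: "S \<in> young r p q" "adds_at_most_one S (shape Q)"
      using that by (auto simp: down_steps_def)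
    from S_below(2) consider (same) "S = shape Q"
      | (box_removed) c a b where "(c, a, b) \<notin> S" "shape Q = insert (c, a, b) S"
      by (auto simp: adds_at_most_one_def)
    then show ?thesis
    proof cases
      case same
      then show ?thesis
        using family by (intro image_eqI[of _ _ "(None, Q)"]) (auto simp: insertion_preimages_def)
    next
      case box_removed
      then obtain i U where "(Some (c, i), U) \<in> insertion_preimages r p q t Q" "shape U = S"
        using insertion_preimage_of_removable_box[OF family S_below(1)] by blast
      then show ?thesis by (intro image_eqI[of _ _ "(Some (c, i), U)"]) auto
    qed
  qed
  then show "(\<lambda>(d, U). shape U) ` insertion_preimages r p q t Q = down_steps r p q (shape Q)"
    using shape_insertion_preimage by fast
qed

lemma deletion_preimages_row:
  assumes "Q \<in> deletion_preimages r p q t U"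
  shows "Q c a = (if Suc t \<in> Q c a then insert (Suc t) (U c a) else U c a)"
    "card (Q c a) = card (U c a) + of_bool (Suc t \<in> Q c a)"
proof -
  have row_U: "U c a = Q c a - {Suc t}" and finite_row: "finite (Q c a)"
    using assms tableau_familyD(2) by (auto simp: deletion_preimages_def delete_entry_def)
  show "Q c a = (if Suc t \<in> Q c a then insert (Suc t) (U c a) else U c a)" using row_U by auto
  show "card (Q c a) = card (U c a) + of_bool (Suc t \<in> Q c a)"
    using row_U finite_row card_Suc_Diff1[of "Q c a" "Suc t"] by auto
qed

lemma inj_on_shape_deletion_preimages: "inj_on shape (deletion_preimages r p q t U)"
proof (rule inj_onI)
  fix Q Q'
  assume preimages: "Q \<in> deletion_preimages r p q t U" "Q' \<in> deletion_preimages r p q t U"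
    and shapes_eq: "shape Q = shape Q'"
  have "Q c a = Q' c a" for c a
  proof -
    have "Suc t \<in> Q c a \<longleftrightarrow> Suc t \<in> Q' c a"
      using shapes_eq deletion_preimages_row(2)[OF preimages(1), of c a]
        deletion_preimages_row(2)[OF preimages(2), of c a]
      by (auto simp: shape_eq_iff of_bool_def split: if_splits)
    then show ?thesis
      using deletion_preimages_row(1)[OF preimages(1), of c a]
        deletion_preimages_row(1)[OF preimages(2), of c a]
      by simp
  qed
  then show "Q = Q'" by blast
qed

lemma shape_deletion_preimage:
  assumes "Q \<in> deletion_preimages r p q t U"
  shows "adds_at_most_one (shape U) (shape Q)"
proof (cases "\<exists>c a. Suc t \<in> Q c a")
  case True
  then obtain c a where new_entry: "Suc t \<in> Q c a" by blast
  have family: "tableau_family r p q (Suc t) Q" using assms by (simp add: deletion_preimages_def)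
  have "Suc t \<in> Q c' b \<longleftrightarrow> c' = c \<and> b = a" for c' b
  proof
    assume "Suc t \<in> Q c' b"
    moreover from this have "c' = c"
      using new_entry tableau_familyD(3)[OF family] unfolding disjoint_family_on_def by blast
    ultimately show "c' = c \<and> b = a"
      using new_entry tableau_familyD(1)[OF family, of c]
      unfolding tableau_def disjoint_family_on_def by blast
  qed (use new_entry in simp)
  then have "card (Q c' b) = card (U c' b) + of_bool (c' = c \<and> b = a)" for c' b
    using deletion_preimages_row(2)[OF assms] by simp
  from shape_add_box[OF this] show ?thesis unfolding adds_at_most_one_def by blast
next
  case False
  then have "shape Q = shape U"
    using deletion_preimages_row(2)[OF assms] by (simp add: shape_eq_iff)
  then show ?thesis by (simp add: adds_at_most_one_def)
qed

lemma deletion_preimage_of_addable_box: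
  assumes family: "tableau_family r p q t U"
    and addable: "S \<in> young r p q" "(c, a, b) \<notin> shape U" "S = insert (c, a, b) (shape U)"
  obtains Q where "Q \<in> deletion_preimages r p q t U" "shape Q = S"
proof -
  define Q where "Q = U(c := (U c)(a := insert (Suc t) (U c a)))"
  have fresh: "Suc t \<notin> entries (U c)" for c
    using tableau_familyD(6)[OF family, of "Suc t" c] by auto
  have "(c, a, card (U c a)) \<in> S"
    using young_downward_closed[OF addable(1), of c a b a "card (U c a)"] addable(2,3)
    by (auto simp: shape_def)
  then have b_eq: "b = card (U c a)" using addable(2,3) by (auto simp: shape_def)
  have corner: "a = 0 \<or> card (U c a) < card (U c (a - 1))"
  proof (cases a)
    case (Suc a')
    then have "(c, a', b) \<in> shape U"
      using young_downward_closed[OF addable(1), of c a b a' b] addable(3) by auto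
    then show ?thesis using Suc b_eq by (simp add: shape_def)
  qed simp
  have "card (Q c' b) = card (U c' b) + of_bool (c' = c \<and> b = a)" for c' b
    using fresh[of c] tableau_familyD(2)[OF family, of c a] by (auto simp: Q_def)
  then have shape_Q: "shape Q = S" using shape_add_box(1)[of Q U c a] addable(3) b_eq by simp
  have entries_Q: "entries (Q c') =
      (if c' = c then insert (Suc t) (entries (U c)) else entries (U c'))" for c'
    by (auto simp: Q_def split: if_splits)
  have "tableau ((U c)(a := insert (Suc t) (U c a)))"
  proof (rule tableau_add_greatest[OF tableau_familyD(1)[OF family] _ corner])
    show "x < Suc t" if "x \<in> U c b" for b x using tableau_familyD(6)[OF family that] by simp
  qed
  then have "tableau (Q c')" for c' using tableau_familyD(1)[OF family] by (simp add: Q_def)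
  moreover have "disjoint_family (\<lambda>c. entries (Q c))"
    using tableau_familyD(3)[OF family] fresh unfolding entries_Q disjoint_family_on_def by auto
  moreover have "entries (U c') \<subseteq> {1..Suc t}" for c'
    using tableau_familyD(4)[OF family, of c'] by (rule order_trans) auto
  then have "entries (Q c') \<subseteq> {1..Suc t}" for c' unfolding entries_Q by simp
  moreover have "shape Q \<subseteq> boxes r p q" unfolding shape_Q using addable(1) by (rule young_subset)
  ultimately have "tableau_family r p q (Suc t) Q" by (simp add: tableau_family_def)
  moreover have "delete_entry (Suc t) Q = U"
    using fresh by (auto simp: delete_entry_def Q_def fun_eq_iff)
  ultimately show thesis using that shape_Q by (simp add: deletion_preimages_def)
qed

lemma bij_betw_shape_deletion_preimages:
  assumes family: "tableau_family r p q t U"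
  shows "bij_betw shape (deletion_preimages r p q t U) (up_steps r p q (shape U))"
proof (rule bij_betw_imageI[OF inj_on_shape_deletion_preimages])
  have "shape Q \<in> up_steps r p q (shape U)" if "Q \<in> deletion_preimages r p q t U" for Q
    using that shape_deletion_preimage[OF that] shape_in_young
    by (auto simp: up_steps_def deletion_preimages_def)
  moreover have "S \<in> shape ` deletion_preimages r p q t U" if "S \<in> up_steps r p q (shape U)" for S
  proof -
    have S_above: "S \<in> young r p q" "adds_at_most_one (shape U) S"
      using that by (auto simp: up_steps_def)
    from S_above(2) consider (same) "S = shape U"
      | (box_added) c a b where "(c, a, b) \<notin> shape U" "S = insert (c, a, b) (shape U)"
      by (auto simp: adds_at_most_one_def)
    then show ?thesis
    proof cases
      case same
      have "Suc t \<notin> U c a" for c a using tableau_familyD(6)[OF family, of "Suc t" c a] by auto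
      then have "delete_entry (Suc t) U = U" by (simp add: delete_entry_def)
      moreover have "entries (U c) \<subseteq> {1..Suc t}" for c
        using tableau_familyD(4)[OF family, of c] by (rule order_trans) auto
      then have "tableau_family r p q (Suc t) U"
        using tableau_familyD(1,5)[OF family] by (intro tableau_family_subset[OF family]) auto
      ultimately show ?thesis using same by (auto simp: deletion_preimages_def)
    next
      case box_added
      from deletion_preimage_of_addable_box[OF family S_above(1) this] show ?thesis by blast
    qed
  qed
  ultimately show "shape ` deletion_preimages r p q t U = up_steps r p q (shape U)" by blast
qed

section \<open>Insertion words\<close>

text \<open>Time runs backwards: the list holds the insertions for the times t + 1, t + 2, ...\<close>

primrec word_family :: "nat \<Rightarrow> (nat \<times> nat) option list \<Rightarrow> nat \<Rightarrow> nat \<Rightarrow> nat set" where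
  "word_family t [] = (\<lambda>_ _. {})"
| "word_family t (d # ds) = insert_entry d (delete_entry (Suc t) (word_family (Suc t) ds))"

primrec admissible :: "nat \<Rightarrow> nat \<Rightarrow> nat \<Rightarrow> nat \<Rightarrow> (nat \<times> nat) option list \<Rightarrow> bool" where
  "admissible r p q t [] = True"
| "admissible r p q t (d # ds) \<longleftrightarrow> admissible r p q (Suc t) ds \<and>
     insertable r t d (delete_entry (Suc t) (word_family (Suc t) ds)) \<and>
     shape (word_family t (d # ds)) \<subseteq> boxes r p q"

definition admissible_words :: "nat \<Rightarrow> nat \<Rightarrow> nat \<Rightarrow> nat \<Rightarrow> nat \<Rightarrow> (nat \<Rightarrow> nat \<Rightarrow> nat set) \<Rightarrow>
    (nat \<times> nat) option list set" where
  "admissible_words r p q m t Q =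
     {ds. length ds = m \<and> admissible r p q t ds \<and> word_family t ds = Q}"

lemma tableau_family_word_family:
  "admissible r p q t ds \<Longrightarrow> tableau_family r p q t (word_family t ds)"
proof (induction ds arbitrary: t)
  case Nil
  then show ?case by (simp add: tableau_family_empty)
next
  case (Cons d ds)
  then have "tableau_family r p q t (delete_entry (Suc t) (word_family (Suc t) ds))"
    by (intro tableau_family_delete_entry) simp
  then show ?case using Cons.prems tableau_family_insert_entry by simp
qed

lemma admissible_words_Suc:
  assumes "tableau_family r p q t Q"
  shows "admissible_words r p q (Suc m) t Q =
    (\<Union>((d, U), Q')\<in>(SIGMA x:insertion_preimages r p q t Q. deletion_preimages r p q t (snd x)).
      (#) d ` admissible_words r p q m (Suc t) Q')" (is "_ = ?R")
proof (intro subset_antisym subsetI)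
  fix ds assume "ds \<in> admissible_words r p q (Suc m) t Q"
  then obtain d ds' where ds_parts: "ds = d # ds'" "length ds' = m" "admissible r p q (Suc t) ds'"
      "insertable r t d (delete_entry (Suc t) (word_family (Suc t) ds'))" "word_family t ds = Q"
    by (auto simp: admissible_words_def length_Suc_conv)
  let ?Q' = "word_family (Suc t) ds'"
  have family: "tableau_family r p q (Suc t) ?Q'"
    using ds_parts(3) by (rule tableau_family_word_family)
  have "(d, delete_entry (Suc t) ?Q') \<in> insertion_preimages r p q t Q"
    using ds_parts tableau_family_delete_entry[OF family] by (simp add: insertion_preimages_def)
  moreover have "?Q' \<in> deletion_preimages r p q t (delete_entry (Suc t) ?Q')"
    using family by (simp add: deletion_preimages_def)
  moreover have "ds' \<in> admissible_words r p q m (Suc t) ?Q'"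
    using ds_parts(2,3) by (simp add: admissible_words_def)
  ultimately show "ds \<in> ?R" unfolding ds_parts(1) by force
next
  fix ds assume "ds \<in> ?R"
  then obtain d U Q' ds' where "(d, U) \<in> insertion_preimages r p q t Q"
      "Q' \<in> deletion_preimages r p q t U" "ds' \<in> admissible_words r p q m (Suc t) Q'" "ds = d # ds'"
    by auto
  then show "ds \<in> admissible_words r p q (Suc m) t Q"
    using tableau_familyD(5)[OF assms]
    by (auto simp: admissible_words_def insertion_preimages_def deletion_preimages_def)
qed

lemma card_UN_Cons_image:
  assumes "finite I" "\<And>x. x \<in> I \<Longrightarrow> finite (V x)"
    and "\<And>x y. x \<in> I \<Longrightarrow> y \<in> I \<Longrightarrow> x \<noteq> y \<Longrightarrow> f x = f y \<Longrightarrow> V x \<inter> V y = {}"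
  shows "finite (\<Union>x\<in>I. (#) (f x) ` V x) \<and> card (\<Union>x\<in>I. (#) (f x) ` V x) = (\<Sum>x\<in>I. card (V x))"
proof
  show "finite (\<Union>x\<in>I. (#) (f x) ` V x)" using assms(1,2) by blast
  have "(#) (f x) ` V x \<inter> (#) (f y) ` V y = {}" if "x \<in> I" "y \<in> I" "x \<noteq> y" for x y
    using assms(3)[OF that] by auto
  then have "card (\<Union>x\<in>I. (#) (f x) ` V x) = (\<Sum>x\<in>I. card ((#) (f x) ` V x))"
    using assms(1,2) by (intro card_UN_disjoint) auto
  then show "card (\<Union>x\<in>I. (#) (f x) ` V x) = (\<Sum>x\<in>I. card (V x))"
    by (simp add: card_image)
qed

theorem card_admissible_words:
  assumes "tableau_family r p q t Q"
  shows "finite (admissible_words r p q m t Q) \<and>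
    card (admissible_words r p q m t Q) = vacillation_count r p q m (shape Q)"
  using assms
proof (induction m arbitrary: t Q)
  case 0
  have "admissible_words r p q 0 t Q = (if Q = (\<lambda>_ _. {}) then {[]} else {})"
    by (auto simp: admissible_words_def)
  then show ?case using shape_eq_empty_iff[OF 0] by simp
next
  case (Suc m)
  let ?W = "\<lambda>x. admissible_words r p q m (Suc t) (snd x)"
  let ?A = "insertion_preimages r p q t Q" and ?B = "\<lambda>x. deletion_preimages r p q t (snd x)"
  let ?I = "SIGMA x:?A. ?B x" and ?up = "up_steps r p q" and ?N = "vacillation_count r p q m"
  have bij_A: "bij_betw (\<lambda>(d, U). shape U) ?A (down_steps r p q (shape Q))"
    by (rule bij_betw_shape_insertion_preimages[OF Suc.prems])
  have bij_B: "bij_betw shape (?B x) (?up (shape (snd x)))" if "x \<in> ?A" for x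
    using that by (intro bij_betw_shape_deletion_preimages) (auto simp: insertion_preimages_def)
  have finite_preimages: "finite ?A" "\<And>x. x \<in> ?A \<Longrightarrow> finite (?B x)"
    using bij_betw_finite[OF bij_A] bij_betw_finite[OF bij_B] finite_down_steps finite_up_steps
    by auto
  have IH: "finite (?W x)" "card (?W x) = ?N (shape (snd x))" if "x \<in> ?I" for x
    using Suc.IH[of "Suc t" "snd x"] that by (auto simp: deletion_preimages_def)
  have words_eq: "admissible_words r p q (Suc m) t Q = (\<Union>x\<in>?I. (#) (fst (fst x)) ` ?W x)"
    unfolding admissible_words_Suc[OF Suc.prems] by (simp add: case_prod_beta)
  have "finite (\<Union>x\<in>?I. (#) (fst (fst x)) ` ?W x) \<and>
      card (\<Union>x\<in>?I. (#) (fst (fst x)) ` ?W x) = (\<Sum>x\<in>?I. card (?W x))"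
    by (rule card_UN_Cons_image)
      (use finite_preimages IH(1) in \<open>auto simp: admissible_words_def deletion_preimages_def\<close>)
  moreover have "(\<Sum>x\<in>?I. card (?W x)) = (\<Sum>x\<in>?A. \<Sum>Q'\<in>?B x. ?N (shape Q'))"
    using IH(2) finite_preimages by (simp add: sum.Sigma case_prod_beta)
  moreover have "\<dots> = (\<Sum>x\<in>?A. \<Sum>S2\<in>?up (shape (snd x)). ?N S2)"
    using bij_B by (intro sum.cong refl sum.reindex_bij_betw)
  moreover have "\<dots> = vacillation_count r p q (Suc m) (shape Q)"
    using sum.reindex_bij_betw[OF bij_A, of "\<lambda>S1. \<Sum>S2\<in>?up S1. ?N S2"] by (simp add: case_prod_beta)
  ultimately show ?case unfolding words_eq by simp
qed

section \<open>Walks in multigraphs\<close>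

definition walks :: "('v, 'e) multigraph \<Rightarrow> 'v \<Rightarrow> nat \<Rightarrow> 'v \<Rightarrow> 'e list set" where
  "walks G u m v = {es. walk G u es v \<and> length es = m}"

lemma walk_start_in_verts: "walk G u es v \<Longrightarrow> u \<in> verts G"
  by (cases es) auto

lemma walk_edges: "walk G u es v \<Longrightarrow> set es \<subseteq> edges G"
  by (induction es arbitrary: u) auto

lemma finite_walks:
  assumes "finite (edges G)"
  shows "finite (walks G u m v)"
  by (rule finite_subset[OF _ finite_lists_length_eq[OF assms, of m]])
    (auto simp: walks_def dest: walk_edges)

lemma walks_Suc:
  assumes "u \<in> verts G"
  shows "walks G u (Suc m) v =
    (\<Union>(w, e)\<in>(SIGMA w:verts G. {e \<in> edges G. ends G e = {u, w}}). (#) e ` walks G w m v)"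
proof (intro subset_antisym subsetI)
  fix es assume "es \<in> walks G u (Suc m) v"
  then obtain e es' w where "es = e # es'" "length es' = m" "e \<in> edges G" "ends G e = {u, w}"
      "walk G w es' v"
    by (auto simp: walks_def length_Suc_conv)
  moreover from this have "w \<in> verts G" by (intro walk_start_in_verts)
  ultimately show "es \<in>
      (\<Union>(w, e)\<in>(SIGMA w:verts G. {e \<in> edges G. ends G e = {u, w}}). (#) e ` walks G w m v)"
    by (auto simp: walks_def)
qed (use assms in \<open>auto simp: walks_def\<close>)

lemma card_walks_Suc:
  assumes "finite (verts G)" "finite (edges G)" "u \<in> verts G"
  shows "card (walks G u (Suc m) v) =
    (\<Sum>w\<in>verts G. card {e \<in> edges G. ends G e = {u, w}} * card (walks G w m v))"
proof -
  let ?I = "SIGMA w:verts G. {e \<in> edges G. ends G e = {u, w}}"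
  have "walks G u (Suc m) v = (\<Union>x\<in>?I. (#) (snd x) ` walks G (fst x) m v)"
    unfolding walks_Suc[OF assms(3)] by (simp add: case_prod_beta)
  also have "card \<dots> = (\<Sum>x\<in>?I. card (walks G (fst x) m v))"
    using assms(1,2) finite_walks[OF assms(2)]
    by (intro conjunct2[OF card_UN_Cons_image]) (auto simp: doubleton_eq_iff)
  also have "\<dots> = (\<Sum>w\<in>verts G. \<Sum>e\<in>{e \<in> edges G. ends G e = {u, w}}. card (walks G w m v))"
    using sum.Sigma[of "verts G" "\<lambda>w. {e \<in> edges G. ends G e = {u, w}}"
      "\<lambda>w e. card (walks G w m v)"]
      assms(1,2) by (simp add: case_prod_beta)
  finally show ?thesis by simp
qed

section \<open>Matrices as families of Young diagrams\<close>

text \<open>The row of A for colour c lists the column heights of the diagram of that colour.\<close>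

definition mat_diagram :: "int mat \<Rightarrow> (nat \<times> nat \<times> nat) set" where
  "mat_diagram A = {(c, a, l). c < dim_row A \<and> l < dim_col A \<and> int a < A $$ (c, l)}"

definition height_mat :: "nat \<Rightarrow> nat \<Rightarrow> (nat \<times> nat \<times> nat) set \<Rightarrow> int mat" where
  "height_mat r q S = mat r q (\<lambda>(c, l). int (card {a. (c, a, l) \<in> S}))"

lemma mat_diagram_iff:
  "A \<in> carrier_mat r q \<Longrightarrow> (c, a, l) \<in> mat_diagram A \<longleftrightarrow> c < r \<and> l < q \<and> int a < A $$ (c, l)"
  by (auto simp: mat_diagram_def)

lemma mat_diagram_zero: "mat_diagram (0\<^sub>m r q) = {}"
  by (auto simp: mat_diagram_def)

lemma elem_mat_carrier: "elem_mat r q c l \<in> carrier_mat r q"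
  by (simp add: elem_mat_def)

lemma elem_mat_entry:
  "c' < r \<Longrightarrow> l' < q \<Longrightarrow> elem_mat r q c l $$ (c', l') = of_bool (c' = c \<and> l' = l)"
  by (simp add: elem_mat_def)

lemma downward_closed_mem_iff:
  fixes X :: "nat set"
  assumes "finite X" "\<And>a b. a \<in> X \<Longrightarrow> b \<le> a \<Longrightarrow> b \<in> X"
  shows "x \<in> X \<longleftrightarrow> x < card X"
proof
  assume "x \<in> X"
  then have "{..x} \<subseteq> X" using assms(2) by blast
  then show "x < card X" using card_mono[OF assms(1), of "{..x}"] by simp
next
  assume "x < card X"
  show "x \<in> X"
  proof (rule ccontr)
    assume "x \<notin> X"
    then have "X \<subseteq> {..<x}" using assms(2) by (metis lessThan_iff not_le_imp_less subsetI)
    then show False using \<open>x < card X\<close> card_mono[of "{..<x}" X] by simp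
  qed
qed

lemma young_mem_iff:
  assumes "S \<in> young r p q"
  shows "(c, a, l) \<in> S \<longleftrightarrow> a < card {a. (c, a, l) \<in> S}"
proof -
  have "finite {a. (c, a, l) \<in> S}"
    by (rule finite_subset[of _ "{..<p}"]) (use young_subset[OF assms] in \<open>auto simp: boxes_def\<close>)
  then have "a \<in> {a. (c, a, l) \<in> S} \<longleftrightarrow> a < card {a. (c, a, l) \<in> S}"
    by (rule downward_closed_mem_iff) (auto elim: young_downward_closed[OF assms])
  then show ?thesis by (simp only: mem_Collect_eq)
qed

lemma mat_diagram_height_mat:
  assumes "S \<in> young r p q"
  shows "mat_diagram (height_mat r q S) = S"
proof -
  have "(c, a, l) \<in> mat_diagram (height_mat r q S) \<longleftrightarrow> (c, a, l) \<in> S" for c a l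
    using young_mem_iff[OF assms, of c a l] young_subset[OF assms]
    by (auto simp: mat_diagram_def height_mat_def boxes_def)
  then show ?thesis by auto
qed

lemma height_mat_mat_diagram:
  assumes "A \<in> carrier_mat r q" "\<And>c l. c < r \<Longrightarrow> l < q \<Longrightarrow> 0 \<le> A $$ (c, l)"
  shows "height_mat r q (mat_diagram A) = A"
proof (rule eq_matI)
  fix c l assume "c < dim_row A" "l < dim_col A"
  then have in_range: "c < r" "l < q" using assms(1) by auto
  then have "{a. (c, a, l) \<in> mat_diagram A} = {..<nat (A $$ (c, l))}"
    using mat_diagram_iff[OF assms(1)] by auto
  then show "height_mat r q (mat_diagram A) $$ (c, l) = A $$ (c, l)"
    using assms(2) in_range by (simp add: height_mat_def)
qed (use assms(1) in \<open>auto simp: height_mat_def\<close>)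

lemma height_mat_insert:
  assumes "finite S" "(c, a, l) \<notin> S"
  shows "height_mat r q (insert (c, a, l) S) = height_mat r q S + elem_mat r q c l"
proof (rule eq_matI)
  fix c' l'
  assume "c' < dim_row (height_mat r q S + elem_mat r q c l)"
    "l' < dim_col (height_mat r q S + elem_mat r q c l)"
  then have in_range: "c' < r" "l' < q" by (auto simp: elem_mat_def)
  have "finite {a. (c', a, l') \<in> S}"
    by (rule finite_subset[OF _ finite_imageI[OF assms(1), of "\<lambda>(_, a, _). a"]]) force
  moreover have "{a'. (c', a', l') \<in> insert (c, a, l) S} =
      (if c' = c \<and> l' = l then insert a {a. (c', a, l') \<in> S} else {a. (c', a, l') \<in> S})" by auto
  ultimately have "card {a'. (c', a', l') \<in> insert (c, a, l) S} =
      card {a. (c', a, l') \<in> S} + of_bool (c' = c \<and> l' = l)" using assms(2) by auto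
  then show "height_mat r q (insert (c, a, l) S) $$ (c', l') =
      (height_mat r q S + elem_mat r q c l) $$ (c', l')"
    using in_range by (simp add: height_mat_def elem_mat_def)
qed (auto simp: height_mat_def elem_mat_def)

lemma mat_diagram_add_elem_mat:
  assumes "A \<in> carrier_mat r q" "c < r" "l < q" "0 \<le> A $$ (c, l)"
  shows "mat_diagram (A + elem_mat r q c l) = insert (c, nat (A $$ (c, l)), l) (mat_diagram A)"
    and "(c, nat (A $$ (c, l)), l) \<notin> mat_diagram A"
proof -
  have sum_carrier: "A + elem_mat r q c l \<in> carrier_mat r q" using assms(1) elem_mat_carrier by auto
  have "(A + elem_mat r q c l) $$ (c', l') = A $$ (c', l') + of_bool (c' = c \<and> l' = l)"
    if "c' < r" "l' < q" for c' l'
    using that assms(1) elem_mat_carrier[of r q c l] by (simp add: elem_mat_entry)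
  then have "(c', a', l') \<in> mat_diagram (A + elem_mat r q c l) \<longleftrightarrow>
      (c', a', l') \<in> insert (c, nat (A $$ (c, l)), l) (mat_diagram A)" for c' a' l'
    using assms unfolding insert_iff mat_diagram_iff[OF sum_carrier] mat_diagram_iff[OF assms(1)]
    by (auto simp: of_bool_def split: if_splits)
  then show "mat_diagram (A + elem_mat r q c l) = insert (c, nat (A $$ (c, l)), l) (mat_diagram A)"
    by auto
  show "(c, nat (A $$ (c, l)), l) \<notin> mat_diagram A"
    using assms(4) by (auto simp: mat_diagram_iff[OF assms(1)])
qed

definition adds_at_most_one_unit :: "nat \<Rightarrow> nat \<Rightarrow> int mat \<Rightarrow> int mat \<Rightarrow> bool" where
  "adds_at_most_one_unit r q A M \<longleftrightarrow> M = A \<or> (\<exists>c<r. \<exists>l<q. M = A + elem_mat r q c l)"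

lemma adds_at_most_one_mat_diagram:
  assumes "A \<in> carrier_mat r q" "\<And>c l. c < r \<Longrightarrow> l < q \<Longrightarrow> 0 \<le> A $$ (c, l)"
    "adds_at_most_one_unit r q A M"
  shows "adds_at_most_one (mat_diagram A) (mat_diagram M)"
  using assms(3) mat_diagram_add_elem_mat[OF assms(1)] assms(2)
  unfolding adds_at_most_one_def adds_at_most_one_unit_def by metis

lemma mat_diff_eq_iff:
  fixes A B M N :: "'a::ab_group_add mat"
  assumes "A \<in> carrier_mat nr nc" "B \<in> carrier_mat nr nc" "M \<in> carrier_mat nr nc"
    "N \<in> carrier_mat nr nc"
  shows "A - B = M \<longleftrightarrow> A = B + M" "A - B = - M \<longleftrightarrow> B = A + M" "A - B = M - N \<longleftrightarrow> A + N = B + M"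
proof -
  have entry: "x - y = z \<longleftrightarrow> x = y + z" "x - y = - z \<longleftrightarrow> y = x + z" "x - y = z - w \<longleftrightarrow> x + w = y + z"
    for x y z w :: 'a
    by (auto simp: algebra_simps)
  show "A - B = M \<longleftrightarrow> A = B + M" using assms by (auto simp: mat_eq_iff entry(1))
  show "A - B = - M \<longleftrightarrow> B = A + M" using assms by (auto simp: mat_eq_iff entry(2))
  show "A - B = M - N \<longleftrightarrow> A + N = B + M" using assms by (auto simp: mat_eq_iff entry(3))
qed

lemma G_adj_iff:
  assumes "A \<in> carrier_mat r (k - 1)" "B \<in> carrier_mat r (k - 1)"
  shows "G_adj k r A B \<longleftrightarrow>
    (\<exists>c<r. \<exists>l<k - 1. A = B + elem_mat r (k - 1) c l \<or> B = A + elem_mat r (k - 1) c l) \<or>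
    (\<exists>c<r. \<exists>l<k - 1. \<exists>c'<r. \<exists>l'<k - 1. (c, l) \<noteq> (c', l') \<and>
       A + elem_mat r (k - 1) c' l' = B + elem_mat r (k - 1) c l)"
  unfolding G_adj_def mat_diff_eq_iff[OF assms elem_mat_carrier elem_mat_carrier] by (rule refl)

text \<open>A difference of two units is a path that goes up from A to M and down to B.\<close>

lemma G_adj_iff_common_upper:
  assumes carrier: "A \<in> carrier_mat r (k - 1)" "B \<in> carrier_mat r (k - 1)" and distinct: "A \<noteq> B"
  shows "G_adj k r A B \<longleftrightarrow>
    (\<exists>M. adds_at_most_one_unit r (k - 1) A M \<and> adds_at_most_one_unit r (k - 1) B M)"
proof
  assume "G_adj k r A B"
  then show "\<exists>M. adds_at_most_one_unit r (k - 1) A M \<and> adds_at_most_one_unit r (k - 1) B M"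
    unfolding G_adj_iff[OF carrier] adds_at_most_one_unit_def by metis
next
  assume "\<exists>M. adds_at_most_one_unit r (k - 1) A M \<and> adds_at_most_one_unit r (k - 1) B M"
  then consider (one_unit) c l where "c < r" "l < k - 1"
      "A = B + elem_mat r (k - 1) c l \<or> B = A + elem_mat r (k - 1) c l"
    | (two_units) c l c' l' where "c < r" "l < k - 1" "c' < r" "l' < k - 1"
      "A + elem_mat r (k - 1) c' l' = B + elem_mat r (k - 1) c l"
    unfolding adds_at_most_one_unit_def using distinct by metis
  then show "G_adj k r A B"
  proof cases
    case one_unit
    then show ?thesis unfolding G_adj_iff[OF carrier] by blast
  next
    case (two_units c l c' l')
    have "(c, l) \<noteq> (c', l')"
    proof
      assume "(c, l) = (c', l')"
      then have "A + elem_mat r (k - 1) c l = B + elem_mat r (k - 1) c l" using two_units(5) by simp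
      then show False
        using distinct carrier elem_mat_carrier[of r "k - 1" c l] by (auto simp: mat_eq_iff)
    qed
    then show ?thesis unfolding G_adj_iff[OF carrier] using two_units by blast
  qed
qed

section \<open>The vertices of the graph\<close>

context
  fixes j k r :: nat
  assumes jk: "j \<ge> 2" "k \<ge> 2"
begin

abbreviation (input) "graph_verts \<equiv> G_verts j k r"
abbreviation (input) "diagrams \<equiv> young r (j - 1) (k - 1)"

lemma G_verts_iff:
  "A \<in> graph_verts \<longleftrightarrow> A \<in> carrier_mat r (k - 1) \<and>
    (\<forall>c<r. \<forall>l<k - 1. 0 \<le> A $$ (c, l) \<and> A $$ (c, l) \<le> int (j - 1) \<and>
      (\<forall>l'\<le>l. A $$ (c, l) \<le> A $$ (c, l')))" (is "_ \<longleftrightarrow> ?R")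
proof
  assume "A \<in> graph_verts"
  then have carrier: "A \<in> carrier_mat r (k - 1)" and
    entries: "\<And>c. c < r \<Longrightarrow> int j > A $$ (c, 0)"
      "\<And>c l. c < r \<Longrightarrow> l + 1 < k - 1 \<Longrightarrow> A $$ (c, l) \<ge> A $$ (c, l + 1)"
      "\<And>c. c < r \<Longrightarrow> A $$ (c, k - 2) \<ge> 0"
    by (auto simp: G_verts_def)
  have antimono: "A $$ (c, l) \<le> A $$ (c, l')" if "c < r" "l' \<le> l" "l < k - 1" for c l l'
    using that(2,3)
  proof (induction rule: dec_induct)
    case (step l)
    then show ?case using entries(2)[OF that(1), of l] by simp
  qed simp
  have "0 \<le> A $$ (c, l) \<and> A $$ (c, l) \<le> int (j - 1)" if "c < r" "l < k - 1" for c l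
    using antimono[OF that(1), of l "k - 2"] antimono[OF that(1), of 0 l]
      entries(1)[OF that(1)] entries(3)[OF that(1)] that(2) jk by force
  then show ?R using carrier antimono by auto
next
  assume bounds: ?R
  have "A $$ (c, 0) < int j" "0 \<le> A $$ (c, k - 2)" if "c < r" for c
    using bounds[THEN conjunct2, rule_format, OF that, of 0]
      bounds[THEN conjunct2, rule_format, OF that, of "k - 2"] jk by auto
  moreover have "A $$ (c, l + 1) \<le> A $$ (c, l)" if "c < r" "l + 1 < k - 1" for c l
    using bounds[THEN conjunct2, rule_format, OF that] by auto
  ultimately show "A \<in> graph_verts" using bounds by (auto simp: G_verts_def)
qed

lemma G_vertsD:
  assumes "A \<in> graph_verts"
  shows "A \<in> carrier_mat r (k - 1)"
    "\<And>c l. c < r \<Longrightarrow> l < k - 1 \<Longrightarrow> 0 \<le> A $$ (c, l)"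
    "\<And>c l. c < r \<Longrightarrow> l < k - 1 \<Longrightarrow> A $$ (c, l) \<le> int (j - 1)"
    "\<And>c l l'. c < r \<Longrightarrow> l < k - 1 \<Longrightarrow> l' \<le> l \<Longrightarrow> A $$ (c, l) \<le> A $$ (c, l')"
  using assms unfolding G_verts_iff by blast+

lemma zero_mat_G_verts: "0\<^sub>m r (k - 1) \<in> graph_verts"
  unfolding G_verts_iff by simp

lemma mat_diagram_young:
  assumes "A \<in> graph_verts"
  shows "mat_diagram A \<in> diagrams"
  unfolding young_def
proof (intro CollectI conjI allI impI subsetI)
  note mem_iff = mat_diagram_iff[OF G_vertsD(1)[OF assms]]
  show "x \<in> boxes r (j - 1) (k - 1)" if "x \<in> mat_diagram A" for x
  proof -
    obtain c a l where x_eq: "x = (c, a, l)" by (cases x) auto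
    then have "c < r" "l < k - 1" "int a < A $$ (c, l)" using that mem_iff by auto
    then show ?thesis using G_vertsD(3)[OF assms, of c l] by (simp add: x_eq boxes_def)
  qed
  fix c a l a' l' assume "(c, a, l) \<in> mat_diagram A" "a' \<le> a" "l' \<le> l"
  then show "(c, a', l') \<in> mat_diagram A"
    using G_vertsD(4)[OF assms, of c l l'] unfolding mem_iff by auto
qed

lemma height_mat_G_verts:
  assumes "S \<in> diagrams"
  shows "height_mat r (k - 1) S \<in> graph_verts"
proof -
  let ?column = "\<lambda>c l. {a. (c, a, l) \<in> S}"
  have column_subset: "?column c l \<subseteq> {..<j - 1}" for c l
    using young_subset[OF assms] by (auto simp: boxes_def)
  have finite_column: "finite (?column c l)" for c l by (rule finite_subset[OF column_subset]) simp
  have "card (?column c l) \<le> j - 1" for c l using card_mono[OF _ column_subset, of c l] by simp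
  moreover have "card (?column c l) \<le> card (?column c l')" if "l' \<le> l" for c l l'
    using finite_column by (rule card_mono) (auto elim: young_downward_closed[OF assms _ _ that])
  ultimately show ?thesis unfolding G_verts_iff by (auto simp: height_mat_def)
qed

lemma bij_betw_mat_diagram: "bij_betw mat_diagram graph_verts diagrams"
proof (rule bij_betw_byWitness[where f' = "height_mat r (k - 1)"])
  show "\<forall>A\<in>graph_verts. height_mat r (k - 1) (mat_diagram A) = A"
    using G_vertsD(1,2) by (blast intro: height_mat_mat_diagram)
  show "\<forall>S\<in>diagrams. mat_diagram (height_mat r (k - 1) S) = S"
    using mat_diagram_height_mat by blast
qed (use mat_diagram_young height_mat_G_verts in auto)

lemma mat_diagram_eq_iff:
  "A \<in> graph_verts \<Longrightarrow> B \<in> graph_verts \<Longrightarrow> mat_diagram A = mat_diagram B \<longleftrightarrow> A = B"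
  using bij_betw_imp_inj_on[OF bij_betw_mat_diagram] by (auto dest: inj_onD)

lemma finite_G_verts: "finite graph_verts"
  using bij_betw_finite[OF bij_betw_mat_diagram] finite_young by simp

lemma adds_at_most_one_mat_diagram_iff:
  assumes "A \<in> graph_verts" "B \<in> graph_verts"
  shows "adds_at_most_one (mat_diagram A) (mat_diagram B) \<longleftrightarrow>
    adds_at_most_one_unit r (k - 1) A B"
proof
  assume "adds_at_most_one (mat_diagram A) (mat_diagram B)"
  then consider (same) "mat_diagram B = mat_diagram A"
    | (new_box) c a l where "(c, a, l) \<notin> mat_diagram A"
      "mat_diagram B = insert (c, a, l) (mat_diagram A)"
    unfolding adds_at_most_one_def by auto
  then show "adds_at_most_one_unit r (k - 1) A B"
  proof cases
    case same
    then show ?thesis using mat_diagram_eq_iff[OF assms] by (simp add: adds_at_most_one_unit_def)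
  next
    case new_box
    have "c < r" "l < k - 1"
      using new_box(2) mat_diagram_iff[OF G_vertsD(1)[OF assms(2)], of c a l] by auto
    moreover have "finite (mat_diagram A)"
      using young_subset[OF mat_diagram_young[OF assms(1)]]
      by (rule finite_subset) (simp add: boxes_def)
    then have "B = A + elem_mat r (k - 1) c l"
      using height_mat_insert[OF _ new_box(1), of r "k - 1"] height_mat_mat_diagram[of A r "k - 1"]
        height_mat_mat_diagram[of B r "k - 1"] G_vertsD(1,2)[OF assms(1)] G_vertsD(1,2)[OF assms(2)]
      by (simp add: new_box(2))
    ultimately show ?thesis by (auto simp: adds_at_most_one_unit_def)
  qed
qed (use adds_at_most_one_mat_diagram G_vertsD(1,2)[OF assms(1)] in blast)

section \<open>Edge multiplicities\<close>

lemma G_adj_iff_adds_at_most_one: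
  assumes verts: "A \<in> graph_verts" "B \<in> graph_verts" "A \<noteq> B"
  shows "G_adj k r A B \<longleftrightarrow> adds_at_most_one (mat_diagram A) (mat_diagram A \<union> mat_diagram B) \<and>
    adds_at_most_one (mat_diagram B) (mat_diagram A \<union> mat_diagram B)"
    (is "_ \<longleftrightarrow> ?R")
proof
  note adj_iff = G_adj_iff_common_upper[OF verts(1,2)[THEN G_vertsD(1)] verts(3)]
  {
    assume "G_adj k r A B"
    then obtain M where upper: "adds_at_most_one (mat_diagram A) (mat_diagram M)"
        "adds_at_most_one (mat_diagram B) (mat_diagram M)"
      unfolding adj_iff using verts(1,2)[THEN G_vertsD(1)] verts(1,2)[THEN G_vertsD(2)]
        adds_at_most_one_mat_diagram by meson
    then have "mat_diagram M = mat_diagram A \<union> mat_diagram B"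
      using adds_at_most_one_common mat_diagram_eq_iff[OF verts(1,2)] verts(3) by blast
    with upper show ?R by simp
  next
    assume ?R
    moreover obtain M where "M \<in> graph_verts" "mat_diagram M = mat_diagram A \<union> mat_diagram B"
      using young_Un[OF verts(1,2)[THEN mat_diagram_young]] bij_betw_mat_diagram
      unfolding bij_betw_def by (metis imageE)
    ultimately show "G_adj k r A B"
      unfolding adj_iff using adds_at_most_one_mat_diagram_iff verts(1,2) by metis
  }
qed

lemma G_mult_distinct:
  assumes "A \<in> graph_verts" "B \<in> graph_verts" "A \<noteq> B"
  shows "G_mult j k r A B =
    card (up_steps r (j - 1) (k - 1) (mat_diagram A) \<inter> up_steps r (j - 1) (k - 1) (mat_diagram B))"
proof -
  have "up_steps r (j - 1) (k - 1) (mat_diagram A) \<inter> up_steps r (j - 1) (k - 1) (mat_diagram B) =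
      (if G_adj k r A B then {mat_diagram A \<union> mat_diagram B} else {})"
    using adds_at_most_one_common[of "mat_diagram A" _ "mat_diagram B"]
      mat_diagram_eq_iff[OF assms(1,2)]
      young_Un[OF mat_diagram_young[OF assms(1)] mat_diagram_young[OF assms(2)]] assms(3)
    by (auto simp: up_steps_def G_adj_iff_adds_at_most_one[OF assms])
  then show ?thesis using assms(3) by (simp add: G_mult_def)
qed

lemma addable_boxes_mat_diagram_iff:
  assumes "A \<in> graph_verts"
  shows "(c, a, l) \<in> addable_boxes r (j - 1) (k - 1) (mat_diagram A) \<longleftrightarrow>
    c < r \<and> a < j - 1 \<and> l < k - 1 \<and> int a = A $$ (c, l) \<and> (\<forall>l'<l. A $$ (c, l) < A $$ (c, l'))"
    (is "_ \<longleftrightarrow> ?R")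
proof
  note mem_iff = mat_diagram_iff[OF G_vertsD(1)[OF assms]]
  {
    assume "(c, a, l) \<in> addable_boxes r (j - 1) (k - 1) (mat_diagram A)"
    then have new: "(c, a, l) \<notin> mat_diagram A"
      and young_insert: "insert (c, a, l) (mat_diagram A) \<in> diagrams"
      by (auto simp: addable_boxes_def)
    have in_range: "c < r" "a < j - 1" "l < k - 1"
      using young_subset[OF young_insert] by (auto simp: boxes_def)
    have below: "int a' < A $$ (c, l)" if "a' < a" for a'
      using young_downward_closed[OF young_insert, of c a l a' l] that mem_iff by auto
    have left: "int a < A $$ (c, l')" if "l' < l" for l'
      using young_downward_closed[OF young_insert, of c a l a l'] that mem_iff by auto
    have "A $$ (c, l) \<le> int a" using new in_range mem_iff by auto
    moreover have "int a \<le> A $$ (c, l)"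
      using below[of "a - 1"] G_vertsD(2)[OF assms in_range(1,3)] by (cases a) auto
    ultimately show ?R using in_range left by auto
  next
    assume corner: ?R
    have "(c, a', l') \<in> insert (c, a, l) (mat_diagram A)" if "a' \<le> a" "l' \<le> l" for a' l'
    proof (cases "l' = l")
      case True
      then show ?thesis using corner that mem_iff by auto
    next
      case False
      then have "int a' < A $$ (c, l')" using corner that by (auto dest!: spec[of _ l'])
      then show ?thesis using corner that False mem_iff by auto
    qed
    then have "insert (c, a, l) (mat_diagram A) \<in> diagrams"
      using corner mat_diagram_young[OF assms] unfolding young_def boxes_def by auto
    moreover have "(c, a, l) \<notin> mat_diagram A" using corner mem_iff by auto
    ultimately show "(c, a, l) \<in> addable_boxes r (j - 1) (k - 1) (mat_diagram A)"
      by (simp add: addable_boxes_def)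
  }
qed

text \<open>Every column height below the maximum yields exactly one addable box, on the leftmost column
  of this height. This is why the loops count distinct row entries.\<close>

lemma leftmost_column_addable:
  assumes "A \<in> graph_verts" "c < r" "l < k - 1" "A $$ (c, l) < int j - 1"
  shows "\<exists>l'. (c, nat (A $$ (c, l)), l') \<in> addable_boxes r (j - 1) (k - 1) (mat_diagram A)"
proof -
  define l' where "l' = (LEAST l'. l' < k - 1 \<and> A $$ (c, l') = A $$ (c, l))"
  have leftmost: "l' < k - 1" "A $$ (c, l') = A $$ (c, l)"
    using LeastI[of "\<lambda>l'. l' < k - 1 \<and> A $$ (c, l') = A $$ (c, l)" l] assms(3)
    by (auto simp: l'_def)
  have "A $$ (c, l') < A $$ (c, l'')" if "l'' < l'" for l''
    using not_less_Least[OF that[unfolded l'_def]] that leftmost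
      G_vertsD(4)[OF assms(1,2) leftmost(1), of l'']
    by auto
  then have "(c, nat (A $$ (c, l)), l') \<in> addable_boxes r (j - 1) (k - 1) (mat_diagram A)"
    unfolding addable_boxes_mat_diagram_iff[OF assms(1)]
    using assms leftmost G_vertsD(2)[OF assms(1-3)] by auto
  then show ?thesis by blast
qed

lemma bij_betw_addable_boxes:
  assumes "A \<in> graph_verts"
  shows "bij_betw (\<lambda>(c, a, l). (c, int a)) (addable_boxes r (j - 1) (k - 1) (mat_diagram A))
    (SIGMA c:{..<r}. {A $$ (c, l) | l. l < k - 1 \<and> A $$ (c, l) < int j - 1})"
    (is "bij_betw ?f ?P ?V")
proof (rule bij_betw_imageI)
  note addable_iff = addable_boxes_mat_diagram_iff[OF assms]
  show "inj_on ?f ?P"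
  proof (rule inj_onI)
    fix x y assume addable: "x \<in> ?P" "y \<in> ?P" "?f x = ?f y"
    obtain c a l c' a' l' where x_eq: "x = (c, a, l)" and y_eq: "y = (c', a', l')"
      by (cases x; cases y)
    have components_eq: "c = c'" "a = a'" using addable(3) by (auto simp: x_eq y_eq)
    have "\<not> l < l'" "\<not> l' < l"
      using addable(1,2) unfolding x_eq y_eq addable_iff components_eq by (metis less_irrefl)+
    then show "x = y" by (simp add: x_eq y_eq components_eq)
  qed
  show "?f ` ?P = ?V"
  proof (intro subset_antisym subsetI)
    fix y assume "y \<in> ?f ` ?P"
    then show "y \<in> ?V" using addable_iff by fastforce
  next
    fix y assume "y \<in> ?V"
    then obtain c l where y_eq: "y = (c, A $$ (c, l))" "c < r" "l < k - 1" "A $$ (c, l) < int j - 1"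
      by auto
    obtain l' where "(c, nat (A $$ (c, l)), l') \<in> ?P"
      using leftmost_column_addable[OF assms y_eq(2-4)] by blast
    moreover have "int (nat (A $$ (c, l))) = A $$ (c, l)"
      using G_vertsD(2)[OF assms y_eq(2,3)] by simp
    ultimately show "y \<in> ?f ` ?P" using y_eq(1) by force
  qed
qed

lemma G_mult_loop:
  assumes "A \<in> graph_verts"
  shows "G_mult j k r A A = card (up_steps r (j - 1) (k - 1) (mat_diagram A))"
proof -
  let ?V = "\<lambda>c. {A $$ (c, l) | l. l < k - 1 \<and> A $$ (c, l) < int j - 1}"
  have "card (up_steps r (j - 1) (k - 1) (mat_diagram A)) = Suc (card (SIGMA c:{..<r}. ?V c))"
    using card_up_steps[OF mat_diagram_young[OF assms]]
      bij_betw_same_card[OF bij_betw_addable_boxes[OF assms]]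
    by simp
  also have "card (SIGMA c:{..<r}. ?V c) = (\<Sum>c<r. card (?V c))" by (intro card_SigmaI) auto
  finally show ?thesis by (simp add: G_mult_def)
qed

lemma G_mult_eq:
  assumes "A \<in> graph_verts" "B \<in> graph_verts"
  shows "G_mult j k r A B =
    card (up_steps r (j - 1) (k - 1) (mat_diagram A) \<inter> up_steps r (j - 1) (k - 1) (mat_diagram B))"
  using G_mult_distinct[OF assms] G_mult_loop[OF assms(1)] by (cases "A = B") auto

section \<open>Walks in the graph\<close>

lemma G_graph_edges_between:
  assumes "A \<in> graph_verts" "B \<in> graph_verts"
  shows "{e \<in> edges (G_graph j k r). ends (G_graph j k r) e = {A, B}} =
    (\<lambda>t. ({A, B}, t)) ` {..<G_mult j k r A B}"
  using assms G_mult_sym[OF assms] by (auto simp: G_graph_def doubleton_eq_iff)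

lemma finite_G_graph_edges: "finite (edges (G_graph j k r))"
proof -
  have "edges (G_graph j k r) =
      (\<Union>A\<in>graph_verts. \<Union>B\<in>graph_verts. (\<lambda>t. ({A, B}, t)) ` {..<G_mult j k r A B})"
    by (auto simp: G_graph_def)
  then show ?thesis using finite_G_verts by simp
qed

lemma card_walks_G_graph_Suc:
  assumes "A \<in> graph_verts"
  shows "card (walks (G_graph j k r) A (Suc m) Z) =
    (\<Sum>B\<in>graph_verts. G_mult j k r A B * card (walks (G_graph j k r) B m Z))"
proof -
  have verts_eq: "verts (G_graph j k r) = graph_verts" by (simp add: G_graph_def)
  have "card {e \<in> edges (G_graph j k r). ends (G_graph j k r) e = {A, B}} = G_mult j k r A B"
    if "B \<in> graph_verts" for B
    unfolding G_graph_edges_between[OF assms that] by (simp add: card_image inj_on_def)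
  then show ?thesis
    using card_walks_Suc[of "G_graph j k r" A m Z] assms finite_G_graph_edges finite_G_verts
    by (simp add: verts_eq)
qed

lemma card_walks_0:
  assumes "A \<in> graph_verts"
  shows "card (walks (G_graph j k r) A 0 (0\<^sub>m r (k - 1))) = of_bool (mat_diagram A = {})"
proof -
  have "walks (G_graph j k r) A 0 (0\<^sub>m r (k - 1)) = (if A = 0\<^sub>m r (k - 1) then {[]} else {})"
    using assms by (auto simp: walks_def G_graph_def)
  then show ?thesis
    using mat_diagram_eq_iff[OF assms zero_mat_G_verts] by (simp add: mat_diagram_zero)
qed

theorem card_walks_to_zero:
  assumes "A \<in> graph_verts"
  shows "card (walks (G_graph j k r) A m (0\<^sub>m r (k - 1))) =
    (\<Sum>S\<in>up_steps r (j - 1) (k - 1) (mat_diagram A). vacillation_count r (j - 1) (k - 1) m S)"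
  using assms
proof (induction m arbitrary: A)
  case 0
  have "up_steps r (j - 1) (k - 1) (mat_diagram A) \<inter> {S. S = {}} =
      (if mat_diagram A = {} then {{}} else {})"
    using empty_in_young by (auto simp: up_steps_def adds_at_most_one_def)
  then show ?case using card_walks_0[OF 0] finite_up_steps by (simp add: sum_of_bool_eq)
next
  case (Suc m)
  let ?up = "up_steps r (j - 1) (k - 1)" and ?down = "down_steps r (j - 1) (k - 1)"
  let ?H = "\<lambda>S. \<Sum>S'\<in>?up S. vacillation_count r (j - 1) (k - 1) m S'"
  let ?A = "?up (mat_diagram A)"
  have "card (walks (G_graph j k r) A (Suc m) (0\<^sub>m r (k - 1))) =
      (\<Sum>B\<in>graph_verts. card (?A \<inter> ?up (mat_diagram B)) * ?H (mat_diagram B))"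
    unfolding card_walks_G_graph_Suc[OF Suc.prems]
    using Suc.IH G_mult_eq[OF Suc.prems] by (intro sum.cong) auto
  also have "\<dots> = (\<Sum>S1\<in>diagrams. card (?A \<inter> ?up S1) * ?H S1)"
    by (rule sum.reindex_bij_betw[OF bij_betw_mat_diagram])
  also have "\<dots> = (\<Sum>S1\<in>diagrams. \<Sum>S\<in>{S \<in> ?A. S1 \<in> ?down S}. ?H S1)"
  proof (rule sum.cong[OF refl])
    fix S1 assume "S1 \<in> diagrams"
    then have "?A \<inter> ?up S1 = {S \<in> ?A. S1 \<in> ?down S}" by (auto simp: up_steps_def down_steps_def)
    then show "card (?A \<inter> ?up S1) * ?H S1 = (\<Sum>S\<in>{S \<in> ?A. S1 \<in> ?down S}. ?H S1)" by simp
  qed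
  also have "\<dots> = (\<Sum>S\<in>?A. \<Sum>S1\<in>{S1 \<in> diagrams. S1 \<in> ?down S}. ?H S1)"
    using finite_young finite_up_steps by (intro sum.swap_restrict)
  also have "\<dots> = (\<Sum>S\<in>?A. \<Sum>S1\<in>?down S. ?H S1)"
    by (intro sum.cong) (auto simp: down_steps_def)
  finally show ?case by simp
qed

corollary card_closed_walks_at_zero:
  "card (walks (G_graph j k r) (0\<^sub>m r (k - 1)) m (0\<^sub>m r (k - 1))) =
    vacillation_count r (j - 1) (k - 1) (Suc m) {}"
  using card_walks_to_zero[OF zero_mat_G_verts, of m]
  by (simp add: mat_diagram_zero down_steps_empty)

end

section \<open>Set partitions and their arcs\<close>

definition arc_set :: "nat set \<Rightarrow> (nat \<times> nat) set \<Rightarrow> bool" where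
  "arc_set A X \<longleftrightarrow> (\<forall>(a, b)\<in>X. a \<in> A \<and> b \<in> A \<and> a < b) \<and> single_valued X \<and> single_valued (X\<inverse>)"

definition same_chain :: "nat set \<Rightarrow> (nat \<times> nat) set \<Rightarrow> (nat \<times> nat) set" where
  "same_chain A X = {(x, y). x \<in> A \<and> y \<in> A \<and> ((x, y) \<in> X\<^sup>* \<or> (y, x) \<in> X\<^sup>*)}"

lemma arc_setD:
  assumes "arc_set A X"
  shows "(a, b) \<in> X \<Longrightarrow> a \<in> A" "(a, b) \<in> X \<Longrightarrow> b \<in> A" "(a, b) \<in> X \<Longrightarrow> a < b"
    "(a, b) \<in> X \<Longrightarrow> (a, b') \<in> X \<Longrightarrow> b = b'" "(a, b) \<in> X \<Longrightarrow> (a', b) \<in> X \<Longrightarrow> a = a'"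
  using assms by (auto simp: arc_set_def single_valued_def)

lemma partition_same_block:
  assumes "partition_on A P" "B \<in> P" "B' \<in> P" "x \<in> B" "x \<in> B'"
  shows "B = B'"
  using assms by (metis disjointD disjoint_iff partition_onD2)

lemma arc_set_arcs:
  assumes "partition_on A P"
  shows "arc_set A (arcs P)"
  unfolding arc_set_def
proof (intro conjI single_valuedI)
  show "\<forall>(a, b)\<in>arcs P. a \<in> A \<and> b \<in> A \<and> a < b"
    using partition_onD1[OF assms] by (auto simp: arcs_def)
  show "b = b'" if two_arcs: "(a, b) \<in> arcs P" "(a, b') \<in> arcs P" for a b b'
  proof -
    obtain B where "B \<in> P" "a \<in> B" "b \<in> B" "a < b" "\<forall>m\<in>B. a < m \<longrightarrow> b \<le> m"
      using two_arcs(1) by (auto simp: arcs_def)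
    moreover obtain B' where "B' \<in> P" "a \<in> B'" "b' \<in> B'" "a < b'" "\<forall>m\<in>B'. a < m \<longrightarrow> b' \<le> m"
      using two_arcs(2) by (auto simp: arcs_def)
    moreover from calculation have "B = B'" using partition_same_block[OF assms] by blast
    ultimately show ?thesis by (meson le_antisym)
  qed
  show "a = a'" if two_arcs: "(b, a) \<in> (arcs P)\<inverse>" "(b, a') \<in> (arcs P)\<inverse>" for a a' b
  proof -
    obtain B where "B \<in> P" "a \<in> B" "b \<in> B" "a < b" "\<forall>m\<in>B. a < m \<longrightarrow> b \<le> m"
      using two_arcs(1) by (auto simp: arcs_def)
    moreover obtain B' where "B' \<in> P" "a' \<in> B'" "b \<in> B'" "a' < b" "\<forall>m\<in>B'. a' < m \<longrightarrow> b \<le> m"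
      using two_arcs(2) by (auto simp: arcs_def)
    moreover from calculation have "B = B'" using partition_same_block[OF assms] by blast
    ultimately show ?thesis by (metis leD linorder_neqE_nat)
  qed
qed

lemma arcs_rtrancl_block:
  assumes "partition_on A P" "B \<in> P" "x \<in> B" "(x, y) \<in> (arcs P)\<^sup>*"
  shows "y \<in> B"
  using assms(4)
proof (induction rule: rtrancl_induct)
  case (step y z)
  then obtain B' where "B' \<in> P" "y \<in> B'" "z \<in> B'" by (auto simp: arcs_def)
  then show ?case using partition_same_block[OF assms(1,2)] step.IH by blast
qed (fact assms(3))

lemma block_arcs_rtrancl:
  assumes "B \<in> P" "x \<in> B" "y \<in> B" "x \<le> y"
  shows "(x, y) \<in> (arcs P)\<^sup>*"
  using assms(2,4)
proof (induction "y - x" arbitrary: x rule: less_induct)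
  case less
  show ?case
  proof (cases "x = y")
    case False
    define z where "z = (LEAST m. m \<in> B \<and> x < m)"
    have y_later: "y \<in> B \<and> x < y" using False less.prems assms(3) by simp
    have next_element: "z \<in> B" "x < z" "\<And>m. m \<in> B \<Longrightarrow> x < m \<Longrightarrow> z \<le> m"
      using LeastI[of "\<lambda>m. m \<in> B \<and> x < m", OF y_later] Least_le[of "\<lambda>m. m \<in> B \<and> x < m"]
      by (auto simp: z_def)
    have "(x, z) \<in> arcs P" unfolding arcs_def using assms(1) less.prems(1) next_element by blast
    moreover have "z \<le> y" using next_element(3) y_later by blast
    then have "(z, y) \<in> (arcs P)\<^sup>*" using less.hyps[of z] next_element(1,2) y_later by simp
    ultimately show ?thesis by (rule converse_rtrancl_into_rtrancl)
  qed simp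
qed

lemma same_block_iff_same_chain:
  assumes "partition_on A P"
  shows "(\<exists>p\<in>P. x \<in> p \<and> y \<in> p) \<longleftrightarrow> (x, y) \<in> same_chain A (arcs P)"
proof
  assume "\<exists>p\<in>P. x \<in> p \<and> y \<in> p"
  then obtain p where same_block: "p \<in> P" "x \<in> p" "y \<in> p" by blast
  then have "x \<in> A" "y \<in> A" using partition_onD1[OF assms] by blast+
  moreover have "(x, y) \<in> (arcs P)\<^sup>* \<or> (y, x) \<in> (arcs P)\<^sup>*"
    using block_arcs_rtrancl[OF same_block] block_arcs_rtrancl[OF same_block(1,3,2)]
      nat_le_linear[of x y] by blast
  ultimately show "(x, y) \<in> same_chain A (arcs P)" by (simp add: same_chain_def)
next
  have "\<exists>p\<in>P. x \<in> p \<and> y \<in> p" if "x \<in> A" "(x, y) \<in> (arcs P)\<^sup>*" for x y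
  proof -
    obtain p where "p \<in> P" "x \<in> p" using partition_onD1[OF assms] \<open>x \<in> A\<close> by blast
    then show ?thesis using arcs_rtrancl_block[OF assms _ _ that(2)] by blast
  qed
  moreover assume "(x, y) \<in> same_chain A (arcs P)"
  ultimately show "\<exists>p\<in>P. x \<in> p \<and> y \<in> p" unfolding same_chain_def by blast
qed

lemma partition_eq_quotient_same_chain:
  assumes "partition_on A P"
  shows "P = A // same_chain A (arcs P)"
proof -
  have "{(x, y). \<exists>p\<in>P. x \<in> p \<and> y \<in> p} = same_chain A (arcs P)"
    using same_block_iff_same_chain[OF assms] by auto
  then show ?thesis using partition_on_eq_quotient[OF assms] by simp
qed

lemma equiv_same_chain:
  assumes "arc_set A X"
  shows "equiv A (same_chain A X)"
proof (rule equivI)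
  show "same_chain A X \<subseteq> A \<times> A" by (auto simp: same_chain_def)
  show "refl_on A (same_chain A X)" by (auto simp: refl_on_def same_chain_def)
  show "sym (same_chain A X)" by (auto simp: sym_def same_chain_def)
  have single_valued: "single_valued X" "single_valued (X\<inverse>)" using assms by (auto simp: arc_set_def)
  have forward: "(y, z) \<in> X\<^sup>* \<or> (z, y) \<in> X\<^sup>*" if "(x, y) \<in> X\<^sup>*" "(x, z) \<in> X\<^sup>*" for x y z
    using single_valued_confluent[OF single_valued(1) that] .
  have backward: "(y, z) \<in> X\<^sup>* \<or> (z, y) \<in> X\<^sup>*" if "(y, x) \<in> X\<^sup>*" "(z, x) \<in> X\<^sup>*" for x y z
    using single_valued_confluent[OF single_valued(2), of x y z] that
    by (auto simp: rtrancl_converse)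
  show "trans (same_chain A X)"
  proof (rule transI)
    fix x y z assume "(x, y) \<in> same_chain A X" "(y, z) \<in> same_chain A X"
    then have in_A: "x \<in> A" "z \<in> A" and chain_xy: "(x, y) \<in> X\<^sup>* \<or> (y, x) \<in> X\<^sup>*"
      and chain_yz: "(y, z) \<in> X\<^sup>* \<or> (z, y) \<in> X\<^sup>*" by (auto simp: same_chain_def)
    have "(x, z) \<in> X\<^sup>* \<or> (z, x) \<in> X\<^sup>*"
      using chain_xy chain_yz backward[of x y z] forward[of y x z] by (meson rtrancl_trans)
    then show "(x, z) \<in> same_chain A X" using in_A by (simp add: same_chain_def)
  qed
qed

lemma same_block_quotient_iff:
  assumes "equiv A E"
  shows "(\<exists>B\<in>A // E. x \<in> B \<and> y \<in> B) \<longleftrightarrow> (x, y) \<in> E"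
proof
  assume "\<exists>B\<in>A // E. x \<in> B \<and> y \<in> B"
  then show "(x, y) \<in> E" using in_quotient_imp_in_rel[OF assms] by blast
next
  assume related: "(x, y) \<in> E"
  then have "x \<in> A" using equiv_type[OF assms] by blast
  then show "\<exists>B\<in>A // E. x \<in> B \<and> y \<in> B"
    using related quotientI[of x A E] equiv_class_self[OF assms] by blast
qed

lemma arc_set_rtrancl_le:
  assumes "arc_set A X" "(x, y) \<in> X\<^sup>*"
  shows "x \<le> y"
  using assms(2) arc_setD(3)[OF assms(1)] by (induction rule: rtrancl_induct) force+

lemma same_chain_first_arc:
  assumes "arc_set A X" "(a, b) \<in> same_chain A X" "a < b"
  obtains z where "(a, z) \<in> X" "(z, b) \<in> X\<^sup>*"
proof -
  have "(a, b) \<in> X\<^sup>*"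
    using assms(2,3) arc_set_rtrancl_le[OF assms(1), of b a] by (auto simp: same_chain_def)
  then show thesis using that assms(3) by (metis converse_rtranclE less_irrefl)
qed

lemma arcs_quotient_same_chain:
  assumes arc_set_X: "arc_set A X"
  shows "arcs (A // same_chain A X) = X"
proof (intro subset_antisym subrelI)
  let ?P = "A // same_chain A X"
  note block_iff = same_block_quotient_iff[OF equiv_same_chain[OF arc_set_X]]
  have partition: "partition_on A ?P"
    using equiv_same_chain[OF arc_set_X] by (rule partition_on_quotient)
  have arc_same_chain: "(a, b) \<in> same_chain A X" if "(a, b) \<in> X" for a b
    using that arc_setD(1,2)[OF arc_set_X that] by (auto simp: same_chain_def)
  {
    fix a b assume "(a, b) \<in> arcs ?P"
    then obtain B where block_B: "B \<in> ?P" "a \<in> B" "b \<in> B" "a < b" "\<forall>m\<in>B. a < m \<longrightarrow> b \<le> m"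
      by (auto simp: arcs_def)
    then have "(a, b) \<in> same_chain A X" using block_iff by blast
    then obtain z where first_arc: "(a, z) \<in> X" "(z, b) \<in> X\<^sup>*"
      using same_chain_first_arc[OF arc_set_X _ block_B(4)] by blast
    obtain B' where "B' \<in> ?P" "a \<in> B'" "z \<in> B'"
      using block_iff arc_same_chain[OF first_arc(1)] by blast
    then have "z \<in> B" using partition_same_block[OF partition block_B(1)] block_B(2) by blast
    then have "b \<le> z" using block_B(5) arc_setD(3)[OF arc_set_X first_arc(1)] by blast
    then show "(a, b) \<in> X" using arc_set_rtrancl_le[OF arc_set_X first_arc(2)] first_arc(1) by simp
  next
    fix a b assume arc: "(a, b) \<in> X"
    obtain B where block_B: "B \<in> ?P" "a \<in> B" "b \<in> B" using block_iff arc_same_chain[OF arc] by blast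
    have "b \<le> m" if "m \<in> B" "a < m" for m
    proof -
      have "(a, m) \<in> same_chain A X" using block_iff block_B that(1) by blast
      then obtain z where first_arc: "(a, z) \<in> X" "(z, m) \<in> X\<^sup>*"
        using same_chain_first_arc[OF arc_set_X _ \<open>a < m\<close>] by blast
      then show ?thesis
        using arc_setD(4)[OF arc_set_X arc first_arc(1)] arc_set_rtrancl_le[OF arc_set_X] by blast
    qed
    then show "(a, b) \<in> arcs ?P"
      unfolding arcs_def using block_B arc_setD(3)[OF arc_set_X arc] by blast
  }
qed

theorem bij_betw_arcs: "bij_betw arcs {P. partition_on A P} {X. arc_set A X}"
proof (rule bij_betw_byWitness[where f' = "\<lambda>X. A // same_chain A X"])
  show "\<forall>P\<in>{P. partition_on A P}. A // same_chain A (arcs P) = P"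
    using partition_eq_quotient_same_chain by blast
  show "\<forall>X\<in>{X. arc_set A X}. arcs (A // same_chain A X) = X"
    using arcs_quotient_same_chain by blast
  show "arcs ` {P. partition_on A P} \<subseteq> {X. arc_set A X}" using arc_set_arcs by blast
  show "(\<lambda>X. A // same_chain A X) ` {X. arc_set A X} \<subseteq> {P. partition_on A P}"
    using equiv_same_chain partition_on_quotient by blast
qed

section \<open>Words of openers\<close>

text \<open>A colored partition is encoded by the function that maps every closer of an arc to the colour
  and the opener of this arc.\<close>

definition valid_closings :: "nat \<Rightarrow> nat \<Rightarrow> nat \<Rightarrow> (nat \<Rightarrow> (nat \<times> nat) option) \<Rightarrow> bool" where
  "valid_closings r t n d \<longleftrightarrow> (\<forall>s\<in>{t<..n}. \<forall>c i. d s = Some (c, i) \<longrightarrow> c < r \<and> 1 \<le> i \<and> i < s \<and>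
     (\<forall>s'\<in>{t<..n}. \<forall>c'. d s' = Some (c', i) \<longrightarrow> s' = s))"

text \<open>The arcs open at time t are listed by decreasing closers, so that nestings become
  increasing and crossings decreasing subsequences of their openers.\<close>

definition open_word :: "nat \<Rightarrow> (nat \<Rightarrow> (nat \<times> nat) option) \<Rightarrow> nat \<Rightarrow> nat \<Rightarrow> nat list" where
  "open_word n d t c =
     map (\<lambda>s. snd (the (d s))) (filter (\<lambda>s. \<exists>i\<le>t. d s = Some (c, i)) (rev [Suc t..<Suc n]))"

lemma valid_closingsD:
  assumes "valid_closings r t n d" "t < s" "s \<le> n" "d s = Some (c, i)"
  shows "c < r" "1 \<le> i" "i < s"
  using assms unfolding valid_closings_def by (meson greaterThanAtMost_iff)+

lemma valid_closings_unique:
  assumes "valid_closings r t n d" "t < s" "s \<le> n" "d s = Some (c, i)" "t < s'" "s' \<le> n"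
    and "d s' = Some (c', i)"
  shows "s' = s"
  using assms unfolding valid_closings_def by (meson greaterThanAtMost_iff)

lemma valid_closings_Suc_iff:
  assumes "t < n"
  shows "valid_closings r t n d \<longleftrightarrow> valid_closings r (Suc t) n d \<and>
    (\<forall>c i. d (Suc t) = Some (c, i) \<longrightarrow> c < r \<and> i \<in> {1..t} \<and>
      (\<forall>s\<in>{Suc t<..n}. \<forall>c'. d s \<noteq> Some (c', i)))"
    (is "_ \<longleftrightarrow> _ \<and> ?first")
proof
  assume valid: "valid_closings r t n d"
  have "valid_closings r (Suc t) n d"
    unfolding valid_closings_def
  proof (intro ballI allI impI conjI)
    fix s c i assume closing: "s \<in> {Suc t<..n}" "d s = Some (c, i)"
    show "c < r" "1 \<le> i" "i < s" using valid_closingsD[OF valid _ _ closing(2)] closing(1) by auto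
    show "s' = s" if "s' \<in> {Suc t<..n}" "d s' = Some (c', i)" for s' c'
      using valid_closings_unique[OF valid _ _ closing(2) _ _ that(2)] closing(1) that(1) by simp
  qed
  moreover have ?first
  proof (intro allI impI conjI ballI)
    fix c i assume closing: "d (Suc t) = Some (c, i)"
    show "c < r" "i \<in> {1..t}" using valid_closingsD[OF valid _ _ closing] assms by auto
    show "d s \<noteq> Some (c', i)" if "s \<in> {Suc t<..n}" for s c'
      using valid_closings_unique[OF valid _ _ closing, of s c'] assms that by auto
  qed
  ultimately show "valid_closings r (Suc t) n d \<and> ?first" ..
next
  assume later: "valid_closings r (Suc t) n d \<and> ?first"
  have split: "{t<..n} = insert (Suc t) {Suc t<..n}" using assms by auto
  show "valid_closings r t n d"
    unfolding valid_closings_def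
  proof (intro ballI allI impI conjI)
    fix s c i assume closing: "s \<in> {t<..n}" "d s = Some (c, i)"
    show "c < r" "1 \<le> i" "i < s"
      using closing later valid_closingsD[of r "Suc t" n d s c i] unfolding split by auto
    show "s' = s" if "s' \<in> {t<..n}" "d s' = Some (c', i)" for s' c'
      using closing that later valid_closings_unique[of r "Suc t" n d s c i s' c']
      unfolding split by auto
  qed
qed

lemma set_open_word: "set (open_word n d t c) = {i. i \<le> t \<and> (\<exists>s\<in>{t<..n}. d s = Some (c, i))}"
proof (intro subset_antisym subsetI)
  fix i assume "i \<in> set (open_word n d t c)"
  then show "i \<in> {i. i \<le> t \<and> (\<exists>s\<in>{t<..n}. d s = Some (c, i))}"
    by (auto simp: open_word_def simp del: upt_Suc intro!: bexI)
next
  fix i assume "i \<in> {i. i \<le> t \<and> (\<exists>s\<in>{t<..n}. d s = Some (c, i))}"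
  then obtain s where "i \<le> t" "t < s" "s \<le> n" "d s = Some (c, i)" by auto
  then show "i \<in> set (open_word n d t c)"
    unfolding open_word_def by (auto simp del: upt_Suc intro!: image_eqI[of _ _ s])
qed

lemma distinct_open_word:
  assumes "valid_closings r t n d"
  shows "distinct (open_word n d t c)"
  unfolding open_word_def distinct_map
proof (intro conjI inj_onI)
  let ?open = "filter (\<lambda>s. \<exists>i\<le>t. d s = Some (c, i)) (rev [Suc t..<Suc n])"
  show "distinct ?open" by simp
  fix s s' assume both_open: "s \<in> set ?open" "s' \<in> set ?open"
    and same_opener: "snd (the (d s)) = snd (the (d s'))"
  obtain i i' where "d s = Some (c, i)" "d s' = Some (c, i')"
    using both_open by (auto simp del: upt_Suc)
  moreover have "t < s" "s \<le> n" "t < s'" "s' \<le> n" using both_open by (auto simp del: upt_Suc)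
  ultimately show "s = s'" using valid_closings_unique[OF assms, of s' c i s c] same_opener by simp
qed

lemma open_word_step:
  assumes "valid_closings r t n d" "t < n"
  shows "open_word n d t c = filter (\<lambda>x. x \<noteq> Suc t) (open_word n d (Suc t) c) @
    (case d (Suc t) of None \<Rightarrow> [] | Some (c', i) \<Rightarrow> if c' = c then [i] else [])"
proof -
  have upt_eq: "rev [Suc t..<Suc n] = rev [Suc (Suc t)..<Suc n] @ [Suc t]"
    using assms(2) by (simp add: upt_conv_Cons del: upt_Suc)
  have "filter (\<lambda>s. \<exists>i\<le>t. d s = Some (c, i)) (rev [Suc (Suc t)..<Suc n]) =
    filter (\<lambda>s. snd (the (d s)) \<noteq> Suc t)
      (filter (\<lambda>s. \<exists>i\<le>Suc t. d s = Some (c, i)) (rev [Suc (Suc t)..<Suc n]))"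
    unfolding filter_filter by (rule filter_cong) (auto simp: le_Suc_eq)
  moreover have "map (\<lambda>s. snd (the (d s))) (filter (\<lambda>s. \<exists>i\<le>t. d s = Some (c, i)) [Suc t]) =
    (case d (Suc t) of None \<Rightarrow> [] | Some (c', i) \<Rightarrow> if c' = c then [i] else [])"
    using valid_closingsD(3)[OF assms(1), of "Suc t"] assms(2) by (fastforce split: option.splits)
  ultimately show ?thesis
    unfolding open_word_def upt_eq by (simp add: filter_map o_def del: upt_Suc)
qed

lemma delete_entry_open_word:
  assumes "valid_closings r t n d"
  shows "delete_entry t (\<lambda>c. insertion_tableau (open_word n d t c)) =
    (\<lambda>c. insertion_tableau (filter (\<lambda>x. x \<noteq> t) (open_word n d t c)))"
  using insertion_tableau_delete_greatest[OF distinct_open_word[OF assms]]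
  by (simp add: delete_entry_def set_open_word fun_eq_iff)

lemma map_upt_Suc_Cons: "t < n \<Longrightarrow> map d [Suc t..<Suc n] = d (Suc t) # map d [Suc (Suc t)..<Suc n]"
  by (simp add: upt_conv_Cons del: upt_Suc)

lemma word_family_open_word:
  assumes "t \<le> n" "valid_closings r t n d"
  shows "word_family t (map d [Suc t..<Suc n]) = (\<lambda>c. insertion_tableau (open_word n d t c))"
  using assms
proof (induction rule: inc_induct)
  case base
  then show ?case by (simp add: open_word_def insertion_tableau_Nil)
next
  case (step t)
  have later: "valid_closings r (Suc t) n d"
    using step.prems valid_closings_Suc_iff[OF step.hyps(2)] by blast
  show ?case
  proof
    fix c
    show "word_family t (map d [Suc t..<Suc n]) c = insertion_tableau (open_word n d t c)"
      unfolding map_upt_Suc_Cons[OF step.hyps(2)] word_family.simps step.IH[OF later]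
        delete_entry_open_word[OF later] open_word_step[OF step.prems step.hyps(2)]
      by (auto simp: insert_entry_def insertion_tableau_snoc split: option.splits)
  qed
qed

lemma insertable_open_word_iff:
  assumes "t < n" "valid_closings r (Suc t) n d"
  shows "insertable r t (d (Suc t))
      (delete_entry (Suc t) (\<lambda>c. insertion_tableau (open_word n d (Suc t) c))) \<longleftrightarrow>
    valid_closings r t n d"
proof -
  have "i \<notin> entries (delete_entry (Suc t) (\<lambda>c. insertion_tableau (open_word n d (Suc t) c)) c) \<longleftrightarrow>
      (\<forall>s\<in>{Suc t<..n}. d s \<noteq> Some (c, i))" if "i \<in> {1..t}" for i c
    using that tableau_insertion_tableau[OF distinct_open_word[OF assms(2)], of c]
    unfolding entries_delete_entry by (auto simp: set_open_word)
  then show ?thesis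
    unfolding insertable_def valid_closings_Suc_iff[OF assms(1)] using assms(2) by blast
qed

lemma admissible_open_word_iff:
  assumes "t \<le> n"
  shows "admissible r p q t (map d [Suc t..<Suc n]) \<longleftrightarrow> valid_closings r t n d \<and>
    (\<forall>u\<in>{t..<n}. shape (\<lambda>c. insertion_tableau (open_word n d u c)) \<subseteq> boxes r p q)"
  using assms
proof (induction rule: inc_induct)
  case base
  then show ?case by (simp add: valid_closings_def)
next
  case (step t)
  let ?bounded = "\<lambda>u. shape (\<lambda>c. insertion_tableau (open_word n d u c)) \<subseteq> boxes r p q"
  let ?later = "map d [Suc (Suc t)..<Suc n]"
  have "valid_closings r (Suc t) n d \<and>
      insertable r t (d (Suc t)) (delete_entry (Suc t) (word_family (Suc t) ?later)) \<longleftrightarrow>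
      valid_closings r t n d"
    using word_family_open_word[of "Suc t" n r d] insertable_open_word_iff[OF step.hyps(2), of r d]
      valid_closings_Suc_iff[OF step.hyps(2), of r d] step.hyps(2) by auto
  then have "admissible r p q t (map d [Suc t..<Suc n]) \<longleftrightarrow> (\<forall>u\<in>{Suc t..<n}. ?bounded u) \<and>
      valid_closings r t n d \<and> shape (word_family t (map d [Suc t..<Suc n])) \<subseteq> boxes r p q"
    using step.IH unfolding map_upt_Suc_Cons[OF step.hyps(2)] admissible.simps by blast
  also have "\<dots> \<longleftrightarrow> (\<forall>u\<in>{Suc t..<n}. ?bounded u) \<and> valid_closings r t n d \<and> ?bounded t"
    using word_family_open_word[of t n r d] step.hyps by auto
  also have "\<dots> \<longleftrightarrow> valid_closings r t n d \<and> (\<forall>u\<in>insert t {Suc t..<n}. ?bounded u)" by blast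
  also have "insert t {Suc t..<n} = {t..<n}" using step.hyps by auto
  finally show ?case .
qed

lemma tableau_within_iff:
  assumes "tableau T"
  shows "(\<forall>a b. b < card (T a) \<longrightarrow> a < p \<and> b < q) \<longleftrightarrow> T p = {} \<and> card (T 0) \<le> q"
proof
  assume "\<forall>a b. b < card (T a) \<longrightarrow> a < p \<and> b < q"
  then have "\<not> 0 < card (T p)" "\<not> q < card (T 0)" by blast+
  then show "T p = {} \<and> card (T 0) \<le> q" using tableau_finite[OF assms] by (simp add: card_gt_0_iff)
next
  assume bounds: "T p = {} \<and> card (T 0) \<le> q"
  show "\<forall>a b. b < card (T a) \<longrightarrow> a < p \<and> b < q"
  proof (intro allI impI conjI)
    fix a b assume box: "b < card (T a)"
    then show "b < q" using bounds tableau_card_antimono[OF assms, of 0 a] by simp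
    show "a < p" using bounds box tableau_nonempty_antimono[OF assms, of p a] by force
  qed
qed

lemma shape_insertion_tableaux_subset_iff:
  assumes "\<And>c. distinct (w c)" "\<And>c. r \<le> c \<Longrightarrow> w c = []"
  shows "shape (\<lambda>c. insertion_tableau (w c)) \<subseteq> boxes r p q \<longleftrightarrow>
    (\<forall>c. \<not> has_chain (>) (Suc p) (w c) \<and> \<not> has_chain (<) (Suc q) (w c))"
proof -
  let ?T = "\<lambda>c. insertion_tableau (w c)"
  have "c < r" if "b < card (?T c a)" for c a b
    using assms(2)[of c] that by (cases "c < r") (auto simp: insertion_tableau_Nil)
  then have "shape ?T \<subseteq> boxes r p q \<longleftrightarrow> (\<forall>c. \<forall>a b. b < card (?T c a) \<longrightarrow> a < p \<and> b < q)"
    unfolding shape_def boxes_def subset_iff by auto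
  also have "\<dots> \<longleftrightarrow> (\<forall>c. ?T c p = {} \<and> card (?T c 0) \<le> q)"
    using tableau_within_iff tableau_insertion_tableau[OF assms(1)] by blast
  also have "\<dots> \<longleftrightarrow> (\<forall>c. \<not> has_chain (>) (Suc p) (w c) \<and> \<not> has_chain (<) (Suc q) (w c))"
    unfolding schensted_increasing[OF assms(1)] schensted_decreasing[OF assms(1)]
    by (simp add: not_less_eq_eq)
  finally show ?thesis .
qed

section \<open>Crossings and nestings as chains of openers\<close>

definition closings :: "nat set set \<times> coloring \<Rightarrow> nat \<Rightarrow> (nat \<times> nat) option" where
  "closings \<Lambda> s = (if \<exists>i. (i, s) \<in> arcs (fst \<Lambda>)
     then let i = (THE i. (i, s) \<in> arcs (fst \<Lambda>)) in Some (snd \<Lambda> (i, s) - 1, i) else None)"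

definition arc_chain ::
    "(nat \<Rightarrow> nat \<Rightarrow> bool) \<Rightarrow> nat set set \<Rightarrow> coloring \<Rightarrow> (nat \<times> nat) list \<Rightarrow> bool" where
  "arc_chain R P \<phi> as \<longleftrightarrow> set as \<subseteq> arcs P \<and> monochromatic \<phi> as \<and> sorted_wrt (>) (map snd as) \<and>
     sorted_wrt R (map fst as) \<and> (\<forall>a\<in>set as. \<forall>b\<in>set as. fst a < snd b)"

lemma crossing_iff_arc_chain:
  "is_crossing P as \<and> monochromatic \<phi> as \<longleftrightarrow> arc_chain (>) P \<phi> (rev as)"
  by (auto simp: is_crossing_def arc_chain_def monochromatic_def sorted_wrt_append
      sorted_wrt_rev rev_map[symmetric])

lemma nesting_iff_arc_chain:
  "is_nesting P as \<and> monochromatic \<phi> as \<longleftrightarrow> arc_chain (<) P \<phi> as"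
  by (auto simp: is_nesting_def arc_chain_def sorted_wrt_append sorted_wrt_rev)

lemma cr_eq_Max_arc_chain: "cr (P, \<phi>) = Max {length as | as. arc_chain (>) P \<phi> as}"
proof -
  have "{length as | as. arc_chain (>) P \<phi> (rev as)} = {length as | as. arc_chain (>) P \<phi> as}"
    by (metis length_rev rev_rev_ident)
  then show ?thesis by (simp add: cr_def crossing_iff_arc_chain)
qed

lemma ne_eq_Max_arc_chain: "ne (P, \<phi>) = Max {length as | as. arc_chain (<) P \<phi> as}"
  by (simp add: ne_def nesting_iff_arc_chain)

lemma closings_iff:
  assumes "partition_on A P"
  shows "closings (P, \<phi>) s = Some (c, i) \<longleftrightarrow> (i, s) \<in> arcs P \<and> c = \<phi> (i, s) - 1"
proof (cases "\<exists>i. (i, s) \<in> arcs P")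
  case True
  then obtain i' where arc: "(i', s) \<in> arcs P" by blast
  note unique = arc_setD(5)[OF arc_set_arcs[OF assms] _ arc]
  have "(THE i. (i, s) \<in> arcs P) = i'" using arc unique by (rule the_equality)
  then show ?thesis using arc unique[of i] by (auto simp: closings_def Let_def)
qed (auto simp: closings_def)

lemma colored_partitionsD:
  assumes "(P, \<phi>) \<in> colored_partitions n r"
  shows "partition_on {1..n} P" "\<phi> \<in> arcs P \<rightarrow>\<^sub>E {1..r}"
    "x \<in> arcs P \<Longrightarrow> 1 \<le> \<phi> x" "x \<in> arcs P \<Longrightarrow> \<phi> x \<le> r"
    "(a, b) \<in> arcs P \<Longrightarrow> 1 \<le> a \<and> a < b \<and> b \<le> n"
proof -
  show partition_P: "partition_on {1..n} P" and \<phi>: "\<phi> \<in> arcs P \<rightarrow>\<^sub>E {1..r}"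
    using assms by (auto simp: colored_partitions_def)
  show "1 \<le> \<phi> x" "\<phi> x \<le> r" if "x \<in> arcs P" using PiE_mem[OF \<phi> that] by auto
  show "1 \<le> a \<and> a < b \<and> b \<le> n" if "(a, b) \<in> arcs P"
    using arc_setD(1-3)[OF arc_set_arcs[OF partition_P] that] by simp
qed

lemma valid_closings_closings:
  assumes "(P, \<phi>) \<in> colored_partitions n r"
  shows "valid_closings r t n (closings (P, \<phi>))"
  unfolding valid_closings_def
proof (intro ballI allI impI conjI)
  note partition = colored_partitionsD[OF assms]
  fix s c i assume "closings (P, \<phi>) s = Some (c, i)"
  then have arc: "(i, s) \<in> arcs P" "c = \<phi> (i, s) - 1" using closings_iff[OF partition(1)] by auto
  show "c < r" using partition(3,4)[OF arc(1)] arc(2) by linarith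
  show "1 \<le> i" "i < s" using partition(5)[OF arc(1)] by auto
  show "s' = s" if "closings (P, \<phi>) s' = Some (c', i)" for s' c'
    using that closings_iff[OF partition(1)] arc_setD(4)[OF arc_set_arcs[OF partition(1)]] arc(1)
    by blast
qed

lemma subseq_map_iff: "subseq s (map f xs) \<longleftrightarrow> (\<exists>ys. subseq ys xs \<and> s = map f ys)"
  unfolding subseq_conv_nths by (auto simp: nths_map)

lemma subseq_strict_sorted_iff:
  fixes xs ys :: "'a::linorder list"
  assumes "sorted_wrt (<) ys"
  shows "subseq xs ys \<longleftrightarrow> sorted_wrt (<) xs \<and> set xs \<subseteq> set ys"
  using assms sorted_wrt_subseq[of xs ys] set_subseq[of xs ys]
    sorted_subset_imp_subseq[of xs ys] strict_sorted_imp_sorted by blast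

lemma subseq_filter_rev_upt_iff:
  "subseq xs (filter Q (rev [a..<b])) \<longleftrightarrow> sorted_wrt (>) xs \<and> (\<forall>x\<in>set xs. a \<le> x \<and> x < b \<and> Q x)"
proof -
  have "subseq xs (filter Q (rev [a..<b])) \<longleftrightarrow> subseq (rev xs) (filter Q [a..<b])"
    using subseq_rev_iff[of "rev xs" "filter Q [a..<b]"] by (simp add: rev_filter)
  also have "\<dots> \<longleftrightarrow> sorted_wrt (<) (rev xs) \<and> set (rev xs) \<subseteq> set (filter Q [a..<b])"
    by (rule subseq_strict_sorted_iff) (simp add: sorted_wrt_filter)
  finally show ?thesis by (auto simp: sorted_wrt_rev)
qed

lemma has_chain_open_word_iff:
  "has_chain R m (open_word n d t c) \<longleftrightarrow> (\<exists>ss. sorted_wrt (>) ss \<and> length ss = m \<and>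
    sorted_wrt R (map (\<lambda>s. snd (the (d s))) ss) \<and>
    (\<forall>s\<in>set ss. t < s \<and> s \<le> n \<and> (\<exists>i\<le>t. d s = Some (c, i))))"
  unfolding has_chain_def open_word_def subseq_map_iff subseq_filter_rev_upt_iff
  by (auto simp: Suc_le_eq less_Suc_eq_le)

lemma arc_chain_imp_has_chain:
  assumes "(P, \<phi>) \<in> colored_partitions n r" "arc_chain R P \<phi> as" "as \<noteq> []"
  shows "\<exists>t<n. \<exists>c. has_chain R (length as) (open_word n (closings (P, \<phi>)) t c)"
proof -
  note partition = colored_partitionsD[OF assms(1)]
  let ?d = "closings (P, \<phi>)"
  have chain: "set as \<subseteq> arcs P" "sorted_wrt (>) (map snd as)" "sorted_wrt R (map fst as)"
    "\<And>a b. a \<in> set as \<Longrightarrow> b \<in> set as \<Longrightarrow> fst a < snd b"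
    using assms(2) by (auto simp: arc_chain_def)
  obtain c where colour: "\<And>a. a \<in> set as \<Longrightarrow> \<phi> a = c"
    using assms(2) by (auto simp: arc_chain_def monochromatic_def)
  have closings_chain: "?d (snd a) = Some (c - 1, fst a)" if "a \<in> set as" for a
    using that colour[OF that] chain(1) closings_iff[OF partition(1), of \<phi> "snd a" "c - 1" "fst a"]
    by auto
  define t where "t = Max (fst ` set as)"
  have opener_le: "fst a \<le> t" if "a \<in> set as" for a using that by (simp add: t_def)
  have "t \<in> fst ` set as" unfolding t_def using assms(3) by (intro Max_in) auto
  then obtain a0 where last_opener: "a0 \<in> set as" "t = fst a0" by blast
  have open_at_t: "t < snd a \<and> snd a \<le> n" if "a \<in> set as" for a
    using chain(4)[OF last_opener(1) that] last_opener(2) chain(1) that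
      partition(5)[of "fst a" "snd a"] by auto
  have "t < n" using open_at_t[OF last_opener(1)] by simp
  moreover have "has_chain R (length as) (open_word n ?d t (c - 1))"
    unfolding has_chain_open_word_iff
  proof (intro exI[of _ "map snd as"] conjI)
    have "map (\<lambda>s. snd (the (?d s))) (map snd as) = map fst as" using closings_chain by simp
    then show "sorted_wrt R (map (\<lambda>s. snd (the (?d s))) (map snd as))"
      using chain(3) by (simp only:)
    show "\<forall>s\<in>set (map snd as). t < s \<and> s \<le> n \<and> (\<exists>i\<le>t. ?d s = Some (c - 1, i))"
      using closings_chain opener_le open_at_t by fastforce
  qed (use chain(2) in simp_all)
  ultimately show ?thesis by blast
qed

lemma has_chain_imp_arc_chain:
  assumes "(P, \<phi>) \<in> colored_partitions n r" "has_chain R m (open_word n (closings (P, \<phi>)) t c)"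
  shows "\<exists>as. arc_chain R P \<phi> as \<and> length as = m"
proof -
  note partition = colored_partitionsD[OF assms(1)]
  let ?d = "closings (P, \<phi>)"
  obtain ss where closers: "sorted_wrt (>) ss" "length ss = m"
    "sorted_wrt R (map (\<lambda>s. snd (the (?d s))) ss)"
    "\<And>s. s \<in> set ss \<Longrightarrow> t < s \<and> s \<le> n \<and> (\<exists>i\<le>t. ?d s = Some (c, i))"
    using assms(2) unfolding has_chain_open_word_iff by blast
  define as where "as = map (\<lambda>s. (snd (the (?d s)), s)) ss"
  have open_arcs: "fst a \<le> t \<and> t < snd a \<and> a \<in> arcs P \<and> \<phi> a = Suc c" if "a \<in> set as" for a
  proof -
    obtain s where closer: "s \<in> set ss" "a = (snd (the (?d s)), s)"
      using \<open>a \<in> set as\<close> by (auto simp: as_def)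
    obtain i where opener: "i \<le> t" "?d s = Some (c, i)" "t < s"
      using closers(4)[OF closer(1)] by blast
    have "a = (i, s)" using closer(2) opener by simp
    moreover have "(i, s) \<in> arcs P" "c = \<phi> (i, s) - 1"
      using opener(2) closings_iff[OF partition(1)] by auto
    ultimately show ?thesis using opener partition(3)[of "(i, s)"] by simp
  qed
  have "map snd as = ss" "map fst as = map (\<lambda>s. snd (the (?d s))) ss"
    by (simp_all add: as_def comp_def)
  moreover have "monochromatic \<phi> as" using open_arcs by (auto simp: monochromatic_def)
  moreover have "\<forall>a\<in>set as. \<forall>b\<in>set as. fst a < snd b" using open_arcs by (meson le_less_trans)
  moreover have "set as \<subseteq> arcs P" using open_arcs by blast
  moreover have "length as = m" using closers(2) by (simp add: as_def)
  ultimately show ?thesis using closers(1,3) unfolding arc_chain_def by (intro exI[of _ as]) simp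
qed

lemma length_arc_chain_le:
  assumes "(P, \<phi>) \<in> colored_partitions n r" "arc_chain R P \<phi> as"
  shows "length as \<le> n"
proof -
  have "snd a \<in> {1..n}" if "a \<in> set as" for a
  proof -
    have "(fst a, snd a) \<in> arcs P" using assms(2) that by (auto simp: arc_chain_def)
    then show ?thesis using colored_partitionsD(5)[OF assms(1), of "fst a" "snd a"] by simp
  qed
  then have "set (rev (map snd as)) \<subseteq> {1..n}" by auto
  moreover have "sorted_wrt (<) (rev (map snd as))"
    using assms(2) by (simp add: arc_chain_def sorted_wrt_rev)
  then have "distinct (rev (map snd as))" using strict_sorted_iff by blast
  ultimately show ?thesis
    using distinct_card[of "rev (map snd as)"] card_mono[of "{1..n}" "set (rev (map snd as))"]
    by simp
qed

lemma Max_length_arc_chain_less_iff: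
  assumes "(P, \<phi>) \<in> colored_partitions n r" "1 \<le> j"
  shows "Max {length as | as. arc_chain R P \<phi> as} < j \<longleftrightarrow>
    (\<forall>t<n. \<forall>c. \<not> has_chain R j (open_word n (closings (P, \<phi>)) t c))"
proof -
  let ?L = "{length as | as. arc_chain R P \<phi> as}"
  have "?L \<subseteq> {..n}" using length_arc_chain_le[OF assms(1)] by auto
  then have "finite ?L" by (rule finite_subset) simp
  moreover have "arc_chain R P \<phi> []" by (simp add: arc_chain_def monochromatic_def)
  then have "?L \<noteq> {}" by blast
  ultimately have "Max ?L < j \<longleftrightarrow> (\<forall>as. arc_chain R P \<phi> as \<longrightarrow> length as < j)"
    by (subst Max_less_iff) auto
  also have "\<dots> \<longleftrightarrow> (\<forall>t<n. \<forall>c. \<not> has_chain R j (open_word n (closings (P, \<phi>)) t c))"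
  proof
    assume "\<forall>as. arc_chain R P \<phi> as \<longrightarrow> length as < j"
    then show "\<forall>t<n. \<forall>c. \<not> has_chain R j (open_word n (closings (P, \<phi>)) t c)"
      using has_chain_imp_arc_chain[OF assms(1)] by (metis less_irrefl)
  next
    assume no_chain: "\<forall>t<n. \<forall>c. \<not> has_chain R j (open_word n (closings (P, \<phi>)) t c)"
    show "\<forall>as. arc_chain R P \<phi> as \<longrightarrow> length as < j"
    proof (intro allI impI, rule ccontr)
      fix as assume long_chain: "arc_chain R P \<phi> as" "\<not> length as < j"
      then have "as \<noteq> []" using assms(2) by auto
      from arc_chain_imp_has_chain[OF assms(1) long_chain(1) this] obtain t c where
        chain_at: "t < n" "has_chain R (length as) (open_word n (closings (P, \<phi>)) t c)" by blast
      then have "has_chain R j (open_word n (closings (P, \<phi>)) t c)"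
        using has_chain_antimono[OF chain_at(2)] long_chain(2) by simp
      then show False using no_chain chain_at(1) by blast
    qed
  qed
  finally show ?thesis .
qed

section \<open>Colored partitions as insertion words\<close>

lemma admissible_closings_iff:
  assumes "(P, \<phi>) \<in> colored_partitions n r" "1 \<le> j" "1 \<le> k"
  shows "admissible r (j - 1) (k - 1) 0 (map (closings (P, \<phi>)) [Suc 0..<Suc n]) \<longleftrightarrow>
    cr (P, \<phi>) < j \<and> ne (P, \<phi>) < k"
proof -
  let ?w = "open_word n (closings (P, \<phi>))"
  note valid = valid_closings_closings[OF assms(1)]
  have "i \<notin> set (?w t c)" if "r \<le> c" for i t c
    using valid_closingsD(1)[OF valid, of t _ c i] that unfolding set_open_word by auto
  then have "?w t c = []" if "r \<le> c" for t c using that by (metis list.set_intros(1) neq_Nil_conv)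
  then have "shape (\<lambda>c. insertion_tableau (?w t c)) \<subseteq> boxes r (j - 1) (k - 1) \<longleftrightarrow>
      (\<forall>c. \<not> has_chain (>) j (?w t c) \<and> \<not> has_chain (<) k (?w t c))" for t
    using shape_insertion_tableaux_subset_iff[of "?w t" r "j - 1" "k - 1"]
      distinct_open_word[OF valid] assms(2,3) by simp
  then have "admissible r (j - 1) (k - 1) 0 (map (closings (P, \<phi>)) [Suc 0..<Suc n]) \<longleftrightarrow>
      (\<forall>t<n. \<forall>c. \<not> has_chain (>) j (?w t c) \<and> \<not> has_chain (<) k (?w t c))"
    using admissible_open_word_iff[of 0 n r "j - 1" "k - 1" "closings (P, \<phi>)"] valid by auto
  then show ?thesis
    unfolding cr_eq_Max_arc_chain ne_eq_Max_arc_chain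
      Max_length_arc_chain_less_iff[OF assms(1,2)] Max_length_arc_chain_less_iff[OF assms(1,3)]
    by blast
qed

lemma inj_on_closings:
  "inj_on (\<lambda>\<Lambda>. map (closings \<Lambda>) [Suc 0..<Suc n]) (colored_partitions n r)"
proof (rule inj_onI)
  fix \<Lambda> \<Lambda>' assume members: "\<Lambda> \<in> colored_partitions n r" "\<Lambda>' \<in> colored_partitions n r"
    and words_eq: "map (closings \<Lambda>) [Suc 0..<Suc n] = map (closings \<Lambda>') [Suc 0..<Suc n]"
  obtain P \<phi> P' \<phi>' where \<Lambda>: "\<Lambda> = (P, \<phi>)" "\<Lambda>' = (P', \<phi>')" by (cases \<Lambda>; cases \<Lambda>')
  note partition = colored_partitionsD[OF members(1)[unfolded \<Lambda>]]
    and partition' = colored_partitionsD[OF members(2)[unfolded \<Lambda>]]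
  have same: "(i, s) \<in> arcs P \<and> c = \<phi> (i, s) - 1 \<longleftrightarrow> (i, s) \<in> arcs P' \<and> c = \<phi>' (i, s) - 1" for i s c
  proof (cases "1 \<le> s \<and> s \<le> n")
    case True
    then have "closings (P, \<phi>) s = closings (P', \<phi>') s"
      using words_eq unfolding \<Lambda> by (simp add: map_eq_conv del: upt_Suc)
    then show ?thesis
      using closings_iff[OF partition(1), of \<phi> s c i] closings_iff[OF partition'(1), of \<phi>' s c i]
      by simp
  next
    case False
    then show ?thesis using partition(5)[of i s] partition'(5)[of i s] by linarith
  qed
  then have arcs: "arcs P = arcs P'" by auto
  then have "P = P'"
    using bij_betw_imp_inj_on[OF bij_betw_arcs] partition(1) partition'(1) by (auto dest: inj_onD)
  moreover have "\<phi> = \<phi>'"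
  proof (rule PiE_ext[OF partition(2)])
    show "\<phi>' \<in> arcs P \<rightarrow>\<^sub>E {1..r}" using partition'(2) arcs by simp
    fix x assume arc: "x \<in> arcs P"
    then have "\<phi> x - 1 = \<phi>' x - 1" using same[of "fst x" "snd x" "\<phi> x - 1"] by simp
    moreover have "1 \<le> \<phi> x" "1 \<le> \<phi>' x" using partition(3) partition'(3) arc arcs by auto
    ultimately show "\<phi> x = \<phi>' x" by linarith
  qed
  ultimately show "\<Lambda> = \<Lambda>'" using \<Lambda> by simp
qed

lemma closings_surj:
  assumes "valid_closings r 0 n d" "\<And>s x. d s = Some x \<Longrightarrow> 0 < s \<and> s \<le> n"
  shows "\<exists>\<Lambda>\<in>colored_partitions n r. closings \<Lambda> = d"
proof -
  have bound: "0 < s" "s \<le> n" if "d s = Some x" for s x using assms(2)[OF that] by auto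
  have valid: "c < r" "1 \<le> i" "i < s" if "d s = Some (c, i)" for s c i
    using valid_closingsD[OF assms(1) bound[OF that] that] by auto
  have unique: "s' = s" if "d s = Some (c, i)" "d s' = Some (c', i)" for s s' c c' i
    using valid_closings_unique[OF assms(1) bound[OF that(1)] that(1) bound[OF that(2)] that(2)] .
  define X where "X = {(i, s). \<exists>c. d s = Some (c, i)}"
  have "single_valued X" using unique by (auto simp: X_def single_valued_def)
  moreover have "single_valued (X\<inverse>)" by (auto simp: X_def single_valued_def)
  moreover have "a \<in> {1..n} \<and> b \<in> {1..n} \<and> a < b" if "d b = Some (c, a)" for a b c
    using bound[OF that] valid[OF that] by auto
  ultimately have "arc_set {1..n} X" by (auto simp: arc_set_def X_def)
  then obtain P where partition_P: "partition_on {1..n} P" "arcs P = X"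
    using bij_betw_arcs[of "{1..n}"]
    unfolding bij_betw_def by (metis (mono_tags) imageE mem_Collect_eq)
  define \<phi> where "\<phi> = restrict (\<lambda>x. Suc (fst (the (d (snd x))))) X"
  have "\<phi> \<in> arcs P \<rightarrow>\<^sub>E {1..r}"
    unfolding \<phi>_def partition_P(2)
    by (rule restrict_PiE_iff[THEN iffD2]) (auto simp: X_def Suc_le_eq dest: valid)
  then have "(P, \<phi>) \<in> colored_partitions n r"
    using partition_P(1) by (simp add: colored_partitions_def)
  moreover have "closings (P, \<phi>) s = d s" for s
  proof (cases "d s")
    case None
    then have "\<nexists>i. (i, s) \<in> arcs P" by (simp add: partition_P(2) X_def)
    then show ?thesis using None by (simp add: closings_def)
  next
    case (Some x)
    obtain c i where x_eq: "x = (c, i)" by (cases x)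
    then have "(i, s) \<in> X" "\<phi> (i, s) = Suc c" using Some by (auto simp: X_def \<phi>_def)
    then show ?thesis
      using closings_iff[OF partition_P(1), of \<phi> s c i] Some x_eq partition_P(2) by simp
  qed
  ultimately show ?thesis by blast
qed

lemma admissible_word_of_closings:
  assumes "admissible r p q 0 ds"
  shows "\<exists>\<Lambda>\<in>colored_partitions (length ds) r. ds = map (closings \<Lambda>) [Suc 0..<Suc (length ds)]"
proof -
  define d where "d s = (if 1 \<le> s \<and> s \<le> length ds then ds ! (s - 1) else None)" for s
  have word_eq: "map d [Suc 0..<Suc (length ds)] = ds"
    by (rule nth_equalityI) (auto simp: d_def simp del: upt_Suc)
  have "valid_closings r 0 (length ds) d"
    using admissible_open_word_iff[of 0 "length ds" r p q d] assms word_eq by simp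
  moreover have "0 < s \<and> s \<le> length ds" if "d s = Some x" for s x
    using that by (auto simp: d_def split: if_splits)
  ultimately obtain \<Lambda> where "\<Lambda> \<in> colored_partitions (length ds) r" "closings \<Lambda> = d"
    using closings_surj by blast
  with word_eq show ?thesis by metis
qed

lemma word_family_0:
  assumes "admissible r p q 0 ds"
  shows "word_family 0 ds = (\<lambda>_ _. {})"
  using tableau_familyD(6)[OF tableau_family_word_family[OF assms]] by (auto simp: fun_eq_iff)

lemma bij_betw_closings:
  assumes "1 \<le> j" "1 \<le> k"
  shows "bij_betw (\<lambda>\<Lambda>. map (closings \<Lambda>) [Suc 0..<Suc n])
    {\<Lambda> \<in> colored_partitions n r. cr \<Lambda> < j \<and> ne \<Lambda> < k}
    (admissible_words r (j - 1) (k - 1) n 0 (\<lambda>_ _. {}))" (is "bij_betw ?f ?C ?W")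
proof (rule bij_betw_imageI)
  show "inj_on ?f ?C" by (rule inj_on_subset[OF inj_on_closings]) auto
  have admissible_iff: "admissible r (j - 1) (k - 1) 0 (?f \<Lambda>) \<longleftrightarrow> cr \<Lambda> < j \<and> ne \<Lambda> < k"
    if "\<Lambda> \<in> colored_partitions n r" for \<Lambda>
    using admissible_closings_iff[of "fst \<Lambda>" "snd \<Lambda>"] that assms by simp
  have words_iff: "?W = {ds. length ds = n \<and> admissible r (j - 1) (k - 1) 0 ds}"
    using word_family_0 by (auto simp: admissible_words_def)
  show "?f ` ?C = ?W"
  proof (intro subset_antisym subsetI)
    fix ds assume "ds \<in> ?f ` ?C"
    then obtain \<Lambda> where "\<Lambda> \<in> ?C" "ds = ?f \<Lambda>" by blast
    then show "ds \<in> ?W" unfolding words_iff using admissible_iff by simp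
  next
    fix ds assume "ds \<in> ?W"
    then have word: "length ds = n" "admissible r (j - 1) (k - 1) 0 ds"
      unfolding words_iff by simp_all
    obtain \<Lambda> where "\<Lambda> \<in> colored_partitions n r" "ds = ?f \<Lambda>"
      using admissible_word_of_closings[OF word(2)] word(1) by blast
    then show "ds \<in> ?f ` ?C" using admissible_iff word(2) by blast
  qed
qed

theorem NCN_eq_vacillation_count:
  assumes "1 \<le> j" "1 \<le> k"
  shows "NCN j k n r = vacillation_count r (j - 1) (k - 1) n {}"
proof -
  have "NCN j k n r = card (admissible_words r (j - 1) (k - 1) n 0 (\<lambda>_ _. {}))"
    unfolding NCN_def by (rule bij_betw_same_card[OF bij_betw_closings[OF assms]])
  then show ?thesis using card_admissible_words[OF tableau_family_empty] by simp
qed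

theorem theorem3p5:
  fixes j k r n :: nat
  assumes "j \<ge> 2" and "k \<ge> 2" and "r \<ge> 1" and "n \<ge> 1"
  shows "NCN j k n r =
    card {es. walk (G_graph j k r) (0\<^sub>m r (k - 1)) es (0\<^sub>m r (k - 1)) \<and> length es = n - 1}"
proof -
  have "NCN j k n r = vacillation_count r (j - 1) (k - 1) (Suc (n - 1)) {}"
    using NCN_eq_vacillation_count[of j k n r] assms by simp
  also have "\<dots> = card (walks (G_graph j k r) (0\<^sub>m r (k - 1)) (n - 1) (0\<^sub>m r (k - 1)))"
    by (rule card_closed_walks_at_zero[OF assms(1,2), symmetric])
  finally show ?thesis by (simp only: walks_def)
qed

end
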